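(* Let $0\le\alpha<d$ and $1<p\le q<\infty$ be such that $\frac1p-\frac1q\le\frac{\alpha}{d}$, and let $\Phi$ be a Young function with $\bar\Phi\in B_{p,q}$. If $(U,V)$ is a pair of $n\times n$ matrix weights on $\mathbb{R}^d$ such that $$[U,V]_{p,q,\Phi}=\sup_Q |Q|^{\frac{\alpha}{d}+\frac1q-\frac1p}\left(\frac{1}{|Q|}\int_Q \big\|U(x)^{\frac1q}V^{-\frac1p}\big\|_{\Phi,Q}^{q}\,dx\right)^{\frac1q}<\infty,$$ where the supremum is over all cubes $Q$, then $M_{\alpha,U,V}:L^p(\mathbb{R}^d,\mathbb{C}^n)\to L^q(\mathbb{R}^d,\mathbb{C}^n)$, i.e. there is a constant $C<\infty$ such that $\|M_{\alpha,U,V}f\|_{L^q(\mathbb{R}^d)}\le C\|f\|_{L^p(\mathbb{R}^d,\mathbb{C}^n)}$ for all $f\in L^p(\mathbb{R}^d,\mathbb{C}^n)$.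
   Context: Cubes $Q\subset\mathbb{R}^d$ have edges parallel to the coordinate axes. A matrix weight is an $n\times n$ self-adjoint matrix function $U$ on $\mathbb{R}^d$ with locally integrable entries such that $U(x)$ is positive definite for a.e. $x$; powers $U^r$, $r\in\mathbb{R}$, are defined by diagonalization. $|\cdot|_{\mathrm{op}}$ is the operator norm on $n\times n$ matrices. A Young function is a convex, increasing $\Phi:[0,\infty)\to[0,\infty)$ with $\Phi(0)=0$ and $\Phi(t)/t\to\infty$ as $t\to\infty$; its associate function is $\bar\Phi(t)=\sup_{s>0}\{st-\Phi(s)\}$. A Young function $\Phi$ is in $B_{p,q}$ if $\int_1^\infty \frac{\Phi(t)^{q/p}}{t^q}\frac{dt}{t}<\infty$ (for $p=q$ this is the $B_p$ condition $\int_1^\infty\frac{\Phi(t)}{t^p}\frac{dt}{t}<\infty$). The localized Orlicz norm is $\|f\|_{\Phi,Q}=\inf\{\lambda>0:\frac1{|Q|}\int_Q\Phi(|f(x)|/\lambda)\,dx\le1\}$. For a matrix function $A$, $\|A\|_{\Phi,Q}$ means $\||A|_{\mathrm{op}}\|_{\Phi,Q}$; thus $\|U(x)^{1/q}V^{-1/p}\|_{\Phi,Q}$ is, for fixed $x$, the Orlicz norm of $y\mapsto|U(x)^{1/q}V(y)^{-1/p}|_{\mathrm{op}}$. For the given $p,q$, the matrix weighted fractional maximal operator is $$M_{\alpha,U,V}f(x)=\sup_{Q\ni x}\frac{1}{|Q|^{1-\frac{\alpha}{d}}}\int_Q|U(x)^{\frac1q}V(y)^{-\frac1p}f(y)|\,dy.$$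 *)

theory Defs
  imports "HOL-Analysis.Analysis"
begin

definition mat_adjoint :: "complex^'n^'n \<Rightarrow> complex^'n^'n" where
  "mat_adjoint A = (\<chi> i j. cnj (A $ j $ i))"

definition self_adjoint :: "complex^'n^'n \<Rightarrow> bool" where
  "self_adjoint A \<longleftrightarrow> mat_adjoint A = A"

definition unitary :: "complex^'n^'n \<Rightarrow> bool" where
  "unitary P \<longleftrightarrow> P ** mat_adjoint P = mat 1 \<and> mat_adjoint P ** P = mat 1"

text \<open>For self-adjoint \<open>A\<close> the Hermitian form below is real, so taking its real part loses nothing.\<close>

definition pos_definite :: "complex^'n^'n \<Rightarrow> bool" where
  "pos_definite A \<longleftrightarrow> self_adjoint A \<and>
     (\<forall>v. v \<noteq> 0 \<longrightarrow> 0 < Re (\<Sum>i\<in>UNIV. (A *v v) $ i * cnj (v $ i)))"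

definition real_diag :: "real^'n \<Rightarrow> complex^'n^'n" where
  "real_diag e = (\<chi> i j. if i = j then of_real (e $ i) else 0)"

text \<open>Powers by unitary diagonalization. For a positive definite matrix the value exists and does not
  depend on the diagonalization chosen. Elsewhere the value is a junk value; for a matrix weight this
  concerns a null set of points only.\<close>

definition mat_powr :: "complex^'n^'n \<Rightarrow> real \<Rightarrow> complex^'n^'n" where
  "mat_powr A r = (SOME B. \<exists>P e. unitary P \<and> A = P ** real_diag e ** mat_adjoint P \<and>
      B = P ** real_diag (\<chi> i. e $ i powr r) ** mat_adjoint P)"

text \<open>The operator norm for the Euclidean norm on \<open>complex^'n\<close>; the norm of the type
  \<open>complex^'n^'n\<close> itself is the Frobenius norm.\<close>

definition op_norm :: "complex^'n^'n \<Rightarrow> real" where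
  "op_norm A = onorm (\<lambda>v. A *v v)"

definition matrix_weight :: "(real^'d \<Rightarrow> complex^'n^'n) \<Rightarrow> bool" where
  "matrix_weight U \<longleftrightarrow> (\<forall>x. self_adjoint (U x)) \<and>
     (\<forall>i j K. compact K \<longrightarrow> set_integrable lebesgue K (\<lambda>x. U x $ i $ j)) \<and>
     (AE x in lebesgue. pos_definite (U x))"

text \<open>Cubes are closed and nondegenerate, with corner \<open>a\<close> and side length \<open>l\<close>.\<close>

definition cubes :: "(real^'d) set set" where
  "cubes = {cbox a (\<chi> i. a $ i + l) | a l. 0 < l}"

definition vol :: "(real^'d) set \<Rightarrow> real" where
  "vol Q = measure lebesgue Q"

text \<open>Powers with exponent \<open>r > 0\<close> of extended nonnegative reals.\<close>

definition ennpowr :: "ennreal \<Rightarrow> real \<Rightarrow> ennreal" where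
  "ennpowr x r = (if x = \<infinity> then \<infinity> else ennreal (enn2real x powr r))"

definition average :: "(real^'d) set \<Rightarrow> (real^'d \<Rightarrow> ennreal) \<Rightarrow> ennreal" where
  "average Q g = ennreal (1 / vol Q) * (\<integral>\<^sup>+x\<in>Q. g x \<partial>lebesgue)"

text \<open>A Young function lives on the half-line \<open>{0..}\<close>; values at negative arguments are irrelevant.
  Increasing means nondecreasing, so that associates of Young functions are again Young functions.\<close>

definition young_function :: "(real \<Rightarrow> real) \<Rightarrow> bool" where
  "young_function \<Phi> \<longleftrightarrow> (\<forall>t\<ge>0. 0 \<le> \<Phi> t) \<and> convex_on {0..} \<Phi> \<and> mono_on {0..} \<Phi> \<and> \<Phi> 0 = 0 \<and>
     filterlim (\<lambda>t. \<Phi> t / t) at_top at_top"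

text \<open>The supremum is finite for a Young function, because \<open>\<Phi> s / s \<rightarrow> \<infinity>\<close>.\<close>

definition young_associate :: "(real \<Rightarrow> real) \<Rightarrow> real \<Rightarrow> real" where
  "young_associate \<Phi> t = (SUP s\<in>{0<..}. s * t - \<Phi> s)"

definition B_class :: "real \<Rightarrow> real \<Rightarrow> (real \<Rightarrow> real) set" where
  "B_class p q = {\<Phi>. (\<integral>\<^sup>+t\<in>{1..}. ennreal (\<Phi> t powr (q / p) / t powr q / t) \<partial>lborel) < \<infinity>}"

text \<open>The norm is \<open>\<infinity>\<close> (the infimum of the empty set) if no \<open>l\<close> is admissible.\<close>

definition orlicz_norm :: "(real \<Rightarrow> real) \<Rightarrow> (real^'d) set \<Rightarrow> (real^'d \<Rightarrow> real) \<Rightarrow> ennreal" where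
  "orlicz_norm \<Phi> Q f =
     Inf {ennreal l | l. 0 < l \<and> average Q (\<lambda>x. ennreal (\<Phi> (\<bar>f x\<bar> / l))) \<le> 1}"

definition weight_pair_const ::
  "real \<Rightarrow> real \<Rightarrow> real \<Rightarrow> (real \<Rightarrow> real) \<Rightarrow>
   (real^'d \<Rightarrow> complex^'n^'n) \<Rightarrow> (real^'d \<Rightarrow> complex^'n^'n) \<Rightarrow> ennreal" where
  "weight_pair_const \<alpha> p q \<Phi> U V =
     (SUP Q\<in>cubes. ennreal (vol Q powr (\<alpha> / real CARD('d) + 1 / q - 1 / p)) *
        ennpowr (average Q (\<lambda>x. ennpowr
          (orlicz_norm \<Phi> Q (\<lambda>y. op_norm (mat_powr (U x) (1 / q) ** mat_powr (V y) (- 1 / p)))) q))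
        (1 / q))"

definition frac_maximal ::
  "real \<Rightarrow> real \<Rightarrow> real \<Rightarrow> (real^'d \<Rightarrow> complex^'n^'n) \<Rightarrow> (real^'d \<Rightarrow> complex^'n^'n) \<Rightarrow>
   (real^'d \<Rightarrow> complex^'n) \<Rightarrow> real^'d \<Rightarrow> ennreal" where
  "frac_maximal \<alpha> p q U V f x =
     (SUP Q\<in>{Q\<in>cubes. x \<in> Q}. ennreal (1 / vol Q powr (1 - \<alpha> / real CARD('d))) *
        (\<integral>\<^sup>+y\<in>Q. ennreal (norm ((mat_powr (U x) (1 / q) ** mat_powr (V y) (- 1 / p)) *v f y)) \<partial>lebesgue))"

definition Lp_norm :: "real \<Rightarrow> (real^'d \<Rightarrow> ennreal) \<Rightarrow> ennreal" where
  "Lp_norm p g = ennpowr (\<integral>\<^sup>+x. ennpowr (g x) p \<partial>lebesgue) (1 / p)"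

definition Lp_space :: "real \<Rightarrow> (real^'d \<Rightarrow> complex^'n) set" where
  "Lp_space p = {f. f \<in> borel_measurable lebesgue \<and> Lp_norm p (\<lambda>x. ennreal (norm (f x))) < \<infinity>}"

end

theory Submission
  imports Defs
begin

text \<open>
  Write \<open>A(x)\<close> for \<open>U(x)\<close> to the power \<open>1/q\<close>, \<open>B(y)\<close> for \<open>V(y)\<close> to the power \<open>-1/p\<close>, \<open>g = B f\<close>, and
  \<open>\<Psi>\<close> for the associate of \<open>\<Phi>\<close>. The operator is the supremum over cubes \<open>Q \<ni> x\<close> of
  \<open>|Q|^(\<alpha>/d)\<close> times the average of \<open>|A(x) g|\<close> over \<open>Q\<close>. The generalized Hoelder inequality
  bounds this average by \<open>2 a_Q(x) b_Q\<close>, where \<open>a_Q(x)\<close> is the \<open>\<Phi>\<close>-norm of \<open>|A(x) B|\<close> on \<open>Q\<close> and \<open>b_Q\<close>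
  is the \<open>\<Psi>\<close>-norm of \<open>|f|\<close> on \<open>Q\<close>. The weight condition controls the \<open>q\<close>-th moment of \<open>a_Q\<close> over \<open>Q\<close>
  for each single cube. It says nothing about the supremum of \<open>a_Q(x)\<close> over all cubes containing \<open>x\<close>,
  so the supremum must be reduced to a sum over few cubes before Hoelder is applied.

  The reduction is a sparse domination that does not depend on the matrix (\<open>sparse_domination\<close>). For a
  cube \<open>P\<close> the averages of \<open>|e \<cdot> g|\<close> over \<open>P\<close> form a seminorm in the vector \<open>e\<close>. An Auerbach
  family for it (\<open>auerbach_family_seminorm\<close>) consists of \<open>n\<close> test vectors whose averages control those
  of all \<open>e\<close>. A subcube on which no test vector has a large average is dominated by \<open>P\<close>
  simultaneously for every matrix, and the remaining subcubes fill at most half of \<open>P\<close>. A greedy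
  selection from the large cubes down therefore gives a sparse family \<open>S\<close> such that, for every \<open>A(x)\<close> at
  once, each average is at most a constant times the average over some cube of \<open>S\<close> that contains the given one. Dyadic nesting
  comes from the one-third trick: finitely many cubes are covered by \<open>2^d\<close> shifted dyadic grids
  (\<open>finite_cubes_laminar_cover\<close>).

  After this the \<open>q\<close>-th power of the supremum is at most a constant times the sum over \<open>P \<in> S\<close>, \<open>P \<ni> x\<close>, of
  \<open>|P|^(q\<alpha>/d) a_P(x)^q b_P^q\<close>, and the weight condition integrates each term to at most
  \<open>|P|^(q/p) b_P^q\<close> up to a constant. It remains to see that these numbers sum to at most a multiple of
  the \<open>q\<close>-th power of the \<open>L^p\<close> norm of \<open>f\<close> (\<open>sparse_orlicz_sum\<close>). Slice by levels, with \<open>u\<close> the reciprocal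
  of the level. A cube with \<open>b_P > 1/u\<close> carries a proportional amount of the integral of
  \<open>\<Psi>(u |f|)\<close> over the set where \<open>u |f|\<close> exceeds a fixed threshold. Sparseness adds up these cubes with
  exponent \<open>q/p\<close>. Jensen's inequality with respect to \<open>|f|^p dx\<close> moves the exponent \<open>q/p\<close> inside the
  integral, and after Tonelli and the scaling \<open>s = u |f(x)|\<close> the integral over the levels is, above the threshold,
  the one in the class \<open>B_(p,q)\<close>.

  The rest is reduction. Powers of positive definite matrices depend continuously on the matrix, so
  \<open>A\<close> and \<open>B\<close> agree almost everywhere with measurable functions. The supremum over all cubes equals the one over
  the countably many rational cubes, so the maximal function is measurable and monotone convergence
  reduces the bound to finitely many cubes and to \<open>f\<close> for which \<open>f\<close> and \<open>B f\<close> are bounded.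
\<close>

section \<open>Diagonalization of Hermitian matrices\<close>

text \<open>A maximizer \<open>v\<close> of the Rayleigh quotient on the unit sphere of \<open>S\<close> is an eigenvector: the part
  \<open>w\<close> of \<open>L v\<close> orthogonal to \<open>v\<close> must vanish, since otherwise moving \<open>v\<close> a little in the direction
  \<open>w\<close> increases the quotient to first order.\<close>

lemma symmetric_eigenvector_in_subspace:
  fixes L :: "'a::euclidean_space \<Rightarrow> 'a"
  assumes S: "subspace S" "S \<noteq> {0}" and L: "linear L" and sym: "\<And>u v. L u \<bullet> v = u \<bullet> L v"
    and inv: "\<And>v. v \<in> S \<Longrightarrow> L v \<in> S"
  obtains v r where "v \<in> S" "norm v = 1" "L v = r *\<^sub>R v"
proof -
  interpret L: linear L by fact
  let ?K = "S \<inter> sphere 0 1"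
  have cpt: "compact ?K"
    using closed_subspace[OF S(1)] by (simp add: closed_Int_compact)
  obtain s where s: "s \<in> S" "s \<noteq> 0" using S subspace_0 by blast
  have "(1 / norm s) *\<^sub>R s \<in> ?K" using s S(1) by (simp add: subspace_scale)
  then have ne: "?K \<noteq> {}" by blast
  have cont: "continuous_on ?K (\<lambda>v. L v \<bullet> v)"
    by (intro continuous_intros linear_continuous_on linear_conv_bounded_linear[THEN iffD1] L)
  from continuous_attains_sup[OF cpt ne cont]
  obtain v where v: "v \<in> S" "norm v = 1" and mx: "\<And>u. u \<in> S \<Longrightarrow> norm u = 1 \<Longrightarrow> L u \<bullet> u \<le> L v \<bullet> v"
    by auto
  define r where "r = L v \<bullet> v"
  have quad: "L u \<bullet> u \<le> r * (u \<bullet> u)" if "u \<in> S" for u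
  proof (cases "u = 0")
    case False
    let ?w = "(1 / norm u) *\<^sub>R u"
    have "L ?w \<bullet> ?w \<le> r" unfolding r_def
      using that False S(1) by (intro mx) (auto simp: subspace_scale)
    moreover have "L ?w \<bullet> ?w = (L u \<bullet> u) / (u \<bullet> u)"
      by (simp add: L.scale power2_norm_eq_inner[symmetric] power2_eq_square)
    ultimately have "(L u \<bullet> u) / (u \<bullet> u) \<le> r" by argo
    then show ?thesis using False by (simp add: divide_le_eq)
  qed (simp add: L.zero)
  define w where "w = L v - r *\<^sub>R v"
  have wS: "w \<in> S" unfolding w_def using v inv S(1) by (simp add: subspace_diff subspace_scale)
  have vv: "v \<bullet> v = 1" using v(2) by (simp add: power2_norm_eq_inner[symmetric])
  have wv: "w \<bullet> v = 0" unfolding w_def by (simp add: inner_diff_left vv r_def)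
  have Lvw: "L v \<bullet> w = w \<bullet> w"
    using wv unfolding w_def by (simp add: inner_diff_left inner_diff_right inner_commute)
  \<comment> \<open>The quadratic inequality at \<open>v + t w\<close>, where the term linear in \<open>t\<close> is \<open>2 t |w|\<^sup>2\<close>.\<close>
  have key: "2 * t * (w \<bullet> w) \<le> t^2 * (r * (w \<bullet> w) - L w \<bullet> w)" for t :: real
  proof -
    have "v + t *\<^sub>R w \<in> S" using v wS S(1) by (simp add: subspace_add subspace_scale)
    from quad[OF this]
    have "L v \<bullet> v + 2 * t * (L v \<bullet> w) + t^2 * (L w \<bullet> w) \<le> r * (v \<bullet> v + 2 * t * (w \<bullet> v) + t^2 * (w \<bullet> w))"
      using sym[of w v] by (simp add: L.add L.scale inner_simps algebra_simps power2_eq_square inner_commute)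
    then show ?thesis using wv Lvw vv by (simp add: r_def algebra_simps)
  qed
  have "w \<bullet> w = 0"
  proof (rule ccontr)
    assume "w \<bullet> w \<noteq> 0"
    then have p: "w \<bullet> w > 0" by simp
    define c where "c = r * (w \<bullet> w) - L w \<bullet> w"
    define t where "t = (w \<bullet> w) / (\<bar>c\<bar> + 1)"
    have t: "t > 0" using p by (simp add: t_def)
    have "2 * t * (w \<bullet> w) \<le> t^2 * c" using key c_def by simp
    then have "2 * (w \<bullet> w) \<le> t * c" using t by (simp add: power2_eq_square)
    also have "\<dots> \<le> t * (\<bar>c\<bar> + 1)" using t by (intro mult_left_mono) auto
    also have "\<dots> = w \<bullet> w" by (simp add: t_def)
    finally show False using p by simp
  qed
  then have "L v = r *\<^sub>R v" by (simp add: w_def)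
  with v show ?thesis by (rule that)
qed

definition herm :: "complex^'n \<Rightarrow> complex^'n \<Rightarrow> complex" where
  "herm v w = (\<Sum>i\<in>UNIV. v $ i * cnj (w $ i))"

lemma inner_eq_Re_herm: "v \<bullet> w = Re (herm v w)"
  by (simp add: herm_def inner_vec_def inner_complex_def)

lemma herm_scale_right: "herm v (c *s w) = cnj c * herm v w"
  by (simp add: herm_def sum_distrib_left mult_ac)

lemma herm_scale_left: "herm (c *s v) w = c * herm v w"
  by (simp add: herm_def sum_distrib_left mult_ac)

lemma herm_cnj: "cnj (herm v w) = herm w v"
  by (simp add: herm_def mult.commute)

lemma herm_self: "herm v v = of_real ((norm v)\<^sup>2)"
proof -
  have "Re (herm v v) = (norm v)\<^sup>2" using inner_eq_Re_herm[of v v] by (simp add: power2_norm_eq_inner)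
  moreover have "Im (herm v v) = 0" by (simp add: herm_def)
  ultimately show ?thesis by (simp add: complex_eq_iff)
qed

lemma herm_mat_mult: "herm (A *v v) w = herm v (mat_adjoint A *v w)"
proof -
  have "herm (A *v v) w = (\<Sum>i\<in>UNIV. \<Sum>j\<in>UNIV. A $ i $ j * v $ j * cnj (w $ i))"
    by (simp add: herm_def matrix_vector_mult_def sum_distrib_right)
  also have "\<dots> = (\<Sum>j\<in>UNIV. \<Sum>i\<in>UNIV. A $ i $ j * v $ j * cnj (w $ i))"
    by (rule sum.swap)
  also have "\<dots> = herm v (mat_adjoint A *v w)"
    by (simp add: herm_def matrix_vector_mult_def mat_adjoint_def sum_distrib_left mult_ac)
  finally show ?thesis .
qed

lemma scaleR_eq_scale_of_real: "r *\<^sub>R v = complex_of_real r *s v" for v :: "complex^'n"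
  by (simp add: vec_eq_iff scaleR_conv_of_real[where 'a = complex])

text \<open>Hermitian orthogonality to \<open>u i\<close> is real orthogonality to both \<open>u i\<close> and \<open>\<i> u i\<close>, so that \<open>2k\<close> real
  conditions have to be met in real dimension \<open>2n\<close>.\<close>

lemma exists_herm_orthogonal:
  fixes u :: "nat \<Rightarrow> complex^'n"
  assumes "k < CARD('n)"
  obtains v where "v \<noteq> 0" "\<And>i. i < k \<Longrightarrow> herm v (u i) = 0"
proof -
  let ?T = "u ` {..<k} \<union> (\<lambda>i. \<i> *s u i) ` {..<k}"
  have "card ?T \<le> card (u ` {..<k}) + card ((\<lambda>i. \<i> *s u i) ` {..<k})" by (rule card_Un_le)
  also have "\<dots> \<le> k + k" using card_image_le[of "{..<k}" u] card_image_le[of "{..<k}" "\<lambda>i. \<i> *s u i"]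
    by simp
  also have "\<dots> < DIM(complex^'n)" using assms by (simp add: DIM_cart)
  finally have "card ?T < DIM(complex^'n)" .
  moreover have "dim ?T \<le> card ?T" by (rule dim_le_card) (auto intro: span_base)
  ultimately have "dim ?T < DIM(complex^'n)" by simp
  from orthogonal_to_subspace_exists[OF this]
  obtain v where v: "v \<noteq> 0" "\<And>y. y \<in> span ?T \<Longrightarrow> orthogonal v y" by blast
  have "herm v (u i) = 0" if "i < k" for i
  proof -
    have "v \<bullet> u i = 0" "v \<bullet> (\<i> *s u i) = 0"
      using that v(2) by (auto simp: orthogonal_def intro!: span_base)
    then show ?thesis by (simp add: inner_eq_Re_herm herm_scale_right complex_eq_iff)
  qed
  with v(1) show ?thesis by (rule that)
qed

text \<open>The Hermitian complement of eigenvectors is invariant under a self-adjoint matrix, so a further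
  eigenvector can be found inside it as long as it is nonzero.\<close>

lemma orthonormal_eigenvectors:
  fixes A :: "complex^'n^'n"
  assumes A: "self_adjoint A" and "k \<le> CARD('n)"
  shows "\<exists>(u :: nat \<Rightarrow> complex^'n) e. (\<forall>i<k. \<forall>j<k. herm (u i) (u j) = (if i = j then 1 else 0)) \<and>
           (\<forall>i<k. A *v u i = complex_of_real (e i) *s u i)"
  using assms(2)
proof (induction k)
  case (Suc k)
  then obtain u :: "nat \<Rightarrow> complex^'n" and e where
    on: "\<And>i j. i < k \<Longrightarrow> j < k \<Longrightarrow> herm (u i) (u j) = (if i = j then 1 else 0)"
    and ev: "\<And>i. i < k \<Longrightarrow> A *v u i = complex_of_real (e i) *s u i" by auto
  have adj: "herm (A *v v) w = herm v (A *v w)" for v w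
    using herm_mat_mult[of A v w] A by (simp add: self_adjoint_def)
  define S where "S = {v. \<forall>i<k. herm v (u i) = 0}"
  have "subspace S"
    unfolding subspace_def S_def scaleR_eq_scale_of_real
    by (auto simp: herm_scale_left) (auto simp: herm_def distrib_right sum.distrib)
  moreover have "S \<noteq> {0}"
    using exists_herm_orthogonal[of k u] Suc.prems unfolding S_def by auto
  moreover have "linear (\<lambda>v. A *v v)"
    by (rule linearI) (simp_all add: matrix_vector_right_distrib scaleR_eq_scale_of_real vector_scalar_commute)
  moreover have "(A *v v) \<bullet> w = v \<bullet> (A *v w)" for v w
    by (simp add: inner_eq_Re_herm adj)
  moreover have "A *v v \<in> S" if "v \<in> S" for v
    using that by (auto simp: S_def adj ev herm_scale_right)
  ultimately obtain v r where v: "v \<in> S" "norm v = 1" "A *v v = r *\<^sub>R v"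
    by (rule symmetric_eigenvector_in_subspace) blast
  have "herm v (u i) = 0" "herm (u i) v = 0" if "i < k" for i
    using v(1) that herm_cnj[of v "u i"] by (auto simp: S_def)
  then show ?case using on ev v
    by (intro exI[of _ "u(k := v)"] exI[of _ "e(k := r)"])
       (auto simp: less_Suc_eq herm_self scaleR_eq_scale_of_real)
qed auto

lemma mat_mult_nth: "(A ** B) $ i $ j = (\<Sum>k\<in>UNIV. A $ i $ k * B $ k $ j)"
  by (simp add: matrix_matrix_mult_def)

lemma sum_indicator_mult:
  fixes f g :: "'n::finite \<Rightarrow> 'a::semiring_1"
  shows "(\<Sum>k\<in>UNIV. (if k = j then f k else 0) * g k) = f j * g j"
  "(\<Sum>k\<in>UNIV. g k * (if k = j then f k else 0)) = g j * f j"
  "(\<Sum>k\<in>UNIV. (if j = k then f k else 0) * g k) = f j * g j"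
  "(\<Sum>k\<in>UNIV. g k * (if j = k then f k else 0)) = g j * f j"
  by (simp_all add: if_distrib[of "\<lambda>x. x * _"] if_distrib[of "\<lambda>x. _ * x"] cong: if_cong)

lemma mat_mult_real_diag: "(P ** real_diag e) $ i $ j = P $ i $ j * of_real (e $ j)"
  by (simp add: mat_mult_nth real_diag_def sum_indicator_mult)

lemma real_diag_mat_mult: "(real_diag e ** P) $ i $ j = of_real (e $ i) * P $ i $ j"
  by (simp add: mat_mult_nth real_diag_def sum_indicator_mult)

lemma self_adjoint_unitary_diagonalization:
  fixes A :: "complex^'n^'n"
  assumes A: "self_adjoint A"
  obtains P e where "unitary P" "A = P ** real_diag e ** mat_adjoint P"
proof -
  from orthonormal_eigenvectors[OF A order_refl]
  obtain u :: "nat \<Rightarrow> complex^'n" and e where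
    on: "\<And>i j. i < CARD('n) \<Longrightarrow> j < CARD('n) \<Longrightarrow> herm (u i) (u j) = (if i = j then 1 else 0)"
    and ev: "\<And>i. i < CARD('n) \<Longrightarrow> A *v u i = complex_of_real (e i) *s u i" by auto
  obtain h where h: "bij_betw h (UNIV :: 'n set) {..<CARD('n)}"
    using ex_bij_betw_finite_nat[of "UNIV :: 'n set"] by (auto simp: atLeast0LessThan)
  have hl: "h i < CARD('n)" for i using bij_betwE[OF h] by auto
  have hi: "h i = h j \<longleftrightarrow> i = j" for i j using h by (auto simp: bij_betw_def inj_on_def)
  define P :: "complex^'n^'n" where "P = (\<chi> i j. u (h j) $ i)"
  define d where "d = (\<chi> j. e (h j))"
  have 1: "mat_adjoint P ** P = mat 1"
  proof -
    have "(mat_adjoint P ** P) $ i $ j = herm (u (h j)) (u (h i))" for i j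
      by (simp add: mat_mult_nth mat_adjoint_def P_def herm_def mult.commute)
    then show ?thesis by (auto simp: vec_eq_iff on hl hi mat_def)
  qed
  then have 2: "P ** mat_adjoint P = mat 1" by (simp add: matrix_left_right_inverse)
  have "A ** P = P ** real_diag d"
  proof -
    have "(A ** P) $ i $ j = (A *v u (h j)) $ i" for i j
      by (simp add: mat_mult_nth matrix_vector_mult_def P_def)
    then show ?thesis by (simp add: vec_eq_iff mat_mult_real_diag ev hl P_def d_def)
  qed
  then have "A ** P ** mat_adjoint P = P ** real_diag d ** mat_adjoint P" by simp
  then have "A = P ** real_diag d ** mat_adjoint P"
    by (simp add: 2 flip: matrix_mul_assoc)
  with 1 2 show ?thesis by (intro that) (auto simp: unitary_def)
qed

text \<open>If \<open>P D P*\<close> and \<open>P' D' P'*\<close> are two diagonalizations of the same matrix then \<open>W = P'* P\<close>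
  satisfies \<open>W D = D' W\<close>. Hence \<open>W\<close> has a nonzero entry only where the two eigenvalues agree, and there
  the equation survives any function applied to the eigenvalues.\<close>

lemma mat_powr_eq_diagonalization:
  assumes P: "unitary P" and A: "A = P ** real_diag e ** mat_adjoint P"
  shows "mat_powr A r = P ** real_diag (\<chi> i. e $ i powr r) ** mat_adjoint P"
proof -
  define Z where "Z = P ** real_diag (\<chi> i. e $ i powr r) ** mat_adjoint P"
  have "B = Z" if B: "\<exists>P e. unitary P \<and> A = P ** real_diag e ** mat_adjoint P \<and>
      B = P ** real_diag (\<chi> i. e $ i powr r) ** mat_adjoint P" for B
  proof -
    from B obtain P' e' where P': "unitary P'" and A': "A = P' ** real_diag e' ** mat_adjoint P'"
      and B: "B = P' ** real_diag (\<chi> i. e' $ i powr r) ** mat_adjoint P'" by blast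
    define W where "W = mat_adjoint P' ** P"
    have cancel: "mat_adjoint P' ** (P' ** X) = X" "P' ** (mat_adjoint P' ** X) = X"
      "X ** mat_adjoint P ** P = X" "X ** P ** mat_adjoint P = X" for X
      using P P' by (simp_all add: unitary_def matrix_mul_assoc) (simp_all add: unitary_def flip: matrix_mul_assoc)
    have "mat_adjoint P' ** (P ** real_diag e ** mat_adjoint P) ** P
        = mat_adjoint P' ** (P' ** real_diag e' ** mat_adjoint P') ** P" using A A' by simp
    then have W: "W ** real_diag e = real_diag e' ** W"
      unfolding W_def by (metis cancel(1,3) matrix_mul_assoc)
    have "W ** real_diag (\<chi> i. e $ i powr r) = real_diag (\<chi> i. e' $ i powr r) ** W"
    proof -
      have "W $ i $ j * of_real (e $ j powr r) = of_real (e' $ i powr r) * W $ i $ j" for i j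
      proof (cases "W $ i $ j = 0")
        case False
        from W have "(W ** real_diag e) $ i $ j = (real_diag e' ** W) $ i $ j" by simp
        with False show ?thesis by (simp add: mat_mult_real_diag real_diag_mat_mult)
      qed simp
      then show ?thesis by (simp add: vec_eq_iff mat_mult_real_diag real_diag_mat_mult)
    qed
    then have "P' ** (W ** real_diag (\<chi> i. e $ i powr r)) ** mat_adjoint P
        = P' ** (real_diag (\<chi> i. e' $ i powr r) ** W) ** mat_adjoint P" by simp
    moreover have "P' ** (W ** X) ** mat_adjoint P = P ** X ** mat_adjoint P" for X
      unfolding W_def by (metis cancel(2) matrix_mul_assoc)
    moreover have "P' ** (X ** W) ** mat_adjoint P = P' ** X ** mat_adjoint P'" for X
      unfolding W_def by (metis cancel(4) matrix_mul_assoc)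
    ultimately show ?thesis by (simp add: B Z_def)
  qed
  moreover have "\<exists>P e. unitary P \<and> A = P ** real_diag e ** mat_adjoint P \<and>
      Z = P ** real_diag (\<chi> i. e $ i powr r) ** mat_adjoint P"
    using P A Z_def by blast
  ultimately show ?thesis unfolding mat_powr_def Z_def by (rule some_equality[rotated])
qed

section \<open>Measurability of matrix powers and of the operator norm\<close>

lemma tendsto_matrix_mult:
  fixes X Y :: "'b \<Rightarrow> complex^'n^'n"
  assumes "(X \<longlongrightarrow> A) F" "(Y \<longlongrightarrow> B) F"
  shows "((\<lambda>k. X k ** Y k) \<longlongrightarrow> A ** B) F"
  by (intro vec_tendstoI) (simp add: mat_mult_nth, intro tendsto_intros tendsto_vec_nth assms)

lemma tendsto_mat_adjoint:
  assumes "(X \<longlongrightarrow> A) F"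
  shows "((\<lambda>k. mat_adjoint (X k)) \<longlongrightarrow> mat_adjoint A) F"
  unfolding mat_adjoint_def
  by (intro vec_tendstoI) (simp, intro tendsto_intros tendsto_vec_nth assms)

lemma tendsto_real_diag:
  assumes "\<And>i. ((\<lambda>k. e k $ i) \<longlongrightarrow> d $ i) F"
  shows "((\<lambda>k. real_diag (e k)) \<longlongrightarrow> real_diag d) F"
  unfolding real_diag_def
  by (intro vec_tendstoI) (auto intro!: tendsto_intros assms)

lemma unitary_row_norm:
  assumes "unitary P"
  shows "norm (P $ i) = 1"
proof -
  have "(P ** mat_adjoint P) $ i $ i = herm (P $ i) (P $ i)"
    by (simp add: mat_mult_nth mat_adjoint_def herm_def)
  then have "herm (P $ i) (P $ i) = 1" using assms by (simp add: unitary_def mat_def)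
  then have "(norm (P $ i))\<^sup>2 = 1" unfolding herm_self of_real_eq_1_iff .
  then show ?thesis by (simp add: power2_eq_1_iff) (metis norm_ge_zero not_one_le_zero le_minus_one_simps(3))
qed

lemma compact_unitary: "compact {P :: complex^'n^'n. unitary P}"
proof (rule compact_eq_bounded_closed[THEN iffD2], rule conjI)
  have "norm P \<le> real CARD('n)" if "unitary P" for P :: "complex^'n^'n"
  proof -
    have "norm P \<le> (\<Sum>i\<in>UNIV. norm (P $ i))" unfolding norm_vec_def by (rule L2_set_le_sum) simp
    then show ?thesis using that by (simp add: unitary_row_norm)
  qed
  then show "bounded {P :: complex^'n^'n. unitary P}" unfolding bounded_iff by blast
  show "closed {P :: complex^'n^'n. unitary P}"
    unfolding closed_sequential_limits
  proof clarify
    fix X and P :: "complex^'n^'n"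
    assume X: "\<forall>n. X n \<in> {P. unitary P}" and "X \<longlonglongrightarrow> P"
    then have l: "(\<lambda>n. X n ** mat_adjoint (X n)) \<longlonglongrightarrow> P ** mat_adjoint P"
      "(\<lambda>n. mat_adjoint (X n) ** X n) \<longlonglongrightarrow> mat_adjoint P ** P"
      by (intro tendsto_matrix_mult tendsto_mat_adjoint; simp)+
    have "(\<lambda>n. X n ** mat_adjoint (X n)) = (\<lambda>_. mat 1)" "(\<lambda>n. mat_adjoint (X n) ** X n) = (\<lambda>_. mat 1)"
      using X by (auto simp: unitary_def)
    with l show "unitary P" unfolding unitary_def by (auto intro: LIMSEQ_unique)
  qed
qed

lemma unitary_cancel:
  assumes "unitary P"
  shows "mat_adjoint P ** (P ** X ** mat_adjoint P) ** P = X"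
    and "P ** (mat_adjoint P ** X ** P) ** mat_adjoint P = X"
proof -
  have "mat_adjoint P ** (P ** X ** mat_adjoint P) ** P = (mat_adjoint P ** P) ** X ** (mat_adjoint P ** P)"
    by (simp only: matrix_mul_assoc)
  then show "mat_adjoint P ** (P ** X ** mat_adjoint P) ** P = X" using assms by (simp add: unitary_def)
  have "P ** (mat_adjoint P ** X ** P) ** mat_adjoint P = (P ** mat_adjoint P) ** X ** (P ** mat_adjoint P)"
    by (simp only: matrix_mul_assoc)
  then show "P ** (mat_adjoint P ** X ** P) ** mat_adjoint P = X" using assms by (simp add: unitary_def)
qed

lemma pos_definite_eigenvalues:
  assumes "pos_definite A" "unitary P" "A = P ** real_diag e ** mat_adjoint P"
  shows "0 < e $ i"
proof -
  define v where "v = (\<chi> j. P $ j $ i)"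
  have "A ** P = P ** real_diag e"
    using assms(2) unfolding assms(3) by (simp add: unitary_def flip: matrix_mul_assoc)
  then have "(A ** P) $ j $ i = P $ j $ i * of_real (e $ i)" for j by (simp add: mat_mult_real_diag)
  then have Av: "A *v v = complex_of_real (e $ i) *s v"
    by (simp add: vec_eq_iff v_def matrix_vector_mult_def mat_mult_nth mult.commute)
  have "herm v v = (mat_adjoint P ** P) $ i $ i"
    by (simp add: mat_mult_nth mat_adjoint_def herm_def v_def mult.commute)
  then have vv: "herm v v = 1" using assms(2) by (simp add: unitary_def mat_def)
  then have "v \<noteq> 0" by (auto simp: herm_def)
  then have "0 < Re (herm (A *v v) v)" using assms(1) unfolding pos_definite_def herm_def by blast
  then show ?thesis by (simp add: Av herm_scale_left vv)
qed

text \<open>Eigenvectors need not depend continuously on the matrix. But along a convergent sequence a subsequence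
  of the diagonalizing unitary matrices converges by compactness, then so do the eigenvalues, and
  the limit diagonalizes the limit matrix. The value of the power there is independent of the
  diagonalization, so the choice of subsequence does not matter. Positivity of the limit eigenvalues is
  what makes \<open>t powr r\<close> continuous.\<close>

lemma continuous_on_mat_powr:
  "continuous_on {A :: complex^'n^'n. pos_definite A} (\<lambda>A. mat_powr A r)"
  unfolding continuous_on_sequentially
proof (clarify)
  fix x and A :: "complex^'n^'n"
  assume pA: "pos_definite A" and px: "\<forall>n. x n \<in> {A. pos_definite A}" and lim: "x \<longlonglongrightarrow> A"
  show "((\<lambda>A. mat_powr A r) \<circ> x) \<longlonglongrightarrow> mat_powr A r"
  proof (rule ccontr)
    assume "\<not> ?thesis"
    then obtain \<epsilon> where \<epsilon>: "\<epsilon> > 0" "\<not> (\<forall>\<^sub>F n in sequentially. dist (mat_powr (x n) r) (mat_powr A r) < \<epsilon>)"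
      unfolding tendsto_iff by auto
    then have "infinite {n. \<not> dist (mat_powr (x n) r) (mat_powr A r) < \<epsilon>}"
      by (simp add: eventually_cofinite flip: cofinite_eq_sequentially)
    from infinite_enumerate[OF this] obtain s :: "nat \<Rightarrow> nat"
      where s: "strict_mono s" "\<And>n. dist (mat_powr (x (s n)) r) (mat_powr A r) \<ge> \<epsilon>" by (auto simp: not_less)
    have "\<exists>P e. unitary P \<and> x (s n) = P ** real_diag e ** mat_adjoint P" for n
    proof -
      have "pos_definite (x (s n))" using px by blast
      then have "self_adjoint (x (s n))" by (simp only: pos_definite_def)
      then show ?thesis by (rule self_adjoint_unitary_diagonalization) blast
    qed
    then obtain P e where P: "\<And>n. unitary (P n)"
      and xe: "\<And>n. x (s n) = P n ** real_diag (e n) ** mat_adjoint (P n)" by metis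
    from compact_unitary[unfolded compact_def, rule_format, of P] P
    obtain Q t where Q: "unitary Q" and t: "strict_mono t" and PQ: "(P \<circ> t) \<longlonglongrightarrow> Q" by auto
    let ?k = "\<lambda>n. s (t n)"
    have xk: "(\<lambda>n. x (?k n)) \<longlonglongrightarrow> A"
      using LIMSEQ_subseq_LIMSEQ[OF LIMSEQ_subseq_LIMSEQ[OF lim s(1)] t] by (simp add: o_def)
    have PQ': "(\<lambda>n. P (t n)) \<longlonglongrightarrow> Q" using PQ by (simp add: o_def)
    define Z where "Z = mat_adjoint Q ** A ** Q"
    have "(\<lambda>n. mat_adjoint (P (t n)) ** x (?k n) ** P (t n)) \<longlonglongrightarrow> Z"
      unfolding Z_def by (intro tendsto_matrix_mult tendsto_mat_adjoint xk PQ')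
    then have DZ: "(\<lambda>n. real_diag (e (t n))) \<longlonglongrightarrow> Z"
      unfolding xe unitary_cancel(1)[OF P] .
    define d where "d = (\<chi> i. Re (Z $ i $ i))"
    have ed: "(\<lambda>n. e (t n) $ i) \<longlonglongrightarrow> d $ i" for i
    proof -
      have "(\<lambda>n. Re (real_diag (e (t n)) $ i $ i)) \<longlonglongrightarrow> Re (Z $ i $ i)"
        by (intro tendsto_Re tendsto_vec_nth DZ)
      then show ?thesis by (simp add: real_diag_def d_def)
    qed
    then have "(\<lambda>n. real_diag (e (t n))) \<longlonglongrightarrow> real_diag d" by (rule tendsto_real_diag)
    with DZ have "Z = real_diag d" by (rule LIMSEQ_unique)
    then have AQ: "A = Q ** real_diag d ** mat_adjoint Q"
      using unitary_cancel(2)[OF Q, of A] by (simp add: Z_def)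
    have dpos: "0 < d $ i" for i by (rule pos_definite_eigenvalues[OF pA Q AQ])
    have "(\<lambda>n. P (t n) ** real_diag (\<chi> i. e (t n) $ i powr r) ** mat_adjoint (P (t n)))
        \<longlonglongrightarrow> Q ** real_diag (\<chi> i. d $ i powr r) ** mat_adjoint Q"
      using dpos by (intro tendsto_matrix_mult tendsto_mat_adjoint PQ' tendsto_real_diag)
        (auto intro!: tendsto_powr ed simp: less_imp_neq[symmetric])
    then have "(\<lambda>n. mat_powr (x (?k n)) r) \<longlonglongrightarrow> mat_powr A r"
      unfolding mat_powr_eq_diagonalization[OF Q AQ] mat_powr_eq_diagonalization[OF P xe] .
    then have "\<forall>\<^sub>F n in sequentially. dist (mat_powr (x (?k n)) r) (mat_powr A r) < \<epsilon>"
      using \<epsilon>(1) by (simp add: tendsto_iff)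
    then show False using s(2) by (auto simp: eventually_sequentially not_le[symmetric])
  qed
qed

lemma borel_measurable_vecI:
  fixes f :: "'a \<Rightarrow> 'b::euclidean_space^'n"
  assumes "\<And>i. (\<lambda>x. f x $ i) \<in> borel_measurable M"
  shows "f \<in> borel_measurable M"
  unfolding borel_measurable_euclidean_space[where f = f]
proof clarify
  fix b :: "'b^'n" assume "b \<in> Basis"
  have "(\<lambda>x. f x \<bullet> b) = (\<lambda>x. \<Sum>i\<in>UNIV. f x $ i \<bullet> b $ i)" by (simp add: inner_vec_def)
  also have "\<dots> \<in> borel_measurable M" using assms by measurable
  finally show "(\<lambda>x. f x \<bullet> b) \<in> borel_measurable M" .
qed

lemma borel_measurable_locally_integrable:
  fixes h :: "real^'d \<Rightarrow> complex"
  assumes "\<And>K. compact K \<Longrightarrow> set_integrable lebesgue K h"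
  shows "h \<in> borel_measurable lebesgue"
proof (rule borel_measurable_LIMSEQ_metric)
  show "(\<lambda>x. indicat_real (cball 0 (real n)) x *\<^sub>R h x) \<in> borel_measurable lebesgue" for n
    using assms[of "cball 0 (real n)"] unfolding set_integrable_def by (intro borel_measurable_integrable) auto
  show "(\<lambda>n. indicat_real (cball 0 (real n)) x *\<^sub>R h x) \<longlonglongrightarrow> h x" for x
  proof (rule tendsto_eventually)
    obtain N where "norm x \<le> real N" using real_arch_simple by blast
    then show "\<forall>\<^sub>F n in sequentially. indicat_real (cball 0 (real n)) x *\<^sub>R h x = h x"
      by (intro eventually_sequentiallyI[of N]) auto
  qed
qed

text \<open>On the null set where \<open>U x\<close> is not positive definite it is replaced by the identity matrix. The
  composition with the continuous power function is then measurable everywhere.\<close>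

lemma matrix_weight_powr_measurable:
  fixes U :: "real^'d \<Rightarrow> complex^'n^'n"
  assumes "matrix_weight U"
  obtains A where "A \<in> borel_measurable lebesgue" "AE x in lebesgue. mat_powr (U x) r = A x"
proof -
  have U: "U \<in> borel_measurable lebesgue"
    using assms unfolding matrix_weight_def
    by (intro borel_measurable_vecI borel_measurable_locally_integrable) blast
  have ae: "AE x in lebesgue. pos_definite (U x)" using assms by (simp add: matrix_weight_def)
  then have "Measurable.pred lebesgue (\<lambda>x. \<not> pos_definite (U x))"
    using sets_completion_AE[where M = lborel and P = "\<lambda>x. \<not> pos_definite (U x)"] by (simp add: AE_completion_iff)
  from pred_intros_logic(2)[OF this] have pd: "Measurable.pred lebesgue (\<lambda>x. pos_definite (U x))" by simp
  define U' where "U' x = (if pos_definite (U x) then U x else mat 1)" for x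
  have "pos_definite (mat 1 :: complex^'n^'n)"
  proof -
    have "0 < Re (herm v v)" if "v \<noteq> 0" for v :: "complex^'n"
      using that by (simp add: herm_self flip: of_real_power)
    moreover have "self_adjoint (mat 1 :: complex^'n^'n)"
      by (auto simp: self_adjoint_def mat_adjoint_def vec_eq_iff mat_def)
    ultimately show ?thesis unfolding pos_definite_def herm_def by (simp only: matrix_vector_mul_lid) blast
  qed
  then have "U' \<in> lebesgue \<rightarrow>\<^sub>M restrict_space borel {A. pos_definite A}"
    using U pd unfolding U'_def by (intro measurable_restrict_space2) auto
  then have "(\<lambda>x. mat_powr (U' x) r) \<in> borel_measurable lebesgue"
    by (rule measurable_compose)
       (intro borel_measurable_continuous_on_restrict continuous_on_mat_powr)
  moreover have "AE x in lebesgue. mat_powr (U x) r = mat_powr (U' x) r"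
    using ae by eventually_elim (simp add: U'_def)
  ultimately show ?thesis by (rule that)
qed

lemma norm_matrix_vector_mult_le:
  fixes A :: "complex^'n^'n"
  shows "norm (A *v v) \<le> norm A * (real CARD('n))\<^sup>2 * norm v"
proof -
  have "norm (A *v v) \<le> (\<Sum>i\<in>UNIV. norm ((A *v v) $ i))" unfolding norm_vec_def by (rule L2_set_le_sum) simp
  also have "\<dots> \<le> (\<Sum>i\<in>(UNIV::'n set). \<Sum>j\<in>(UNIV::'n set). norm A * norm v)"
  proof (rule sum_mono)
    fix i
    have "norm ((A *v v) $ i) \<le> (\<Sum>j\<in>UNIV. norm (A $ i $ j * v $ j))"
      unfolding matrix_vector_mult_def by (simp add: norm_sum)
    also have "\<dots> \<le> (\<Sum>j\<in>(UNIV::'n set). norm A * norm v)"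
      unfolding norm_mult
      by (intro sum_mono mult_mono) (auto intro: order_trans[OF Finite_Cartesian_Product.norm_nth_le] Finite_Cartesian_Product.norm_nth_le)
    finally show "norm ((A *v v) $ i) \<le> (\<Sum>j\<in>(UNIV::'n set). norm A * norm v)" .
  qed
  finally show ?thesis by (simp add: power2_eq_square mult_ac)
qed

lemma bounded_linear_matrix_vector_mult: "bounded_linear (\<lambda>v. (A :: complex^'n^'n) *v v)"
proof (rule bounded_linear_intro[where K = "norm A * (real CARD('n))\<^sup>2"])
  show "norm (A *v x) \<le> norm x * (norm A * (real CARD('n))\<^sup>2)" for x
    using norm_matrix_vector_mult_le[of A x] by (simp add: mult_ac)
qed (simp_all add: matrix_vector_right_distrib scaleR_eq_scale_of_real vector_scalar_commute)

lemma op_norm_nonneg: "0 \<le> op_norm A"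
  unfolding op_norm_def by (rule onorm_pos_le[OF bounded_linear_matrix_vector_mult])

lemma norm_le_op_norm: "norm (A *v v) \<le> op_norm A * norm v"
  unfolding op_norm_def by (rule onorm[OF bounded_linear_matrix_vector_mult])

lemma continuous_on_op_norm: "continuous_on UNIV (op_norm :: complex^'n^'n \<Rightarrow> real)"
proof -
  define c where "c = (real CARD('n))\<^sup>2"
  have "op_norm A - op_norm B \<le> c * norm (A - B)" for A B :: "complex^'n^'n"
  proof -
    have "op_norm (B + (A - B)) \<le> op_norm B + op_norm (A - B)"
      unfolding op_norm_def matrix_vector_mult_add_rdistrib
      by (intro onorm_triangle bounded_linear_matrix_vector_mult)
    moreover have "op_norm (A - B) \<le> c * norm (A - B)"
      unfolding op_norm_def c_def
      by (rule onorm_bound) (use norm_matrix_vector_mult_le[of "A - B"] in \<open>auto simp: mult_ac\<close>)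
    ultimately show ?thesis by simp
  qed
  then have "\<bar>op_norm A - op_norm B\<bar> \<le> c * norm (A - B)" for A B :: "complex^'n^'n"
    by (smt (verit) norm_minus_commute)
  then have "c-lipschitz_on UNIV (op_norm :: complex^'n^'n \<Rightarrow> real)"
    by (intro lipschitz_onI) (auto simp: dist_norm c_def)
  then show ?thesis by (rule lipschitz_on_continuous_on)
qed

lemma op_norm_measurable [measurable]: "op_norm \<in> borel_measurable borel"
  by (rule borel_measurable_continuous_onI[OF continuous_on_op_norm])

lemma matrix_mult_measurable [measurable]:
  fixes X Y :: "'b \<Rightarrow> complex^'n^'n"
  assumes [measurable]: "X \<in> borel_measurable M" "Y \<in> borel_measurable M"
  shows "(\<lambda>x. X x ** Y x) \<in> borel_measurable M"
proof (rule borel_measurable_continuous_Pair[OF assms])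
  show "continuous_on UNIV (\<lambda>x :: (complex^'n^'n) \<times> (complex^'n^'n). fst x ** snd x)"
    unfolding matrix_matrix_mult_def by (intro continuous_intros)
qed

lemma matrix_vector_mult_measurable [measurable]:
  fixes X :: "'b \<Rightarrow> complex^'n^'n" and Y :: "'b \<Rightarrow> complex^'n"
  assumes [measurable]: "X \<in> borel_measurable M" "Y \<in> borel_measurable M"
  shows "(\<lambda>x. X x *v Y x) \<in> borel_measurable M"
proof (rule borel_measurable_continuous_Pair[OF assms])
  show "continuous_on UNIV (\<lambda>x :: (complex^'n^'n) \<times> (complex^'n). fst x *v snd x)"
    unfolding matrix_vector_mult_def by (intro continuous_intros)
qed

section \<open>Auerbach families for seminorms\<close>

lemma seminorm_abs_diff:
  fixes \<rho> :: "complex^'n \<Rightarrow> real"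
  assumes tri: "\<And>v w. \<rho> (v + w) \<le> \<rho> v + \<rho> w" and hom: "\<And>c v. \<rho> (c *s v) = norm c * \<rho> v"
  shows "\<bar>\<rho> v - \<rho> w\<bar> \<le> \<rho> (v - w)"
proof -
  have "\<rho> (w - v) = \<rho> (v - w)" using hom[of "-1" "v - w"] by (simp add: vector_sneg_minus1[symmetric])
  then show ?thesis using tri[of w "v - w"] tri[of v "w - v"] by (simp add: algebra_simps abs_le_iff)
qed

lemma seminorm_sum_le:
  fixes \<rho> :: "complex^'n \<Rightarrow> real"
  assumes tri: "\<And>v w. \<rho> (v + w) \<le> \<rho> v + \<rho> w" and hom: "\<And>c v. \<rho> (c *s v) = norm c * \<rho> v"
  shows "\<rho> (\<Sum>i\<in>I. c i *s v i) \<le> (\<Sum>i\<in>I. norm (c i) * \<rho> (v i))"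
proof (induction I rule: infinite_finite_induct)
  case (insert i I)
  then show ?case using tri[of "c i *s v i" "\<Sum>i\<in>I. c i *s v i"] by (simp add: hom)
qed (use hom[of 0 0] in auto)

lemma vec_eq_sum_axis: "v = (\<Sum>i\<in>UNIV. v $ i *s axis i (1 :: complex))"
  by (simp add: vec_eq_iff axis_def if_distrib cong: if_cong)

lemma seminorm_le_norm:
  fixes \<rho> :: "complex^'n \<Rightarrow> real"
  assumes tri: "\<And>v w. \<rho> (v + w) \<le> \<rho> v + \<rho> w" and hom: "\<And>c v. \<rho> (c *s v) = norm c * \<rho> v"
    and nn: "\<And>v. 0 \<le> \<rho> v"
  shows "\<rho> v \<le> (\<Sum>i\<in>UNIV. \<rho> (axis i 1)) * norm v"
proof -
  have "\<rho> v \<le> (\<Sum>i\<in>UNIV. norm (v $ i) * \<rho> (axis i 1))"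
    by (subst vec_eq_sum_axis) (rule seminorm_sum_le[OF tri hom])
  also have "\<dots> \<le> (\<Sum>i\<in>UNIV. norm v * \<rho> (axis i 1))"
    by (intro sum_mono mult_right_mono Finite_Cartesian_Product.norm_nth_le nn)
  finally show ?thesis by (simp add: sum_distrib_left mult.commute)
qed

lemma seminorm_continuous:
  fixes \<rho> :: "complex^'n \<Rightarrow> real"
  assumes tri: "\<And>v w. \<rho> (v + w) \<le> \<rho> v + \<rho> w" and hom: "\<And>c v. \<rho> (c *s v) = norm c * \<rho> v"
    and nn: "\<And>v. 0 \<le> \<rho> v"
  shows "continuous_on UNIV \<rho>"
proof -
  define c where "c = (\<Sum>i\<in>UNIV. \<rho> (axis i 1))"
  have "c-lipschitz_on UNIV \<rho>"
    using seminorm_abs_diff[OF tri hom] seminorm_le_norm[OF tri hom nn]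
    by (intro lipschitz_onI)
      (auto simp: dist_norm c_def intro!: sum_nonneg nn intro: order_trans)
  then show ?thesis by (rule lipschitz_on_continuous_on)
qed

text \<open>A norm on a finite-dimensional space attains a positive minimum on the Euclidean unit sphere.\<close>

lemma norm_bounds_euclidean:
  fixes \<rho> :: "complex^'n \<Rightarrow> real"
  assumes tri: "\<And>v w. \<rho> (v + w) \<le> \<rho> v + \<rho> w" and hom: "\<And>c v. \<rho> (c *s v) = norm c * \<rho> v"
    and nn: "\<And>v. 0 \<le> \<rho> v" and def: "\<And>v. \<rho> v = 0 \<Longrightarrow> v = 0"
  obtains m where "0 < m" "\<And>v. m * norm v \<le> \<rho> v"
proof -
  have sc: "\<rho> (r *\<^sub>R v) = \<bar>r\<bar> * \<rho> v" for r v
  proof -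
    have "r *\<^sub>R v = complex_of_real r *s v" by (simp add: vec_eq_iff scaleR_conv_of_real[where 'a = complex])
    then show ?thesis by (simp add: hom)
  qed
  have "axis undefined 1 \<in> sphere (0 :: complex^'n) 1" by simp
  then have "sphere (0 :: complex^'n) 1 \<noteq> {}" by blast
  from continuous_attains_inf[OF compact_sphere this continuous_on_subset[OF seminorm_continuous[OF tri hom nn]]]
  obtain u where u: "norm u = 1" "\<And>v. norm v = 1 \<Longrightarrow> \<rho> u \<le> \<rho> v" by auto
  have "0 < \<rho> u" using nn[of u] def[of u] u(1) by fastforce
  moreover have "\<rho> u * norm v \<le> \<rho> v" for v
  proof (cases "v = 0")
    case False
    then have "\<rho> u \<le> \<rho> ((1 / norm v) *\<^sub>R v)" by (intro u(2)) simp
    with False show ?thesis by (simp add: sc field_simps)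
  qed (simp add: nn)
  ultimately show ?thesis by (rule that)
qed

text \<open>Among all bases inside the closed unit ball of \<open>\<rho>\<close> take one of maximal determinant. By Cramer's rule,
  replacing the \<open>k\<close>-th basis vector by \<open>v / \<rho> v\<close> multiplies the determinant by the \<open>k\<close>-th coordinate of
  that vector, so by maximality all coordinates of \<open>v\<close> are at most \<open>\<rho> v\<close>.\<close>

lemma auerbach_basis_norm:
  fixes \<rho> :: "complex^'n \<Rightarrow> real"
  assumes tri: "\<And>v w. \<rho> (v + w) \<le> \<rho> v + \<rho> w" and hom: "\<And>c v. \<rho> (c *s v) = norm c * \<rho> v"
    and nn: "\<And>v. 0 \<le> \<rho> v" and def: "\<And>v. \<rho> v = 0 \<Longrightarrow> v = 0"
  shows "\<exists>b :: 'n \<Rightarrow> complex^'n. (\<forall>i. \<rho> (b i) \<le> 1) \<and>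
    (\<forall>v. \<exists>c. (\<forall>i. norm (c i) \<le> \<rho> v) \<and> v = (\<Sum>i\<in>UNIV. c i *s b i))"
proof -
  obtain m where m: "0 < m" "\<And>v. m * norm v \<le> \<rho> v" using norm_bounds_euclidean[OF tri hom nn def] by blast
  define K :: "(complex^'n^'n) set" where "K = {B. \<forall>i. \<rho> (B $ i) \<le> 1}"
  have "closed K"
  proof -
    have "K = (\<Inter>i. {B. \<rho> (B $ i) \<le> 1})" by (auto simp: K_def)
    moreover have "closed {B :: complex^'n^'n. \<rho> (B $ i) \<le> 1}" for i
      by (intro closed_Collect_le continuous_on_compose2[OF seminorm_continuous[OF tri hom nn]] continuous_intros) auto
    ultimately show ?thesis by auto
  qed
  moreover have "bounded K"
  proof -
    have "norm B \<le> real CARD('n) * (1 / m)" if "B \<in> K" for B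
    proof -
      have "norm (B $ i) \<le> 1 / m" for i
      proof -
        have "m * norm (B $ i) \<le> 1" using m(2)[of "B $ i"] that unfolding K_def by (auto intro: order_trans)
        then show ?thesis using m(1) by (simp add: field_simps)
      qed
      then have "(\<Sum>i\<in>UNIV. norm (B $ i)) \<le> (\<Sum>i\<in>(UNIV::'n set). 1 / m)" by (intro sum_mono)
      moreover have "norm B \<le> (\<Sum>i\<in>UNIV. norm (B $ i))" unfolding norm_vec_def by (rule L2_set_le_sum) simp
      ultimately show ?thesis by simp
    qed
    then show ?thesis unfolding bounded_iff by blast
  qed
  ultimately have "compact K" by (simp add: compact_eq_bounded_closed)
  moreover have z: "\<rho> 0 = 0" using hom[of 0 0] by simp
  then have "0 \<in> K" by (simp add: K_def)
  then have "K \<noteq> {}" by blast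
  moreover have "continuous_on K (\<lambda>B. norm (det B))" unfolding det_def by (intro continuous_intros)
  ultimately have "\<exists>B\<in>K. \<forall>B'\<in>K. norm (det B') \<le> norm (det B)" by (rule continuous_attains_sup)
  then obtain B where B: "B \<in> K" "\<And>B'. B' \<in> K \<Longrightarrow> norm (det B') \<le> norm (det B)" by auto
  define t where "t = 1 / (\<Sum>i\<in>UNIV. \<rho> (axis i 1) + 1)"
  have S: "0 < (\<Sum>i\<in>(UNIV::'n set). \<rho> (axis i 1) + 1)" by (intro sum_pos add_nonneg_pos nn) auto
  have t0: "0 < t" using S by (simp add: t_def)
  \<comment> \<open>A small multiple of the standard basis lies in \<open>K\<close>, so the maximal determinant is not zero.\<close>
  have "det B \<noteq> 0"
  proof -
    define D :: "complex^'n^'n" where "D = (\<chi> i. complex_of_real t *s axis i 1)"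
    have "D \<in> K"
    proof -
      have "\<rho> (D $ i) \<le> 1" for i
      proof -
        have "\<rho> (axis i 1) + 1 \<le> (\<Sum>i\<in>(UNIV::'n set). \<rho> (axis i 1) + 1)"
          by (rule member_le_sum) (auto intro: add_nonneg_nonneg nn)
        then have "t * \<rho> (axis i 1) \<le> 1" using S by (simp add: t_def divide_le_eq)
        moreover have "norm (complex_of_real t) = t" using S by (simp add: t_def del: of_real_divide of_real_sum)
        ultimately show ?thesis by (simp add: D_def hom)
      qed
      then show ?thesis by (simp add: K_def)
    qed
    moreover have "det D = of_real t ^ CARD('n)"
    proof -
      have "det D = (\<Prod>i\<in>UNIV. D $ i $ i)" by (rule det_diagonal) (simp add: D_def axis_def)
      then show ?thesis by (simp add: D_def axis_def)
    qed
    moreover have "0 < t ^ CARD('n)" using t0 by (rule zero_less_power)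
    ultimately have "0 < norm (det D)" using t0 by (simp add: norm_power)
    with \<open>D \<in> K\<close> show ?thesis using B(2)[of D] by auto
  qed
  then have "invertible B" by (simp add: invertible_det_nz)
  then obtain B' where inv: "B' ** B = mat 1" unfolding invertible_def by blast
  have "\<exists>c. (\<forall>i. norm (c i) \<le> \<rho> v) \<and> v = (\<Sum>i\<in>UNIV. c i *s B $ i)" for v
  proof -
    define c where "c = transpose (B') *v v"
    have vc: "transpose B *v c = v"
    proof -
      have "transpose B *v c = transpose (B' ** B) *v v"
        by (simp only: c_def matrix_vector_mul_assoc matrix_transpose_mul)
      then show ?thesis by (simp add: inv)
    qed
    then have v: "v = (\<Sum>i\<in>UNIV. c $ i *s B $ i)"
      by (auto simp: vec_eq_iff matrix_vector_mult_def transpose_def mult.commute)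
    have "norm (c $ k) \<le> \<rho> v" for k
    proof (cases "v = 0")
      case True
      then show ?thesis by (simp add: c_def z)
    next
      case False
      then have pv: "0 < \<rho> v" using nn[of v] def[of v] by fastforce
      define r where "r = complex_of_real (1 / \<rho> v)"
      have nr: "norm r = 1 / \<rho> v" using pv by (simp add: r_def norm_divide)
      have rB: "row i B = B $ i" for i by (simp add: row_def vec_lambda_eta)
      have e: "det (\<chi> i. if i = k then v else B $ i) = c $ k * det B"
        using cramer_lemma_transpose[of k c B] unfolding rB v[symmetric] .
      have e: "det (\<chi> i. if i = k then r *s v else B $ i) = r * (c $ k * det B)"
        using det_row_mul[of k r "\<lambda>i. v" "\<lambda>i. B $ i"] e by (simp cong: if_cong)
      have "(\<chi> i. if i = k then r *s v else B $ i) \<in> K"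
        using B(1) pv nr by (auto simp: K_def hom)
      from B(2)[OF this] have "norm r * norm (c $ k) * norm (det B) \<le> 1 * norm (det B)"
        by (simp add: e norm_mult mult.assoc)
      then have "norm r * norm (c $ k) \<le> 1" using \<open>det B \<noteq> 0\<close> by (metis mult_le_cancel_right zero_less_norm_iff not_less)
      then show ?thesis using pv by (simp add: nr field_simps)
    qed
    with v show ?thesis by blast
  qed
  moreover have "\<rho> (B $ i) \<le> 1" for i using B(1) by (simp add: K_def)
  ultimately show ?thesis by (intro exI[of _ "\<lambda>i. B $ i"]) auto
qed

text \<open>For a seminorm with kernel \<open>N\<close>, adding the Euclidean norm of the orthogonal projection \<open>\<pi>\<close> onto \<open>N\<close> gives a norm
  which agrees with \<open>\<rho>\<close> on the complement of \<open>N\<close>. An Auerbach basis of that norm represents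
  every vector up to an element of the kernel, with coefficients bounded by \<open>\<rho>\<close>.\<close>

lemma auerbach_family_seminorm:
  fixes \<rho> :: "complex^'n \<Rightarrow> real"
  assumes tri: "\<And>v w. \<rho> (v + w) \<le> \<rho> v + \<rho> w" and hom: "\<And>c v. \<rho> (c *s v) = norm c * \<rho> v"
    and nn: "\<And>v. 0 \<le> \<rho> v"
  shows "\<exists>b :: 'n \<Rightarrow> complex^'n. (\<forall>i. \<rho> (b i) \<le> 1) \<and>
    (\<forall>v. \<exists>c. (\<forall>i. norm (c i) \<le> \<rho> v) \<and> \<rho> (v - (\<Sum>i\<in>UNIV. c i *s b i)) = 0)"
proof -
  define N where "N = {v. \<rho> v = 0}"
  have z: "\<rho> 0 = 0" using hom[of 0 0] by simp
  have N: "subspace N"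
  proof (rule subspaceI)
    fix x y assume "x \<in> N" "y \<in> N"
    then show "x + y \<in> N" using tri[of x y] nn[of "x + y"] by (simp add: N_def)
  qed (auto simp: N_def z scaleR_eq_scale_of_real hom)
  have NC: "c *s v \<in> N" if "v \<in> N" for c v using that by (simp add: N_def hom)
  define pr where "pr v y \<longleftrightarrow> y \<in> N \<and> (\<forall>w\<in>N. (v - y) \<bullet> w = 0)" for v y
  have "\<exists>y. pr v y" for v
    using orthogonal_subspace_decomp_exists[of N v] span_eq_iff[THEN iffD2, OF N]
    unfolding pr_def orthogonal_def by (metis add_diff_cancel_left')
  then obtain \<pi> where \<pi>: "\<And>v. pr v (\<pi> v)" by metis
  have uniq: "y = \<pi> v" if "pr v y" for v y
  proof -
    have "y - \<pi> v \<in> N" using that \<pi>[of v] N by (simp add: pr_def subspace_diff)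
    then have "(v - \<pi> v) \<bullet> (y - \<pi> v) - (v - y) \<bullet> (y - \<pi> v) = 0" using that \<pi>[of v] by (simp add: pr_def)
    then have "(y - \<pi> v) \<bullet> (y - \<pi> v) = 0" by (simp add: inner_diff_left)
    then show ?thesis by simp
  qed
  have \<pi>N: "\<pi> v \<in> N" for v using \<pi>[of v] by (simp add: pr_def)
  have \<pi>_add: "\<pi> (v + w) = \<pi> v + \<pi> w" for v w
  proof (rule uniq[symmetric])
    show "pr (v + w) (\<pi> v + \<pi> w)"
      using \<pi>[of v] \<pi>[of w] N by (auto simp: pr_def subspace_add add_diff_add inner_add_left)
  qed
  have adj: "(c *s v) \<bullet> w = v \<bullet> (cnj c *s w)" for c v and w :: "complex^'n"
    by (simp add: inner_eq_Re_herm herm_scale_left herm_scale_right)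
  have \<pi>_scale: "\<pi> (c *s v) = c *s \<pi> v" for c v
  proof (rule uniq[symmetric])
    show "pr (c *s v) (c *s \<pi> v)"
      using \<pi>[of v] unfolding pr_def vector_ssub_ldistrib[symmetric] adj by (auto simp only: NC)
  qed
  have \<pi>_id: "\<pi> v = v" if "v \<in> N" for v
    by (rule uniq[symmetric]) (use that in \<open>simp add: pr_def\<close>)
  define \<sigma> where "\<sigma> v = \<rho> v + norm (\<pi> v)" for v
  have 1: "\<sigma> (v + w) \<le> \<sigma> v + \<sigma> w" for v w
    using tri[of v w] norm_triangle_ineq[of "\<pi> v" "\<pi> w"] by (simp add: \<sigma>_def \<pi>_add)
  have norm_scale: "norm (c *s v) = norm c * norm v" for c and v :: "complex^'n"
    by (simp add: norm_vec_def norm_mult L2_set_right_distrib)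
  then have 2: "\<sigma> (c *s v) = norm c * \<sigma> v" for c v
    by (simp add: \<sigma>_def hom \<pi>_scale distrib_left)
  have 3: "0 \<le> \<sigma> v" for v by (simp add: \<sigma>_def nn)
  have 4: "v = 0" if "\<sigma> v = 0" for v
  proof -
    have "\<rho> v = 0" "\<pi> v = 0" using that nn[of v] by (auto simp: \<sigma>_def add_nonneg_eq_0_iff)
    then show ?thesis using \<pi>_id[of v] by (simp add: N_def)
  qed
  obtain b :: "'n \<Rightarrow> complex^'n" where b: "\<And>i. \<sigma> (b i) \<le> 1"
    and rep: "\<And>v. \<exists>c. (\<forall>i. norm (c i) \<le> \<sigma> v) \<and> v = (\<Sum>i\<in>UNIV. c i *s b i)"
    using auerbach_basis_norm[of \<sigma>, OF 1 2 3 4] by auto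
  show ?thesis
  proof (intro exI[of _ b] conjI allI)
    show "\<rho> (b i) \<le> 1" for i using b[of i] norm_ge_zero[of "\<pi> (b i)"] unfolding \<sigma>_def by linarith
    show "\<exists>c. (\<forall>i. norm (c i) \<le> \<rho> v) \<and> \<rho> (v - (\<Sum>i\<in>UNIV. c i *s b i)) = 0" for v
    proof -
      obtain c where c: "\<And>i. norm (c i) \<le> \<sigma> (v - \<pi> v)" "v - \<pi> v = (\<Sum>i\<in>UNIV. c i *s b i)"
        using rep by blast
      have "\<pi> (v - \<pi> v) + \<pi> (\<pi> v) = \<pi> v" using \<pi>_add[of "v - \<pi> v" "\<pi> v"] by simp
      then have \<pi>0: "\<pi> (v - \<pi> v) = 0" using \<pi>_id[OF \<pi>N] by simp
      have "\<bar>\<rho> (v - \<pi> v) - \<rho> v\<bar> \<le> \<rho> ((-1) *s \<pi> v)"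
        using seminorm_abs_diff[OF tri hom, of "v - \<pi> v" v] by (simp add: vector_sneg_minus1[symmetric])
      moreover have "\<rho> ((-1) *s \<pi> v) = 0" using \<pi>N[of v] unfolding hom by (simp add: N_def)
      ultimately have "\<rho> (v - \<pi> v) = \<rho> v" by linarith
      then have "\<sigma> (v - \<pi> v) = \<rho> v" by (simp add: \<sigma>_def \<pi>0)
      moreover have "v - (\<Sum>i\<in>UNIV. c i *s b i) = \<pi> v" using c(2) by (metis diff_diff_eq2 add_diff_cancel_left')
      ultimately show ?thesis using c(1) \<pi>N[of v] by (intro exI[of _ c]) (simp add: N_def)
    qed
  qed
qed

section \<open>Cubes and shifted dyadic grids\<close>

text \<open>Closed cubes of one dyadic grid can share faces. Nesting or null overlap is all that the measure
  estimates need, and closed cubes are the ones over which the weight condition is formulated.\<close>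

definition almost_laminar :: "(real^'d) set set \<Rightarrow> bool" where
  "almost_laminar F \<longleftrightarrow> (\<forall>P\<in>F. \<forall>Q\<in>F. P \<subseteq> Q \<or> Q \<subseteq> P \<or> negligible (P \<inter> Q))"

definition cube :: "real^'d \<Rightarrow> real \<Rightarrow> (real^'d) set" where
  "cube a l = cbox a (\<chi> i. a $ i + l)"

lemma cubes_eq: "Q \<in> cubes \<longleftrightarrow> (\<exists>a l. 0 < l \<and> Q = cube a l)"
  by (auto simp: cubes_def cube_def)

lemma mem_cube: "x \<in> cube a l \<longleftrightarrow> (\<forall>i. a $ i \<le> x $ i \<and> x $ i \<le> a $ i + l)"
  by (simp add: cube_def mem_box_cart)

lemma cube_subset: "(\<And>i. b $ i \<le> a $ i \<and> a $ i + l \<le> b $ i + s) \<Longrightarrow> cube a l \<subseteq> cube b s"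
  by (auto simp: mem_cube) (smt (verit))+

lemma vol_cube: "0 \<le> l \<Longrightarrow> vol (cube a l :: (real^'d) set) = l ^ CARD('d)"
  by (simp add: vol_def cube_def content_cbox_cart interval_ne_empty_cart(1))

lemma vol_cube_pos: "Q \<in> cubes \<Longrightarrow> 0 < vol Q"
  by (auto simp: cubes_eq vol_cube)

lemma cube_lmeasurable: "Q \<in> cubes \<Longrightarrow> Q \<in> lmeasurable"
  by (auto simp: cubes_eq cube_def)

lemma cube_sets: "Q \<in> cubes \<Longrightarrow> Q \<in> sets lebesgue"
  by (auto simp: cubes_eq cube_def)

lemma emeasure_cube: "Q \<in> cubes \<Longrightarrow> emeasure lebesgue Q = ennreal (vol Q)"
  unfolding vol_def by (intro emeasure_eq_measure2 cube_lmeasurable)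

lemma negligible_cube_overlap:
  fixes a b :: "real^'d"
  assumes "a $ i + l \<le> b $ i"
  shows "negligible (cube a l \<inter> cube b s)"
proof (rule negligible_subset)
  show "cube a l \<inter> cube b s \<subseteq> {x :: real^'d. axis i 1 \<bullet> x = b $ i}"
    using assms by (auto simp: mem_cube inner_axis') (smt (verit))
  show "negligible {x :: real^'d. axis i 1 \<bullet> x = b $ i}" by (rule negligible_hyperplane) simp
qed

text \<open>The side lengths are \<open>L / 2^j\<close> with one fixed top length \<open>L\<close>. Coordinates in \<open>T\<close> are shifted by \<open>L/3\<close>,
  which modulo each side length is one or two thirds of it, because \<open>3\<close> does not divide \<open>2^j\<close>. So the
  same shift serves all scales, and each shifted grid is again nested.\<close>

definition grid_shift :: "real \<Rightarrow> 'd set \<Rightarrow> real^'d" where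
  "grid_shift L T = (\<chi> i. if i \<in> T then L / 3 else 0)"

definition grid_cube :: "real \<Rightarrow> 'd set \<Rightarrow> nat \<Rightarrow> ('d \<Rightarrow> int) \<Rightarrow> (real^'d) set" where
  "grid_cube L T j m = cube (\<chi> i. L / 2 ^ j * of_int (m i) + grid_shift L T $ i) (L / 2 ^ j)"

lemma grid_cube_nested:
  assumes L: "0 < L" and jk: "j \<le> k"
  shows "grid_cube L T k m \<subseteq> grid_cube L T j m' \<or> negligible (grid_cube L T k m \<inter> grid_cube L T j m')"
proof -
  define s where "s = L / 2 ^ k"
  define K :: int where "K = 2 ^ (k - j)"
  have s: "0 < s" using L by (simp add: s_def)
  have "(2 :: real) ^ k = 2 ^ (k - j) * 2 ^ j" using jk by (simp flip: power_add)
  then have Ls: "L / 2 ^ j = s * of_int K" by (simp add: s_def K_def)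
  have gk: "grid_cube L T k m = cube (\<chi> i. s * of_int (m i) + grid_shift L T $ i) s"
    by (simp add: grid_cube_def s_def)
  have gj: "grid_cube L T j m' = cube (\<chi> i. s * of_int (K * m' i) + grid_shift L T $ i) (s * of_int K)"
    by (simp add: grid_cube_def Ls mult_ac)
  show ?thesis
  proof (cases "\<forall>i. K * m' i \<le> m i \<and> m i + 1 \<le> K * (m' i + 1)")
    case True
    have "s * of_int (K * m' i) \<le> s * of_int (m i)" "s * of_int (m i + 1) \<le> s * of_int (K * (m' i + 1))" for i
      using True s by (intro mult_left_mono; simp only: of_int_le_iff; simp)+
    then have "grid_cube L T k m \<subseteq> grid_cube L T j m'"
      unfolding gk gj by (intro cube_subset) (auto simp: algebra_simps)
    then show ?thesis ..
  next
    case False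
    then obtain i where "\<not> (K * m' i \<le> m i \<and> m i + 1 \<le> K * (m' i + 1))" by blast
    then have "m i + 1 \<le> K * m' i \<or> K * (m' i + 1) \<le> m i" by linarith
    then show ?thesis
    proof
      assume "m i + 1 \<le> K * m' i"
      then have "s * of_int (m i + 1) \<le> s * of_int (K * m' i)"
        using s by (intro mult_left_mono) (simp only: of_int_le_iff, simp)
      then show ?thesis unfolding gk gj
        by (intro disjI2 negligible_cube_overlap[where i = i]) (simp add: algebra_simps)
    next
      assume "K * (m' i + 1) \<le> m i"
      then have "s * of_int (K * (m' i + 1)) \<le> s * of_int (m i)"
        using s by (intro mult_left_mono) (simp only: of_int_le_iff, simp)
      then show ?thesis unfolding gk gj Int_commute[of "cube _ s"]
        by (intro disjI2 negligible_cube_overlap[where i = i]) (simp add: algebra_simps)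
    qed
  qed
qed

lemma grid_almost_laminar:
  assumes L: "0 < L" and F: "F \<subseteq> {grid_cube L T j m | j m. True}"
  shows "almost_laminar F"
  unfolding almost_laminar_def
proof (intro ballI)
  fix P Q assume "P \<in> F" "Q \<in> F"
  then obtain j m k m' where PQ: "P = grid_cube L T j m" "Q = grid_cube L T k m'" using F by blast
  show "P \<subseteq> Q \<or> Q \<subseteq> P \<or> negligible (P \<inter> Q)"
    using grid_cube_nested[OF L, of j k T m' m] grid_cube_nested[OF L, of k j T m m'] nat_le_linear[of j k]
    unfolding PQ by (auto simp: Int_commute)
qed

text \<open>The endpoints of the unshifted and of the shifted dyadic intervals of length \<open>L / 2^j\<close> stay at distance at least a third of this
  length apart, so an interval shorter than that cannot contain an endpoint of both kinds.\<close>

lemma one_third_trick: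
  fixes a l L :: real
  assumes L: "0 < L" and l: "0 < l" "l < L / 2 ^ j / 3"
  obtains m :: int and t where "t \<in> {0, L / 3}"
    "L / 2 ^ j * of_int m + t \<le> a" "a + l \<le> L / 2 ^ j * of_int m + t + L / 2 ^ j"
proof -
  define s where "s = L / 2 ^ j"
  have s: "0 < s" using L by (simp add: s_def)
  have fl: "s * of_int \<lfloor>z / s\<rfloor> \<le> z" "z < s * of_int \<lfloor>z / s\<rfloor> + s" for z
  proof -
    have "s * of_int \<lfloor>z / s\<rfloor> \<le> s * (z / s)" "s * (z / s) < s * (of_int \<lfloor>z / s\<rfloor> + 1)"
      using s by (intro mult_left_mono mult_strict_left_mono; linarith)+
    then show "s * of_int \<lfloor>z / s\<rfloor> \<le> z" "z < s * of_int \<lfloor>z / s\<rfloor> + s" 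
      using s by (simp_all add: distrib_left)
  qed
  define m where "m = \<lfloor>a / s\<rfloor>"
  define m' where "m' = \<lfloor>(a - L / 3) / s\<rfloor>"
  have m: "s * of_int m \<le> a" "a < s * of_int m + s" using fl[of a] by (simp_all add: m_def)
  have m': "s * of_int m' + L / 3 \<le> a" "a < s * of_int m' + L / 3 + s" using fl[of "a - L / 3"] by (simp_all add: m'_def)
  consider "a + l \<le> s * of_int m + s" | "a + l \<le> s * of_int m' + L / 3 + s"
    | "s * of_int m + s < a + l" "s * of_int m' + L / 3 + s < a + l" by linarith
  then show ?thesis
  proof cases
    case 1 with m show ?thesis by (intro that[of 0 m]) (auto simp: s_def)
  next
    case 2 with m' show ?thesis by (intro that[of "L / 3" m']) (auto simp: s_def)
  next
    case 3
    \<comment> \<open>Both endpoints lie in an interval of length \<open>l\<close>, and their distance is \<open>s/3\<close> times the integer \<open>N\<close>.\<close>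
    define N where "N = 3 * (m - m') - 2 ^ j"
    have Ls: "L = s * 2 ^ j" by (simp add: s_def)
    have "\<bar>(s * of_int m + s) - (s * of_int m' + L / 3 + s)\<bar> < l" using 3 m m' by linarith
    also have "(s * of_int m + s) - (s * of_int m' + L / 3 + s) = s / 3 * of_int N"
      by (simp add: N_def Ls field_simps)
    finally have "s / 3 * \<bar>of_int N\<bar> < l" using s by (simp add: abs_mult)
    also have "l < s / 3 * 1" using l by (simp add: s_def)
    finally have "\<bar>real_of_int N\<bar> < 1" using s by (simp only: mult_less_cancel_left_pos[of "s / 3"])
    then have "N = 0" by linarith
    then have "3 * (m - m') = 2 ^ j" by (simp add: N_def)
    then have "(3::int) dvd 2 ^ j" by (metis dvd_triv_left)
    then have "(3::int) dvd 2" by (rule prime_dvd_power[rotated]) simp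
    then show ?thesis by simp
  qed
qed

text \<open>Choosing the finest scale with \<open>l < L / 2^j / 3\<close> makes the side of the grid cube at most \<open>6 l\<close>. The
  coordinates choose independently between the shifted and the unshifted grid, which produces \<open>T\<close>.\<close>

lemma cube_subset_grid_cube:
  fixes Q :: "(real^'d) set"
  assumes L: "0 < L" and Q: "Q = cube a l" "0 < l" "l < L / 3"
  obtains T j m where "Q \<subseteq> grid_cube L T j m" "vol (grid_cube L T j m) \<le> 6 ^ CARD('d) * vol Q"
proof -
  have "\<exists>n. L / 2 ^ n / 3 \<le> l"
  proof -
    obtain n where "L / 3 / l < 2 ^ n" using real_arch_pow[of 2 "L / 3 / l"] by auto
    then show ?thesis using Q(2) by (intro exI[of _ n]) (simp add: field_simps)
  qed
  then obtain n where n: "L / 2 ^ n / 3 \<le> l" by blast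
  have "\<not> L / 2 ^ 0 / 3 \<le> l" using Q(3) by simp
  from ex_least_nat_less[of "\<lambda>n. L / 2 ^ n / 3 \<le> l", OF n this]
  obtain j where j: "L / 2 ^ Suc j / 3 \<le> l" "l < L / 2 ^ j / 3" by (auto simp: not_le)
  have "\<exists>m t. t \<in> {0, L / 3} \<and> L / 2 ^ j * real_of_int m + t \<le> a $ i \<and>
      a $ i + l \<le> L / 2 ^ j * of_int m + t + L / 2 ^ j" for i
    by (rule one_third_trick[OF L Q(2) j(2), of "a $ i"]) blast
  then obtain m t where mt: "\<And>i. t i \<in> {0, L / 3}" "\<And>i. L / 2 ^ j * real_of_int (m i) + t i \<le> a $ i"
    "\<And>i. a $ i + l \<le> L / 2 ^ j * of_int (m i) + t i + L / 2 ^ j" by metis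
  define T where "T = {i. t i = L / 3}"
  have t: "t i = grid_shift L T $ i" for i using mt(1)[of i] by (auto simp: T_def grid_shift_def)
  show ?thesis
  proof (rule that)
    show "Q \<subseteq> grid_cube L T j m"
      unfolding Q grid_cube_def using mt(2,3) by (intro cube_subset) (simp add: t)
    have "vol (grid_cube L T j m) = (L / 2 ^ j) ^ CARD('d)"
      unfolding grid_cube_def using L by (intro vol_cube) simp
    also have "\<dots> \<le> (6 * l) ^ CARD('d)"
      using j(1) L by (intro power_mono) (simp_all add: field_simps)
    finally show "vol (grid_cube L T j m) \<le> 6 ^ CARD('d) * vol Q"
      using Q by (simp add: vol_cube power_mult_distrib)
  qed
qed

lemma grid_cube_in_cubes: "0 < L \<Longrightarrow> grid_cube L T j m \<in> cubes"
  unfolding cubes_eq grid_cube_def by (rule exI, rule exI[of _ "L / 2 ^ j"], simp)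

text \<open>The members of \<open>F T\<close> all come from the grid with shift \<open>T\<close>, so the supremum over \<open>\<Q>\<close> is controlled by
  \<open>2^d\<close> suprema over nested families.\<close>

lemma finite_cubes_laminar_cover:
  fixes \<Q> :: "(real^'d) set set"
  assumes fin: "finite \<Q>" and sub: "\<Q> \<subseteq> cubes"
  obtains F :: "'d set \<Rightarrow> (real^'d) set set" where
    "\<And>T. finite (F T)" "\<And>T. F T \<subseteq> cubes" "\<And>T. almost_laminar (F T)"
    "\<And>Q. Q \<in> \<Q> \<Longrightarrow> \<exists>T. \<exists>P\<in>F T. Q \<subseteq> P \<and> vol P \<le> 6 ^ CARD('d) * vol Q"
proof -
  have "\<forall>Q\<in>\<Q>. \<exists>a l. 0 < l \<and> Q = cube a l" using sub by (auto simp: cubes_eq)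
  then obtain a l where al: "\<And>Q. Q \<in> \<Q> \<Longrightarrow> 0 < l Q" "\<And>Q. Q \<in> \<Q> \<Longrightarrow> Q = cube (a Q) (l Q)" by metis
  define L where "L = 3 * (\<Sum>Q\<in>\<Q>. l Q) + 1"
  have "0 \<le> (\<Sum>Q\<in>\<Q>. l Q)" using al(1) by (intro sum_nonneg) (auto intro: less_imp_le)
  then have L: "0 < L" by (simp add: L_def)
  have "l Q < L / 3" if "Q \<in> \<Q>" for Q
  proof -
    have "l Q \<le> (\<Sum>Q\<in>\<Q>. l Q)" using fin that al(1) by (intro member_le_sum) (auto intro: less_imp_le)
    then show ?thesis by (simp add: L_def)
  qed
  then have "\<exists>T j m. Q \<subseteq> grid_cube L T j m \<and> vol (grid_cube L T j m) \<le> 6 ^ CARD('d) * vol Q"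
    if "Q \<in> \<Q>" for Q
    using cube_subset_grid_cube[OF L al(2)[OF that] al(1)[OF that]] that by metis
  then obtain T j m where Tjm: "\<And>Q. Q \<in> \<Q> \<Longrightarrow> Q \<subseteq> grid_cube L (T Q) (j Q) (m Q) \<and>
      vol (grid_cube L (T Q) (j Q) (m Q)) \<le> 6 ^ CARD('d) * vol Q" by metis
  define F where "F T' = (\<lambda>Q. grid_cube L (T Q) (j Q) (m Q)) ` {Q\<in>\<Q>. T Q = T'}" for T'
  show ?thesis
  proof (rule that[of F])
    show "finite (F T')" for T' using fin by (simp add: F_def)
    show "F T' \<subseteq> cubes" for T' using L by (auto simp: F_def grid_cube_in_cubes)
    show "almost_laminar (F T')" for T' by (rule grid_almost_laminar[OF L, of _ T']) (auto simp: F_def)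
    show "\<exists>T'. \<exists>P\<in>F T'. Q \<subseteq> P \<and> vol P \<le> 6 ^ CARD('d) * vol Q" if "Q \<in> \<Q>" for Q
      using Tjm[OF that] that by (intro exI[of _ "T Q"]) (auto simp: F_def)
  qed
qed

section \<open>Powers in [0, \<infinity>], averages and Orlicz norms\<close>

lemma ennpowr_ennreal: "0 \<le> x \<Longrightarrow> ennpowr (ennreal x) r = ennreal (x powr r)"
  by (simp add: ennpowr_def)

lemma ennpowr_top [simp]: "ennpowr top r = top"
  by (simp add: ennpowr_def)

lemma ennpowr_0 [simp]: "ennpowr 0 r = 0"
  by (simp add: ennpowr_def)

lemma ennpowr_one [simp]: "ennpowr x 1 = x"
  by (cases x) (auto simp: ennpowr_def)

lemma ennpowr_mono: "x \<le> y \<Longrightarrow> 0 \<le> r \<Longrightarrow> ennpowr x r \<le> ennpowr y r"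
  by (cases x; cases y) (auto simp: ennpowr_def top_unique intro!: ennreal_leI powr_mono2)

lemma ennpowr_ennpowr: "ennpowr (ennpowr x a) b = ennpowr x (a * b)"
  by (cases x) (auto simp: ennpowr_def powr_powr)

lemma ennpowr_eq_0: "ennpowr x r = 0 \<longleftrightarrow> x = 0"
  by (cases x) (auto simp: ennpowr_def)

lemma ennpowr_mult: "ennpowr (x * y) r = ennpowr x r * ennpowr y r"
proof -
  have T: "ennpowr (\<infinity> * z) r = \<infinity> * ennpowr z r" for z
    by (cases "z = 0") (simp_all add: ennreal_top_mult ennpowr_eq_0)
  show ?thesis
  proof (cases x)
    case top
    then show ?thesis using T[of y] by simp
  next
    case x: (real a)
    show ?thesis
    proof (cases y)
      case top
      then show ?thesis using T[of x] by (simp add: mult.commute)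
    next
      case (real b)
      then show ?thesis using x by (simp add: ennpowr_ennreal powr_mult flip: ennreal_mult)
    qed
  qed
qed

lemma ennpowr_less_top: "ennpowr x r < top \<longleftrightarrow> x < top"
  by (cases x) (auto simp: ennpowr_def)

lemma ennpowr_measurable [measurable]:
  assumes [measurable]: "f \<in> borel_measurable M"
  shows "(\<lambda>x. ennpowr (f x) r) \<in> borel_measurable M"
  unfolding ennpowr_def by measurable

lemma ennpowr_mult_self:
  assumes "x < \<infinity>" shows "ennpowr x (r - 1) * x = ennpowr x r"
  using assms by (cases x) (auto simp: ennpowr_def powr_diff simp flip: ennreal_mult split: if_splits)

text \<open>Convexity of \<open>x powr r\<close>: its graph lies above the tangent at \<open>c\<close>, with all terms moved to
  the side where they are nonnegative, so that it can be integrated in \<open>[0, \<infinity>]\<close>.\<close>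

lemma powr_tangent:
  fixes c x r :: real
  assumes "1 \<le> r" "0 < c" "0 \<le> x"
  shows "r * c powr (r - 1) * x \<le> x powr r + (r - 1) * c powr r"
proof (cases "r = 1")
  case False
  then have r: "1 < r" using assms by simp
  have "x * c powr (r - 1) \<le> x powr r / r + (c powr (r - 1)) powr (r / (r - 1)) / (r / (r - 1))"
    using r assms by (intro Youngs_inequality) (auto simp: field_simps)
  also have "(c powr (r - 1)) powr (r / (r - 1)) = c powr r" using r by (simp add: powr_powr)
  finally have "r * (x * c powr (r - 1)) \<le> r * (x powr r / r + c powr r / (r / (r - 1)))"
    using r by (intro mult_left_mono) auto
  also have "\<dots> = x powr r + (r - 1) * c powr r" using r by (simp add: field_simps)
  finally show ?thesis by (simp add: mult_ac)
qed (use assms in auto)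

text \<open>Jensen's inequality for the measure \<open>w dM\<close> of total mass \<open>N\<close>, obtained by integrating the tangent
  inequality at the mean value \<open>c\<close>. Writing it with the factor \<open>N powr (r - 1)\<close> avoids normalizing.\<close>

lemma weighted_jensen_powr:
  fixes w \<phi> :: "'a \<Rightarrow> real"
  assumes [measurable]: "w \<in> borel_measurable M" "\<phi> \<in> borel_measurable M"
    and nn: "\<And>x. 0 \<le> w x" "\<And>x. 0 \<le> \<phi> x" and r: "1 \<le> r"
    and N: "(\<integral>\<^sup>+x. w x \<partial>M) = N" "N < \<infinity>"
  shows "ennpowr (\<integral>\<^sup>+x. ennreal (w x * \<phi> x) \<partial>M) r \<le> ennpowr N (r - 1) * (\<integral>\<^sup>+x. ennreal (w x * \<phi> x powr r) \<partial>M)"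
proof -
  define m where "m = (\<integral>\<^sup>+x. ennreal (w x * \<phi> x) \<partial>M)"
  define J where "J = (\<integral>\<^sup>+x. ennreal (w x * \<phi> x powr r) \<partial>M)"
  show ?thesis
  proof (cases "m = 0 \<or> J = \<infinity>")
    case True
    then show ?thesis
    proof
      assume "J = \<infinity>"
      show ?thesis
      proof (cases "N = 0")
        case True
        then have "AE x in M. w x = 0" using N(1) nn by (simp add: nn_integral_0_iff_AE)
        then have "m = 0" unfolding m_def by (intro nn_integral_0_iff_AE[THEN iffD2]) auto
        then show ?thesis by (simp add: m_def)
      next
        case False
        then have "ennpowr N (r - 1) * J = \<infinity>" using \<open>J = \<infinity>\<close> by (simp add: ennreal_mult_top ennpowr_eq_0)
        then show ?thesis by (simp add: J_def)
      qed
    qed (simp add: m_def)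
  next
    case False
    have key: "ennreal (r * c powr (r - 1)) * m \<le> J + ennreal ((r - 1) * c powr r) * N" if c: "0 < c" for c
    proof -
      have "ennreal (r * c powr (r - 1)) * m = (\<integral>\<^sup>+x. ennreal (r * c powr (r - 1)) * ennreal (w x * \<phi> x) \<partial>M)"
        unfolding m_def by (subst nn_integral_cmult) auto
      also have "\<dots> \<le> (\<integral>\<^sup>+x. ennreal (w x * \<phi> x powr r) + ennreal ((r - 1) * c powr r) * ennreal (w x) \<partial>M)"
      proof (rule nn_integral_mono)
        fix x
        have "w x * (r * c powr (r - 1) * \<phi> x) \<le> w x * (\<phi> x powr r + (r - 1) * c powr r)"
          by (intro mult_left_mono powr_tangent r c nn)
        then show "ennreal (r * c powr (r - 1)) * ennreal (w x * \<phi> x)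
            \<le> ennreal (w x * \<phi> x powr r) + ennreal ((r - 1) * c powr r) * ennreal (w x)"
        proof -
          have "ennreal (r * c powr (r - 1)) * ennreal (w x * \<phi> x) = ennreal (w x * (r * c powr (r - 1) * \<phi> x))"
            using nn r by (subst ennreal_mult[symmetric]) (auto simp: mult_ac)
          moreover have "ennreal (w x * \<phi> x powr r) + ennreal ((r - 1) * c powr r) * ennreal (w x)
              = ennreal (w x * (\<phi> x powr r + (r - 1) * c powr r))"
            using nn r by (subst ennreal_mult[symmetric], simp, simp, subst ennreal_plus[symmetric]) (auto simp: distrib_left mult_ac)
          ultimately show ?thesis using \<open>w x * _ \<le> _\<close> by (simp only: ennreal_leI)
        qed
      qed
      also have "\<dots> = J + ennreal ((r - 1) * c powr r) * N"
        unfolding J_def N(1)[symmetric] by (subst nn_integral_add; (subst nn_integral_cmult)?) auto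
      finally show ?thesis .
    qed
    obtain N' where N': "0 \<le> N'" "N = ennreal N'" using N(2) by (cases N) auto
    obtain J' where J': "0 \<le> J'" "J = ennreal J'" using False by (cases J) auto
    have "ennreal r * m \<le> J + ennreal (r - 1) * N" using key[of 1] by simp
    then have "ennreal r * m < \<infinity>"
      unfolding N' J' by (rule le_less_trans) (simp add: ennreal_mult_eq_top_iff less_top[symmetric])
    then have "m < \<infinity>" using r by (auto simp: ennreal_mult_less_top)
    then obtain m' where m': "0 \<le> m'" "m = ennreal m'" by (cases m) auto
    have m0: "0 < m'" using False m' by (auto simp: less_le)
    have N0: "0 < N'"
    proof (rule ccontr)
      assume "\<not> 0 < N'"
      then have "N = 0" using N' by simp
      then have "AE x in M. w x = 0" using N(1) nn by (simp add: nn_integral_0_iff_AE)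
      then have "m = 0" unfolding m_def by (intro nn_integral_0_iff_AE[THEN iffD2]) auto
      then show False using m0 m' by simp
    qed
    define c where "c = m' / N'"
    have c: "0 < c" using m0 N0 by (simp add: c_def)
    have "r * c powr (r - 1) * m' \<le> J' + (r - 1) * c powr r * N'"
      using key[OF c] r m' J' N' by (simp flip: ennreal_mult ennreal_plus)
    moreover have "c powr (r - 1) * m' = c powr r * N'"
    proof -
      have "c powr r = c powr (r - 1) * c" using c by (simp add: powr_diff)
      moreover have "c * N' = m'" using N0 by (simp add: c_def)
      ultimately show ?thesis by simp
    qed
    then have "r * c powr (r - 1) * m' = r * (c powr r * N')" by simp
    moreover have "(r - 1) * c powr r * N' = r * (c powr r * N') - c powr r * N'" by (simp add: algebra_simps)
    ultimately have "c powr r * N' \<le> J'" by linarith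
    then have "N' powr (r - 1) * (c powr r * N') \<le> N' powr (r - 1) * J'" by (intro mult_left_mono) auto
    moreover have "N' powr (r - 1) * (c powr r * N') = m' powr r"
    proof -
      have "m' powr r = c powr r * N' powr r" using c N0 by (simp add: c_def flip: powr_mult)
      moreover have "N' powr (r - 1) * N' = N' powr r" using N0 by (simp add: powr_diff)
      ultimately show ?thesis by (simp add: mult_ac)
    qed
    ultimately have "m' powr r \<le> N' powr (r - 1) * J'" by simp
    then show ?thesis
      unfolding m_def[symmetric] J_def[symmetric] N' m' J' using N'(1) m'(1) J'(1)
      by (simp add: ennpowr_ennreal flip: ennreal_mult)
  qed
qed

lemma average_mono:
  "(\<And>y. y \<in> Q \<Longrightarrow> f y \<le> g y) \<Longrightarrow> average Q f \<le> average Q g"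
  unfolding average_def by (intro mult_left_mono nn_integral_mono) (auto simp: indicator_def)

lemma average_const:
  assumes "Q \<in> cubes"
  shows "average Q (\<lambda>_. c) = c"
proof -
  have "average Q (\<lambda>_. c) = ennreal (1 / vol Q) * (c * ennreal (vol Q))"
    unfolding average_def using emeasure_cube[OF assms] cube_sets[OF assms]
    by (simp add: nn_integral_cmult_indicator)
  also have "\<dots> = c * (ennreal (1 / vol Q) * ennreal (vol Q))" by (simp add: mult_ac)
  also have "ennreal (1 / vol Q) * ennreal (vol Q) = 1"
    using vol_cube_pos[OF assms] by (simp flip: ennreal_mult)
  finally show ?thesis by simp
qed

lemma average_add:
  assumes [measurable]: "f \<in> borel_measurable lebesgue" "g \<in> borel_measurable lebesgue" and Q: "Q \<in> cubes"
  shows "average Q (\<lambda>y. f y + g y) = average Q f + average Q g"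
proof -
  note [measurable] = cube_sets[OF Q]
  show ?thesis unfolding average_def by (simp add: distrib_right distrib_left nn_integral_add)
qed

lemma average_cmult:
  assumes [measurable]: "f \<in> borel_measurable lebesgue" and Q: "Q \<in> cubes"
  shows "average Q (\<lambda>y. c * f y) = c * average Q f"
proof -
  note [measurable] = cube_sets[OF Q]
  show ?thesis unfolding average_def by (simp add: mult.assoc nn_integral_cmult) (simp add: mult_ac)
qed

text \<open>Superlinear growth of \<open>\<Phi>\<close> confines the relevant \<open>s\<close> to a bounded interval. Without it the supremum
  that defines the associate would be a junk value.\<close>

lemma young_associate_bdd:
  assumes "young_function \<Phi>"
  shows "bdd_above ((\<lambda>s. s * t - \<Phi> s) ` {0<..})"
proof -
  have nn: "0 \<le> \<Phi> s" if "0 \<le> s" for s using assms that by (simp add: young_function_def)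
  have "filterlim (\<lambda>t. \<Phi> t / t) at_top at_top" using assms by (simp add: young_function_def)
  then have "\<forall>\<^sub>F s in at_top. \<bar>t\<bar> \<le> \<Phi> s / s" by (simp add: filterlim_at_top)
  then obtain s1 where s1: "\<And>s. s1 \<le> s \<Longrightarrow> \<bar>t\<bar> \<le> \<Phi> s / s" by (auto simp: eventually_at_top_linorder)
  have "s * t - \<Phi> s \<le> \<bar>s1\<bar> * \<bar>t\<bar>" if s: "0 < s" for s
  proof (cases "s1 \<le> s")
    case True
    then have "s * \<bar>t\<bar> \<le> \<Phi> s" using s1[OF True] s by (simp add: field_simps)
    moreover have "s * t \<le> s * \<bar>t\<bar>" using s by (intro mult_left_mono) auto
    moreover have "0 \<le> \<bar>s1\<bar> * \<bar>t\<bar>" by simp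
    ultimately show ?thesis by linarith
  next
    case False
    have "s * t \<le> s * \<bar>t\<bar>" using s by (intro mult_left_mono) auto
    also have "\<dots> \<le> \<bar>s1\<bar> * \<bar>t\<bar>" using False s by (intro mult_right_mono) auto
    finally show ?thesis using nn[of s] s by simp
  qed
  then show ?thesis by (intro bdd_aboveI[of _ "\<bar>s1\<bar> * \<bar>t\<bar>"]) auto
qed

lemma young_function_scale:
  assumes "young_function \<Phi>" "0 \<le> c" "c \<le> 1" "0 \<le> s"
  shows "\<Phi> (c * s) \<le> c * \<Phi> s"
proof -
  have "convex_on {0..} \<Phi>" "\<Phi> 0 = 0" using assms(1) by (auto simp: young_function_def)
  then have "\<Phi> ((1 - c) *\<^sub>R 0 + c *\<^sub>R s) \<le> (1 - c) * \<Phi> 0 + c * \<Phi> s"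
    using assms(2-4) by (intro convex_onD) auto
  then show ?thesis using \<open>\<Phi> 0 = 0\<close> by simp
qed

lemma young_associate_upper:
  assumes "young_function \<Phi>" "0 < s"
  shows "s * t - \<Phi> s \<le> young_associate \<Phi> t"
  unfolding young_associate_def by (rule cSUP_upper[OF _ young_associate_bdd]) (use assms in auto)

lemma young_associate_least:
  assumes "\<And>s. 0 < s \<Longrightarrow> s * t - \<Phi> s \<le> b"
  shows "young_associate \<Phi> t \<le> b"
  unfolding young_associate_def by (rule cSUP_least) (use assms in auto)

lemma young_associate_mono: 
  assumes "young_function \<Phi>" shows "mono (young_associate \<Phi>)"
proof (rule monoI, rule young_associate_least)
  fix t u s :: real assume "t \<le> u" "0 < s"
  then have "s * t - \<Phi> s \<le> s * u - \<Phi> s" by simp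
  also have "\<dots> \<le> young_associate \<Phi> u" by (rule young_associate_upper[OF assms \<open>0 < s\<close>])
  finally show "s * t - \<Phi> s \<le> young_associate \<Phi> u" .
qed

lemma young_associate_0:
  assumes Y: "young_function \<Phi>" shows "young_associate \<Phi> 0 = 0"
proof (rule antisym)
  have nn: "0 \<le> \<Phi> s" if "0 \<le> s" for s using Y that by (simp add: young_function_def)
  then show "young_associate \<Phi> 0 \<le> 0" by (intro young_associate_least) auto
  show "0 \<le> young_associate \<Phi> 0"
  proof (rule field_le_epsilon)
    fix \<epsilon> :: real assume \<epsilon>: "0 < \<epsilon>"
    define s where "s = min 1 (\<epsilon> / (\<Phi> 1 + 1))"
    have s: "0 < s" "s \<le> 1" using \<epsilon> nn[of 1] by (auto simp: s_def)
    have "\<Phi> (s * 1) \<le> s * \<Phi> 1" using s by (intro young_function_scale[OF Y]) auto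
    also have "\<dots> \<le> \<epsilon> / (\<Phi> 1 + 1) * (\<Phi> 1 + 1)"
      using s nn[of 1] by (intro mult_mono) (auto simp: s_def)
    also have "\<dots> = \<epsilon>" using nn[of 1] by simp
    finally have "\<Phi> s \<le> \<epsilon>" by simp
    moreover have "s * 0 - \<Phi> s \<le> young_associate \<Phi> 0" by (rule young_associate_upper[OF Y s(1)])
    ultimately show "0 \<le> young_associate \<Phi> 0 + \<epsilon>" by simp
  qed
qed

lemma young_associate_nonneg: "young_function \<Phi> \<Longrightarrow> 0 \<le> t \<Longrightarrow> 0 \<le> young_associate \<Phi> t"
  using monoD[OF young_associate_mono, of \<Phi> 0 t] by (simp add: young_associate_0)

lemma young_associate_scale:
  assumes Y: "young_function \<Phi>" and c: "0 \<le> c" "c \<le> 1"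
  shows "young_associate \<Phi> (c * t) \<le> c * young_associate \<Phi> t"
proof (rule young_associate_least)
  fix s :: real assume s: "0 < s"
  have "0 \<le> \<Phi> s" using Y s by (simp add: young_function_def)
  then have "s * (c * t) - \<Phi> s \<le> s * (c * t) - c * \<Phi> s" using c by (simp add: mult_left_le_one_le)
  also have "\<dots> = c * (s * t - \<Phi> s)" by (simp add: algebra_simps)
  also have "\<dots> \<le> c * young_associate \<Phi> t" using c by (intro mult_left_mono young_associate_upper[OF Y s]) auto
  finally show "s * (c * t) - \<Phi> s \<le> c * young_associate \<Phi> t" .
qed

lemma young_inequality:
  assumes Y: "young_function \<Phi>" and "0 \<le> s" "0 \<le> t"
  shows "s * t \<le> \<Phi> s + young_associate \<Phi> t"
proof (cases "s = 0")
  case True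
  then show ?thesis using Y young_associate_nonneg[OF Y assms(3)] by (simp add: young_function_def)
next
  case False
  then show ?thesis using young_associate_upper[OF Y, of s t] assms by simp
qed

definition admissible :: "(real \<Rightarrow> real) \<Rightarrow> (real^'d) set \<Rightarrow> (real^'d \<Rightarrow> real) \<Rightarrow> real \<Rightarrow> bool" where
  "admissible \<Phi> Q f l \<longleftrightarrow> 0 < l \<and> average Q (\<lambda>x. ennreal (\<Phi> (\<bar>f x\<bar> / l))) \<le> 1"

lemma orlicz_norm_admissible: "orlicz_norm \<Phi> Q f = Inf {ennreal l | l. admissible \<Phi> Q f l}"
  by (simp add: orlicz_norm_def admissible_def)

lemma orlicz_norm_le: "admissible \<Phi> Q f l \<Longrightarrow> orlicz_norm \<Phi> Q f \<le> ennreal l"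
  unfolding orlicz_norm_admissible by (rule Inf_lower) auto

lemma admissible_near:
  assumes "orlicz_norm \<Phi> Q f < ennreal c"
  obtains l where "admissible \<Phi> Q f l" "l < c"
proof -
  from assms obtain l where "admissible \<Phi> Q f l" "ennreal l < ennreal c"
    unfolding orlicz_norm_admissible Inf_less_iff by auto
  then show ?thesis by (intro that) (auto simp: ennreal_less_iff admissible_def)
qed

text \<open>Young's inequality applied to \<open>X/l\<close> and \<open>Z/m\<close> bounds the average of \<open>X Z\<close> by \<open>2 l m\<close> for all admissible
  \<open>l\<close> and \<open>m\<close>. Both norms are taken finite because the product of \<open>0\<close> and \<open>\<infinity>\<close> is \<open>0\<close> in \<open>[0, \<infinity>]\<close>.\<close>

lemma orlicz_holder:
  assumes Y: "young_function \<Phi>" and Q: "Q \<in> cubes"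
    and [measurable]: "X \<in> borel_measurable lebesgue" "Z \<in> borel_measurable lebesgue"
    and nn: "\<And>y. 0 \<le> X y" "\<And>y. 0 \<le> Z y"
    and a: "orlicz_norm \<Phi> Q X = ennreal a" "0 \<le> a"
    and b: "orlicz_norm (young_associate \<Phi>) Q Z = ennreal b" "0 \<le> b"
  shows "average Q (\<lambda>y. ennreal (X y * Z y)) \<le> ennreal (2 * a * b)"
proof -
  note [measurable] = cube_sets[OF Q]
  let ?\<Psi> = "young_associate \<Phi>"
  have \<Psi>m: "?\<Psi> \<in> borel_measurable borel" by (rule borel_measurable_mono[OF young_associate_mono[OF Y]])
  have mo: "mono_on {0..} \<Phi>" and \<Phi>nn: "\<And>t. 0 \<le> t \<Longrightarrow> 0 \<le> \<Phi> t" using Y by (auto simp: young_function_def)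
  have "mono (\<lambda>t. \<Phi> (max 0 t))" using mo by (intro monoI) (auto simp: mono_on_def)
  then have \<Phi>m: "(\<lambda>t. \<Phi> (max 0 t)) \<in> borel_measurable borel" by (rule borel_measurable_mono)
  have adm: "average Q (\<lambda>y. ennreal (X y * Z y)) \<le> ennreal (2 * l * m)"
    if l: "admissible \<Phi> Q X l" and m: "admissible ?\<Psi> Q Z m" for l m
  proof -
    have lm: "0 < l" "0 < m" using l m by (auto simp: admissible_def)
    have M1: "(\<lambda>y. ennreal (\<Phi> (\<bar>X y\<bar> / l))) \<in> borel_measurable lebesgue"
    proof -
      have "(\<lambda>y. ennreal (\<Phi> (max 0 (\<bar>X y\<bar> / l)))) \<in> borel_measurable lebesgue"
        by (intro measurable_compose[OF _ measurable_ennreal] measurable_compose[OF _ \<Phi>m]) measurable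
      then show ?thesis using lm by (simp add: max_def)
    qed
    have M2: "(\<lambda>y. ennreal (?\<Psi> (\<bar>Z y\<bar> / m))) \<in> borel_measurable lebesgue"
      by (intro measurable_compose[OF _ measurable_ennreal] measurable_compose[OF _ \<Psi>m]) measurable
    have "average Q (\<lambda>y. ennreal (X y * Z y))
        \<le> average Q (\<lambda>y. ennreal (l * m) * (ennreal (\<Phi> (\<bar>X y\<bar> / l)) + ennreal (?\<Psi> (\<bar>Z y\<bar> / m))))"
    proof (rule average_mono)
      fix y
      have "X y / l * (Z y / m) \<le> \<Phi> (X y / l) + ?\<Psi> (Z y / m)"
        using nn lm by (intro young_inequality[OF Y]) auto
      then have "l * m * (X y / l * (Z y / m)) \<le> l * m * (\<Phi> (X y / l) + ?\<Psi> (Z y / m))"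
        using lm by (intro mult_left_mono) auto
      then have "X y * Z y \<le> l * m * (\<Phi> (X y / l) + ?\<Psi> (Z y / m))" using lm by simp
      then show "ennreal (X y * Z y) \<le> ennreal (l * m) * (ennreal (\<Phi> (\<bar>X y\<bar> / l)) + ennreal (?\<Psi> (\<bar>Z y\<bar> / m)))"
        using nn lm \<Phi>nn young_associate_nonneg[OF Y]
        by (simp add: ennreal_leI flip: ennreal_plus ennreal_mult)
    qed
    also have "\<dots> = ennreal (l * m) * (average Q (\<lambda>y. ennreal (\<Phi> (\<bar>X y\<bar> / l))) + average Q (\<lambda>y. ennreal (?\<Psi> (\<bar>Z y\<bar> / m))))"
      using M1 M2 Q by (subst average_cmult) (auto simp: average_add)
    also have "\<dots> \<le> ennreal (l * m) * (1 + 1)"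
      using l m by (intro mult_left_mono add_mono) (auto simp: admissible_def)
    also have "\<dots> = ennreal (2 * l * m)"
      using lm by (simp add: mult.commute mult.left_commute flip: ennreal_mult ennreal_numeral)
    finally show ?thesis .
  qed
  have eps: "average Q (\<lambda>y. ennreal (X y * Z y)) \<le> ennreal (2 * (a + \<epsilon>) * (b + \<epsilon>))" if \<epsilon>: "0 < \<epsilon>" for \<epsilon>
  proof -
    obtain l where l: "admissible \<Phi> Q X l" "l < a + \<epsilon>"
      using admissible_near[of \<Phi> Q X "a + \<epsilon>"] a \<epsilon> by (auto simp: ennreal_less_iff)
    obtain m where m: "admissible ?\<Psi> Q Z m" "m < b + \<epsilon>"
      using admissible_near[of ?\<Psi> Q Z "b + \<epsilon>"] b \<epsilon> by (auto simp: ennreal_less_iff)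
    have "0 < l" "0 < m" using l m by (auto simp: admissible_def)
    then have "2 * l * m \<le> 2 * (a + \<epsilon>) * (b + \<epsilon>)" using l m a b \<epsilon> by (intro mult_mono) auto
    then show ?thesis using adm[OF l(1) m(1)] by (meson ennreal_leI order_trans)
  qed
  have "(\<lambda>n. ennreal (2 * (a + inverse (real (Suc n))) * (b + inverse (real (Suc n))))) \<longlonglongrightarrow> ennreal (2 * (a + 0) * (b + 0))"
    by (intro tendsto_ennrealI tendsto_intros LIMSEQ_inverse_real_of_nat)
  then show ?thesis
    using eps by (intro LIMSEQ_le_const[of _ "ennreal (2 * a * b)"]) (auto intro!: exI[of _ 0])
qed

lemma orlicz_norm_bounded:
  assumes Y: "young_function \<Phi>" and Q: "Q \<in> cubes" and f: "\<And>y. \<bar>f y\<bar> \<le> k"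
  shows "orlicz_norm (young_associate \<Phi>) Q f < \<infinity>"
proof -
  let ?\<Psi> = "young_associate \<Phi>"
  have p1: "0 \<le> ?\<Psi> 1" by (rule young_associate_nonneg[OF Y]) simp
  have k: "0 \<le> k" using f[of undefined] by (meson abs_ge_zero order_trans)
  \<comment> \<open>With this \<open>l\<close> both \<open>k / l \<le> 1\<close> and \<open>(k / l) \<Psi> 1 \<le> 1\<close>.\<close>
  define l where "l = k + k * ?\<Psi> 1 + 1"
  have l: "0 < l" "k \<le> l" "k * ?\<Psi> 1 \<le> l" using k p1 by (auto simp: l_def intro!: add_nonneg_pos)
  have "?\<Psi> (\<bar>f y\<bar> / l) \<le> 1" for y
  proof -
    have "?\<Psi> (\<bar>f y\<bar> / l) \<le> ?\<Psi> (k / l * 1)"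
      using f[of y] l by (intro monoD[OF young_associate_mono[OF Y]]) (simp add: divide_right_mono)
    also have "\<dots> \<le> k / l * ?\<Psi> 1" using k l by (intro young_associate_scale[OF Y]) auto
    also have "\<dots> \<le> 1" using l by simp
    finally show ?thesis .
  qed
  then have "average Q (\<lambda>y. ennreal (?\<Psi> (\<bar>f y\<bar> / l))) \<le> average Q (\<lambda>_. 1)"
    by (intro average_mono) (simp add: ennreal_le_1)
  then have "admissible ?\<Psi> Q f l" using l by (simp add: admissible_def average_const[OF Q])
  from orlicz_norm_le[OF this] show ?thesis by (rule le_less_trans) simp
qed

section \<open>Sparse domination for vector-valued averages\<close>

lemma almost_laminar_subset: "almost_laminar F \<Longrightarrow> G \<subseteq> F \<Longrightarrow> almost_laminar G"
  unfolding almost_laminar_def by blast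

definition maximal_members :: "'a set set \<Rightarrow> 'a set set" where
  "maximal_members F = {Q\<in>F. \<not> (\<exists>R\<in>F. Q \<subset> R)}"

lemma maximal_members_cover:
  assumes "finite F"
  shows "\<Union>(maximal_members F) = \<Union>F"
proof
  show "\<Union>F \<subseteq> \<Union>(maximal_members F)"
  proof clarify
    fix x Q assume "x \<in> Q" "Q \<in> F"
    from finite_has_maximal2[OF assms this(2)] obtain M where "M \<in> F" "Q \<subseteq> M" "\<forall>b\<in>F. M \<subseteq> b \<longrightarrow> M = b" by auto
    with \<open>x \<in> Q\<close> show "x \<in> \<Union>(maximal_members F)" unfolding maximal_members_def by blast
  qed
qed (auto simp: maximal_members_def)

lemma maximal_members_overlap:
  assumes "almost_laminar F"
  shows "pairwise (\<lambda>P Q. negligible (P \<inter> Q)) (maximal_members F)"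
  unfolding pairwise_def
proof (intro ballI impI)
  fix P Q assume PQ: "P \<in> maximal_members F" "Q \<in> maximal_members F" "P \<noteq> Q"
  then have "\<not> P \<subset> Q" "\<not> Q \<subset> P" "P \<in> F" "Q \<in> F" by (auto simp: maximal_members_def)
  with PQ(3) assms show "negligible (P \<inter> Q)" unfolding almost_laminar_def by blast
qed

text \<open>Off the null set of pairwise overlaps the indicators of the members add up to at most the indicator of
  the union.\<close>

lemma sum_nn_integral_le_Union:
  assumes fin: "finite M" and ov: "pairwise (\<lambda>P Q. negligible (P \<inter> Q)) M"
    and M: "M \<subseteq> sets lebesgue" and h: "h \<in> borel_measurable lebesgue"
    and W: "\<Union>M \<subseteq> W"
  shows "(\<Sum>Q\<in>M. \<integral>\<^sup>+y\<in>Q. h y \<partial>lebesgue) \<le> (\<integral>\<^sup>+y\<in>W. h y \<partial>lebesgue)"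
proof -
  define N where "N = \<Union>((\<lambda>(P, Q). P \<inter> Q) ` {(P, Q). P \<in> M \<and> Q \<in> M \<and> P \<noteq> Q})"
  have "finite {(P, Q). P \<in> M \<and> Q \<in> M \<and> P \<noteq> Q}"
    by (rule finite_subset[of _ "M \<times> M"]) (use fin in auto)
  then have "negligible N"
    unfolding N_def using ov by (intro negligible_Union finite_imageI) (auto simp: pairwise_def)
  then have "AE y in lebesgue. y \<notin> N" by (simp add: AE_not_in negligible_iff_null_sets)
  then have *: "AE y in lebesgue. (\<Sum>Q\<in>M. h y * indicator Q y) \<le> h y * indicator W y"
  proof eventually_elim
    case (elim y)
    show ?case
    proof (cases "\<exists>Q\<in>M. y \<in> Q")
      case True
      then obtain Q where Q: "Q \<in> M" "y \<in> Q" by blast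
      have "y \<notin> R" if "R \<in> M - {Q}" for R using elim that Q unfolding N_def by blast
      then have "(\<Sum>R\<in>M - {Q}. h y * indicator R y) = 0" by (intro sum.neutral) auto
      then have "(\<Sum>R\<in>M. h y * indicator R y) = h y * indicator Q y"
        by (simp add: sum.remove[OF fin Q(1)])
      then show ?thesis using Q W by (auto simp: indicator_def)
    next
      case False
      then have "(\<Sum>R\<in>M. h y * indicator R y) = 0" by (intro sum.neutral) auto
      then show ?thesis by simp
    qed
  qed
  have "(\<Sum>Q\<in>M. \<integral>\<^sup>+y\<in>Q. h y \<partial>lebesgue) = (\<integral>\<^sup>+y. (\<Sum>Q\<in>M. h y * indicator Q y) \<partial>lebesgue)"
    using M h by (subst nn_integral_sum) auto
  also have "\<dots> \<le> (\<integral>\<^sup>+y\<in>W. h y \<partial>lebesgue)" by (rule nn_integral_mono_AE[OF *])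
  finally show ?thesis .
qed

lemma nn_integral_eq_vol_average:
  assumes "Q \<in> cubes"
  shows "(\<integral>\<^sup>+y\<in>Q. h y \<partial>lebesgue) = ennreal (vol Q) * average Q h"
  using vol_cube_pos[OF assms]
  by (simp add: average_def mult.assoc[symmetric] ennreal_mult[symmetric])

text \<open>Bilinear, not Hermitian: pairing with a row of a matrix gives an entry of the matrix-vector product
  (\<open>dotp_row\<close>).\<close>

definition dotp :: "complex^'n \<Rightarrow> complex^'n \<Rightarrow> complex" where
  "dotp e w = (\<Sum>i\<in>UNIV. e $ i * w $ i)"

lemma dotp_add: "dotp (v + w) z = dotp v z + dotp w z"
  by (simp add: dotp_def distrib_right sum.distrib)

lemma dotp_scale: "dotp (c *s v) z = c * dotp v z"
  by (simp add: dotp_def sum_distrib_left mult_ac)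

lemma dotp_row: "dotp (A $ i) z = (A *v z) $ i"
  by (simp add: dotp_def matrix_vector_mult_def)

lemma vec_nth_measurable [measurable]:
  fixes g :: "'a \<Rightarrow> complex^'n"
  assumes "g \<in> borel_measurable M"
  shows "(\<lambda>y. g y $ i) \<in> borel_measurable M"
  by (rule measurable_compose[OF assms borel_measurable_continuous_onI]) (intro continuous_intros)

lemma dotp_measurable [measurable]:
  assumes [measurable]: "g \<in> borel_measurable M"
  shows "(\<lambda>y. dotp e (g y)) \<in> borel_measurable M"
  unfolding dotp_def by measurable

definition mean_dot :: "(real^'d \<Rightarrow> complex^'n) \<Rightarrow> (real^'d) set \<Rightarrow> complex^'n \<Rightarrow> ennreal" where
  "mean_dot g Q e = average Q (\<lambda>y. ennreal (norm (dotp e (g y))))"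

lemma mean_dot_add:
  assumes [measurable]: "g \<in> borel_measurable lebesgue" and Q: "Q \<in> cubes"
  shows "mean_dot g Q (v + w) \<le> mean_dot g Q v + mean_dot g Q w"
proof -
  note [measurable] = cube_sets[OF Q]
  have "(\<integral>\<^sup>+y\<in>Q. ennreal (norm (dotp (v + w) (g y))) \<partial>lebesgue)
      \<le> (\<integral>\<^sup>+y. ennreal (norm (dotp v (g y))) * indicator Q y + ennreal (norm (dotp w (g y))) * indicator Q y \<partial>lebesgue)"
    by (intro nn_integral_mono)
       (auto simp: dotp_add indicator_def norm_triangle_ineq simp flip: ennreal_plus intro!: ennreal_leI)
  also have "\<dots> = (\<integral>\<^sup>+y\<in>Q. ennreal (norm (dotp v (g y))) \<partial>lebesgue) + (\<integral>\<^sup>+y\<in>Q. ennreal (norm (dotp w (g y))) \<partial>lebesgue)"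
    by (intro nn_integral_add) measurable
  finally show ?thesis unfolding mean_dot_def average_def
    by (simp add: distrib_left[symmetric] mult_left_mono)
qed

lemma mean_dot_scale:
  assumes [measurable]: "g \<in> borel_measurable lebesgue" and Q: "Q \<in> cubes"
  shows "mean_dot g Q (c *s v) = ennreal (norm c) * mean_dot g Q v"
proof -
  note [measurable] = cube_sets[OF Q]
  have "(\<integral>\<^sup>+y\<in>Q. ennreal (norm (dotp (c *s v) (g y))) \<partial>lebesgue)
      = (\<integral>\<^sup>+y. ennreal (norm c) * (ennreal (norm (dotp v (g y))) * indicator Q y) \<partial>lebesgue)"
    by (intro nn_integral_cong) (simp add: dotp_scale norm_mult ennreal_mult mult.assoc)
  also have "\<dots> = ennreal (norm c) * (\<integral>\<^sup>+y\<in>Q. ennreal (norm (dotp v (g y))) \<partial>lebesgue)"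
    by (intro nn_integral_cmult) measurable
  finally show ?thesis unfolding mean_dot_def average_def by (simp add: mult_ac)
qed

lemma mean_dot_sum:
  assumes g: "g \<in> borel_measurable lebesgue" and Q: "Q \<in> cubes" and "finite I"
  shows "mean_dot g Q (\<Sum>i\<in>I. c i *s b i) \<le> (\<Sum>i\<in>I. ennreal (norm (c i)) * mean_dot g Q (b i))"
  using assms(3)
proof induction
  case empty
  then show ?case using mean_dot_scale[OF g Q, of 0 0] by simp
next
  case (insert i I)
  then show ?case using mean_dot_add[OF g Q, of "c i *s b i" "\<Sum>i\<in>I. c i *s b i"]
    unfolding sum.insert[OF insert.hyps] mean_dot_scale[OF g Q]
    using insert.IH by (blast intro: order_trans add_left_mono)
qed

lemma mean_dot_zero_subset:
  assumes g: "g \<in> borel_measurable lebesgue" and PQ: "P \<in> cubes" "Q \<in> cubes" "Q \<subseteq> P"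
    and 0: "mean_dot g P e = 0"
  shows "mean_dot g Q e = 0"
proof -
  have "(\<integral>\<^sup>+y\<in>Q. ennreal (norm (dotp e (g y))) \<partial>lebesgue) \<le> (\<integral>\<^sup>+y\<in>P. ennreal (norm (dotp e (g y))) \<partial>lebesgue)"
    using PQ(3) by (intro nn_integral_mono) (auto simp: indicator_def)
  also have "\<dots> = 0" using 0 by (simp add: nn_integral_eq_vol_average[OF PQ(1)] mean_dot_def)
  finally show ?thesis by (simp add: mean_dot_def average_def)
qed

text \<open>The constant is \<open>n\<close> test vectors times the threshold \<open>2n\<close> used in \<open>nondominated_escape\<close>.\<close>

definition dominates :: "(real^'d \<Rightarrow> complex^'n) \<Rightarrow> (real^'d) set \<Rightarrow> (real^'d) set \<Rightarrow> bool" where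
  "dominates g P Q \<longleftrightarrow> (\<forall>e. mean_dot g Q e \<le> of_nat (2 * CARD('n)^2) * mean_dot g P e)"

text \<open>If all test vectors had averages at most \<open>2n\<close> over \<open>Q\<close>, then expanding an arbitrary \<open>v\<close> in them would
  bound its average over \<open>Q\<close> by \<open>2n\<^sup>2\<close> times its average over \<open>P\<close>. The error of the expansion has average zero
  over \<open>P\<close> and hence over \<open>Q\<close>.\<close>

lemma nondominated_escape:
  fixes g :: "real^'d \<Rightarrow> complex^'n" and b :: "'n \<Rightarrow> complex^'n"
  assumes g: "g \<in> borel_measurable lebesgue"
    and PQ: "P \<in> cubes" "Q \<in> cubes" "Q \<subseteq> P" and nd: "\<not> dominates g P Q"
    and fin: "\<And>e. mean_dot g P e < \<infinity>"
    and rep: "\<And>v. \<exists>c. (\<forall>i. ennreal (norm (c i)) \<le> mean_dot g P v) \<and> mean_dot g P (v - (\<Sum>i\<in>UNIV. c i *s b i)) = 0"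
  shows "\<exists>i. of_nat (2 * CARD('n)) < mean_dot g Q (b i)"
proof (rule ccontr)
  assume "\<not> ?thesis"
  then have le: "mean_dot g Q (b i) \<le> of_nat (2 * CARD('n))" for i by (simp add: not_less)
  have "mean_dot g Q v \<le> of_nat (2 * CARD('n)^2) * mean_dot g P v" for v
  proof -
    obtain c where c: "\<And>i. ennreal (norm (c i)) \<le> mean_dot g P v"
      "mean_dot g P (v - (\<Sum>i\<in>UNIV. c i *s b i)) = 0" using rep by blast
    have "mean_dot g Q v \<le> mean_dot g Q (v - (\<Sum>i\<in>UNIV. c i *s b i)) + mean_dot g Q (\<Sum>i\<in>UNIV. c i *s b i)"
      using mean_dot_add[OF g PQ(2), of "v - (\<Sum>i\<in>UNIV. c i *s b i)" "\<Sum>i\<in>UNIV. c i *s b i"] by simp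
    also have "mean_dot g Q (v - (\<Sum>i\<in>UNIV. c i *s b i)) = 0"
      by (rule mean_dot_zero_subset[OF g PQ c(2)])
    also have "0 + mean_dot g Q (\<Sum>i\<in>UNIV. c i *s b i) \<le> (\<Sum>i\<in>UNIV. ennreal (norm (c i)) * mean_dot g Q (b i))"
      using mean_dot_sum[OF g PQ(2) finite, of c b UNIV] by simp
    also have "\<dots> \<le> (\<Sum>i\<in>(UNIV::'n set). mean_dot g P v * of_nat (2 * CARD('n)))"
      by (intro sum_mono mult_mono c le) auto
    also have "\<dots> = of_nat (2 * CARD('n)^2) * mean_dot g P v" by (simp add: power2_eq_square mult_ac)
    finally show ?thesis .
  qed
  then show False using nd by (simp add: dominates_def)
qed

text \<open>This is the weak type \<open>(1,1)\<close> bound for the dyadic maximal function, applied to the \<open>n\<close> functions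
  \<open>|b i \<cdot> g|\<close>. Each has average at most \<open>1\<close> over \<open>P\<close>, so the disjoint cubes on which its average exceeds
  \<open>2n\<close> have total volume at most \<open>vol P / 2n\<close>.\<close>

lemma nondominated_small_union:
  fixes g :: "real^'d \<Rightarrow> complex^'n"
  assumes g[measurable]: "g \<in> borel_measurable lebesgue" and P: "P \<in> cubes"
    and fin: "\<And>e. mean_dot g P e < \<infinity>"
    and \<B>: "finite \<B>" "\<B> \<subseteq> cubes" "almost_laminar \<B>"
    and sub: "\<And>Q. Q \<in> \<B> \<Longrightarrow> Q \<subseteq> P" and nd: "\<And>Q. Q \<in> \<B> \<Longrightarrow> \<not> dominates g P Q"
  shows "measure lebesgue (\<Union>\<B>) \<le> vol P / 2"
proof -
  define \<rho> where "\<rho> e = enn2real (mean_dot g P e)" for e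
  have \<rho>: "ennreal (\<rho> e) = mean_dot g P e" for e using fin[of e] by (simp add: \<rho>_def less_top)
  have nn: "0 \<le> \<rho> e" for e by (simp add: \<rho>_def)
  have tri: "\<rho> (v + w) \<le> \<rho> v + \<rho> w" for v w
    using mean_dot_add[OF g P, of v w] by (simp add: \<rho>[symmetric] nn flip: ennreal_plus)
  have hom: "\<rho> (c *s v) = norm c * \<rho> v" for c v
    using mean_dot_scale[OF g P, of c v] by (simp add: \<rho>[symmetric] nn flip: ennreal_mult)
  obtain b :: "'n \<Rightarrow> complex^'n" where b: "\<And>i. \<rho> (b i) \<le> 1"
    and rep: "\<And>v. \<exists>c. (\<forall>i. norm (c i) \<le> \<rho> v) \<and> \<rho> (v - (\<Sum>i\<in>UNIV. c i *s b i)) = 0"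
    using auerbach_family_seminorm[of \<rho>, OF tri hom nn] by auto
  have rep': "\<exists>c. (\<forall>i. ennreal (norm (c i)) \<le> mean_dot g P v) \<and> mean_dot g P (v - (\<Sum>i\<in>UNIV. c i *s b i)) = 0" for v
    using rep[of v] by (simp add: \<rho>[symmetric] nn)
  define M where "M = maximal_members \<B>"
  have M: "finite M" "M \<subseteq> \<B>" using \<B>(1) by (auto simp: M_def maximal_members_def)
  have ov: "pairwise (\<lambda>P Q. negligible (P \<inter> Q)) M" unfolding M_def by (rule maximal_members_overlap[OF \<B>(3)])
  define n where "n = CARD('n)"
  have n: "0 < n" by (simp add: n_def)
  define Mi where "Mi i = {Q\<in>M. of_nat (2 * n) < mean_dot g Q (b i)}" for i
  have each: "real (2 * n) * (\<Sum>Q\<in>Mi i. vol Q) \<le> vol P" for i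
  proof -
    have Mi: "finite (Mi i)" "Mi i \<subseteq> M" using M by (auto simp: Mi_def)
    have Mic: "Mi i \<subseteq> cubes" using Mi M \<B>(2) by blast
    have "ennreal (real (2 * n) * (\<Sum>Q\<in>Mi i. vol Q)) = (\<Sum>Q\<in>Mi i. ennreal (vol Q) * of_nat (2 * n))"
    proof -
      have "ennreal (vol Q) * of_nat (2 * n) = ennreal (real (2 * n) * vol Q)" for Q :: "(real^'d) set"
        unfolding ennreal_of_nat_eq_real_of_nat
        by (subst ennreal_mult[symmetric]) (simp_all add: vol_def mult.commute)
      then show ?thesis by (simp add: sum_distrib_left sum_ennreal vol_def)
    qed
    also have "\<dots> \<le> (\<Sum>Q\<in>Mi i. ennreal (vol Q) * mean_dot g Q (b i))"
      by (intro sum_mono mult_left_mono) (auto simp: Mi_def)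
    also have "\<dots> = (\<Sum>Q\<in>Mi i. \<integral>\<^sup>+y\<in>Q. ennreal (norm (dotp (b i) (g y))) \<partial>lebesgue)"
      using Mic by (intro sum.cong) (auto simp: nn_integral_eq_vol_average mean_dot_def)
    also have "\<dots> \<le> (\<integral>\<^sup>+y\<in>P. ennreal (norm (dotp (b i) (g y))) \<partial>lebesgue)"
    proof (rule sum_nn_integral_le_Union[OF Mi(1) pairwise_subset[OF ov Mi(2)]])
      show "Mi i \<subseteq> sets lebesgue" using Mic cube_sets by auto
      show "\<Union>(Mi i) \<subseteq> P" using Mi(2) M(2) sub by auto
    qed measurable
    also have "\<dots> = ennreal (vol P) * ennreal (\<rho> (b i))"
      by (simp add: nn_integral_eq_vol_average[OF P] \<rho> mean_dot_def)
    also have "\<dots> \<le> ennreal (vol P) * ennreal 1" by (intro mult_left_mono ennreal_leI b) auto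
    finally show ?thesis using vol_cube_pos[OF P] by simp
  qed
  have cov: "M = (\<Union>i. Mi i)"
  proof (intro equalityI subsetI)
    fix Q assume Q: "Q \<in> M"
    then have "Q \<in> \<B>" using M(2) by blast
    then have "\<exists>i. of_nat (2 * n) < mean_dot g Q (b i)"
      unfolding n_def using \<B>(2) by (intro nondominated_escape[OF g P _ sub nd fin rep']) auto
    then show "Q \<in> (\<Union>i. Mi i)" using Q by (auto simp: Mi_def)
  qed (auto simp: Mi_def)
  have volnn: "0 \<le> vol Q" for Q :: "(real^'d) set" by (simp add: vol_def)
  have "measure lebesgue (\<Union>\<B>) = measure lebesgue (\<Union>M)"
    unfolding M_def by (simp add: maximal_members_cover[OF \<B>(1)])
  also have "\<dots> \<le> (\<Sum>Q\<in>M. vol Q)"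
    unfolding vol_def using M \<B>(2) cube_lmeasurable by (intro measure_Union_le) (auto simp: M(1))
  also have "\<dots> \<le> (\<Sum>i\<in>UNIV. \<Sum>Q\<in>Mi i. vol Q)"
  proof -
    have "(\<Sum>Q\<in>M. vol Q) \<le> (\<Sum>Q\<in>M. \<Sum>i\<in>UNIV. if Q \<in> Mi i then vol Q else 0)"
    proof (rule sum_mono)
      fix Q assume "Q \<in> M"
      then obtain i where "Q \<in> Mi i" using cov by blast
      then have "vol Q = (if Q \<in> Mi i then vol Q else 0)" by simp
      also have "\<dots> \<le> (\<Sum>i\<in>UNIV. if Q \<in> Mi i then vol Q else 0)"
        by (rule member_le_sum) (auto simp: volnn)
      finally show "vol Q \<le> (\<Sum>i\<in>UNIV. if Q \<in> Mi i then vol Q else 0)" .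
    qed
    also have "\<dots> = (\<Sum>i\<in>UNIV. \<Sum>Q\<in>M. if Q \<in> Mi i then vol Q else 0)" by (rule sum.swap)
    also have "\<dots> = (\<Sum>i\<in>UNIV. \<Sum>Q\<in>Mi i. vol Q)"
      by (rule sum.cong[OF refl], subst sum.inter_filter[OF M(1), symmetric], rule sum.cong) (auto simp: Mi_def)
    finally show ?thesis .
  qed
  also have "\<dots> \<le> (\<Sum>i\<in>(UNIV::'n set). vol P / real (2 * n))"
    using each n by (intro sum_mono) (simp add: field_simps)
  also have "\<dots> = vol P / 2" using n by (simp add: n_def)
  finally show ?thesis .
qed

text \<open>A member is selected unless it is covered by a selected strictly larger member. This is well defined
  from the large sets down; the induction removes a minimal set and decides about it last.\<close>

lemma greedy_kernel:
  assumes "finite F"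
  shows "\<exists>S\<subseteq>F. \<forall>Q\<in>F. Q \<in> S \<longleftrightarrow> \<not> (\<exists>P\<in>S. Q \<subset> P \<and> covers P Q)"
  using assms
proof (induction "card F" arbitrary: F)
  case (Suc k)
  then have "F \<noteq> {}" by auto
  with finite_has_minimal[OF Suc.prems] obtain Q where Q: "Q \<in> F" "\<And>R. R \<in> F \<Longrightarrow> R \<subseteq> Q \<Longrightarrow> R = Q" by metis
  have "k = card (F - {Q})" using Suc.hyps(2) Suc.prems Q(1) by simp
  from Suc.hyps(1)[OF this] Suc.prems
  have "\<exists>S\<subseteq>F - {Q}. \<forall>R\<in>F - {Q}. R \<in> S \<longleftrightarrow> \<not> (\<exists>P\<in>S. R \<subset> P \<and> covers P R)" by simp
  then obtain S where S1: "S \<subseteq> F - {Q}"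
    and S2: "\<forall>R\<in>F - {Q}. R \<in> S \<longleftrightarrow> \<not> (\<exists>P\<in>S. R \<subset> P \<and> covers P R)" by (elim exE conjE) (rule that)
  note S = S1 S2[rule_format]
  have nQ: "\<not> R \<subset> Q" if "R \<in> F" for R using Q(2)[OF that] by blast
  show ?case
  proof (cases "\<exists>P\<in>S. Q \<subset> P \<and> covers P Q")
    case True
    show ?thesis
    proof (intro exI[of _ S] conjI ballI)
      show "S \<subseteq> F" using S(1) by blast
      fix R assume R: "R \<in> F"
      have "Q \<notin> S" using S(1) by blast
      then show "R \<in> S \<longleftrightarrow> \<not> (\<exists>P\<in>S. R \<subset> P \<and> covers P R)"
        using True S(2)[of R] R by (cases "R = Q") simp_all
    qed
  next
    case False
    have ins: "(\<exists>P\<in>insert Q S. R \<subset> P \<and> covers P R) \<longleftrightarrow> (\<exists>P\<in>S. R \<subset> P \<and> covers P R)" if "R \<in> F" for R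
      by (simp add: nQ[OF that])
    show ?thesis
    proof (intro exI[of _ "insert Q S"] conjI ballI)
      show "insert Q S \<subseteq> F" using S(1) Q(1) by blast
      fix R assume R: "R \<in> F"
      show "R \<in> insert Q S \<longleftrightarrow> \<not> (\<exists>P\<in>insert Q S. R \<subset> P \<and> covers P R)"
        unfolding ins[OF R] using False S(2)[of R] R by (cases "R = Q") simp_all
    qed
  qed
qed auto

definition sparse :: "(real^'d) set set \<Rightarrow> bool" where
  "sparse S \<longleftrightarrow> (\<forall>P\<in>S. measure lebesgue (\<Union>{Q\<in>S. Q \<subset> P}) \<le> vol P / 2)"

text \<open>The parts \<open>E P\<close> of the cubes outside their selected proper subcubes overlap in null sets only, and each has
  at least half of the volume of its cube.\<close>

lemma sparse_packing:
  assumes S: "finite S" "S \<subseteq> cubes" "almost_laminar S" "sparse S" and S': "S' \<subseteq> S"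
  shows "(\<Sum>P\<in>S'. vol P) \<le> 2 * measure lebesgue (\<Union>S')"
proof -
  define E where "E P = P - \<Union>{Q\<in>S. Q \<subset> P}" for P
  have lm: "P \<in> lmeasurable" if "P \<in> S" for P using that S cube_lmeasurable by blast
  have U: "\<Union>{Q\<in>S. Q \<subset> P} \<in> lmeasurable" for P
    using S(1) lm by (intro fmeasurable.finite_Union) auto
  have fin': "finite S'" using S' S(1) finite_subset by blast
  have "vol P \<le> 2 * measure lebesgue (E P)" if "P \<in> S'" for P
  proof -
    have P: "P \<in> S" using that S' by blast
    have "measure lebesgue (E P) = vol P - measure lebesgue (\<Union>{Q\<in>S. Q \<subset> P})"
      unfolding E_def vol_def using lm[OF P] U by (intro measurable_measure_Diff) auto
    then show ?thesis using S(4) P unfolding sparse_def by fastforce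
  qed
  then have "(\<Sum>P\<in>S'. vol P) \<le> 2 * (\<Sum>P\<in>S'. measure lebesgue (E P))"
    unfolding sum_distrib_left by (rule sum_mono)
  also have "(\<Sum>P\<in>S'. measure lebesgue (E P)) = measure lebesgue (\<Union>(E ` S'))"
  proof (rule measure_negligible_finite_Union_image[symmetric])
    show "E P \<in> lmeasurable" if "P \<in> S'" for P
      unfolding E_def using that S' lm U by (intro fmeasurable.Diff) auto
    show "pairwise (\<lambda>P Q. negligible (E P \<inter> E Q)) S'"
      unfolding pairwise_def
    proof (intro ballI impI)
      fix P Q assume PQ: "P \<in> S'" "Q \<in> S'" "P \<noteq> Q"
      then have "P \<in> S" "Q \<in> S" using S' by auto
      with S(3) PQ(3) consider "P \<subset> Q" | "Q \<subset> P" | "negligible (P \<inter> Q)"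
        unfolding almost_laminar_def by blast
      then show "negligible (E P \<inter> E Q)"
      proof cases
        case 1 then have "E P \<inter> E Q = {}" using \<open>P \<in> S\<close> by (auto simp: E_def)
        then show ?thesis by simp
      next
        case 2 then have "E P \<inter> E Q = {}" using \<open>Q \<in> S\<close> by (auto simp: E_def)
        then show ?thesis by simp
      next
        case 3 then show ?thesis by (rule negligible_subset) (auto simp: E_def)
      qed
    qed
  qed (rule fin')
  also have "\<dots> \<le> measure lebesgue (\<Union>S')"
  proof (rule measure_mono_fmeasurable)
    show "\<Union>S' \<in> lmeasurable" using fin' S' lm by (intro fmeasurable.finite_Union) auto
    show "\<Union>(E ` S') \<in> sets lebesgue"
      unfolding E_def using fin' S' lm U by (intro sets.finite_UN) (auto intro!: sets.Diff fmeasurableD)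
  qed (auto simp: E_def)
  finally show ?thesis by simp
qed

text \<open>One sparse family serves all matrices \<open>A\<close>: rows of \<open>A\<close> are vectors \<open>e\<close> in the definition of
  domination, and the norm of \<open>A g\<close> lies between each of its entries and their sum. This uniformity is what
  allows \<open>A\<close> to depend on the point \<open>x\<close> at which the maximal function is evaluated.\<close>

lemma sparse_domination:
  fixes g :: "real^'d \<Rightarrow> complex^'n"
  assumes g[measurable]: "g \<in> borel_measurable lebesgue"
    and fin: "\<And>P e. P \<in> F \<Longrightarrow> mean_dot g P e < \<infinity>"
    and F: "finite F" "F \<subseteq> cubes" "almost_laminar F"
  obtains S where "S \<subseteq> F" "sparse S"
    "\<And>Q A. Q \<in> F \<Longrightarrow> \<exists>P\<in>S. Q \<subseteq> P \<and> (\<forall>A :: complex^'n^'n. average Q (\<lambda>y. ennreal (norm (A *v g y)))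
        \<le> of_nat (2 * CARD('n)^3) * average P (\<lambda>y. ennreal (norm (A *v g y))))"
proof -
  obtain S where S1: "S \<subseteq> F"
    and S2: "\<forall>Q\<in>F. Q \<in> S \<longleftrightarrow> \<not> (\<exists>P\<in>S. Q \<subset> P \<and> dominates g P Q)"
    using greedy_kernel[OF F(1), of "dominates g"] by (elim exE conjE) (rule that)
  note S = S1 S2[rule_format]
  have "sparse S"
    unfolding sparse_def
  proof
    fix P assume P: "P \<in> S"
    show "measure lebesgue (\<Union>{Q\<in>S. Q \<subset> P}) \<le> vol P / 2"
    proof (rule nondominated_small_union[OF g])
      show "P \<in> cubes" "mean_dot g P e < \<infinity>" for e using P S(1) F(2) fin by auto
      show "finite {Q\<in>S. Q \<subset> P}" "{Q\<in>S. Q \<subset> P} \<subseteq> cubes" "almost_laminar {Q\<in>S. Q \<subset> P}"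
        using S(1) F by (auto intro: finite_subset elim!: almost_laminar_subset)
      show "\<not> dominates g P Q" if "Q \<in> {Q\<in>S. Q \<subset> P}" for Q
      proof -
        have "Q \<in> F" "Q \<in> S" "Q \<subset> P" using that S(1) by auto
        then show ?thesis using S(2)[of Q] P by metis
      qed
    qed auto
  qed
  moreover have "\<exists>P\<in>S. Q \<subseteq> P \<and> (\<forall>A :: complex^'n^'n. average Q (\<lambda>y. ennreal (norm (A *v g y)))
        \<le> of_nat (2 * CARD('n)^3) * average P (\<lambda>y. ennreal (norm (A *v g y))))" if Q: "Q \<in> F" for Q
  proof -
    have "\<exists>P\<in>S. Q \<subseteq> P \<and> dominates g P Q"
    proof (cases "Q \<in> S")
      case True
      have "mean_dot g Q e \<le> of_nat (2 * CARD('n)^2) * mean_dot g Q e" for e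
      proof -
        have "(of_nat 1 :: ennreal) \<le> of_nat (2 * CARD('n)^2)"
          by (intro of_nat_mono) (simp add: Suc_leI)
        then have "1 * mean_dot g Q e \<le> of_nat (2 * CARD('n)^2) * mean_dot g Q e"
          by (intro mult_right_mono) simp_all
        then show ?thesis by simp
      qed
      then show ?thesis using True by (auto simp: dominates_def)
    next
      case False then show ?thesis using S(2)[OF Q] by blast
    qed
    then obtain P where P: "P \<in> S" "Q \<subseteq> P" "dominates g P Q" by blast
    have PQ: "P \<in> cubes" "Q \<in> cubes" using P(1) S(1) Q F(2) by auto
    note [measurable] = cube_sets[OF PQ(1)] cube_sets[OF PQ(2)]
    have "average Q (\<lambda>y. ennreal (norm (A *v g y))) \<le> of_nat (2 * CARD('n)^3) * average P (\<lambda>y. ennreal (norm (A *v g y)))"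
      for A :: "complex^'n^'n"
    proof -
      have 1: "ennreal (norm (A *v g y)) \<le> (\<Sum>i\<in>UNIV. ennreal (norm (dotp (A $ i) (g y))))" for y
        unfolding dotp_row using L2_set_le_sum[of UNIV "\<lambda>i. norm ((A *v g y) $ i)"]
        by (subst sum_ennreal) (auto simp: norm_vec_def intro: ennreal_leI)
      have "average Q (\<lambda>y. ennreal (norm (A *v g y)))
          \<le> ennreal (1 / vol Q) * (\<integral>\<^sup>+y. (\<Sum>i\<in>UNIV. ennreal (norm (dotp (A $ i) (g y))) * indicator Q y) \<partial>lebesgue)"
        unfolding average_def by (intro mult_left_mono nn_integral_mono) (use 1 in \<open>auto simp: indicator_def\<close>)
      also have "\<dots> = (\<Sum>i\<in>UNIV. mean_dot g Q (A $ i))"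
        unfolding mean_dot_def average_def by (subst nn_integral_sum) (auto simp: sum_distrib_left)
      also have "\<dots> \<le> (\<Sum>i\<in>(UNIV::'n set). of_nat (2 * CARD('n)^2) * average P (\<lambda>y. ennreal (norm (A *v g y))))"
      proof (rule sum_mono)
        fix i
        have "mean_dot g P (A $ i) \<le> average P (\<lambda>y. ennreal (norm (A *v g y)))"
          unfolding mean_dot_def average_def dotp_row
          by (intro mult_left_mono nn_integral_mono mult_right_mono ennreal_leI Finite_Cartesian_Product.norm_nth_le) auto
        then show "mean_dot g Q (A $ i) \<le> of_nat (2 * CARD('n)^2) * average P (\<lambda>y. ennreal (norm (A *v g y)))"
          using P(3) unfolding dominates_def by (meson mult_left_mono order_trans zero_le)
      qed
      also have "\<dots> = of_nat (2 * CARD('n)^3) * average P (\<lambda>y. ennreal (norm (A *v g y)))"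
        by (simp add: power3_eq_cube power2_eq_square mult_ac)
      finally show ?thesis .
    qed
    with P show ?thesis by blast
  qed
  ultimately show ?thesis using S(1) by (intro that) auto
qed

section \<open>Orlicz norms summed over a sparse family\<close>

text \<open>The levels are parametrized by their reciprocals \<open>u\<close>, so that the later scaling in \<open>u\<close> is linear.\<close>

lemma layer_cake_powr:
  fixes b q :: real
  assumes b: "0 < b" and q: "0 < q"
  shows "ennreal (b powr q) = (\<integral>\<^sup>+u. ennreal (q * u powr (- q - 1)) * indicator {1 / b<..} u \<partial>lborel)"
proof -
  have "(\<integral>\<^sup>+u. ennreal (q * u powr (- q - 1)) * indicator {1 / b..} u \<partial>lborel) = 0 - (- ((1 / b) powr (- q)))"
  proof (rule nn_integral_FTC_atLeast)
    show "((\<lambda>u. - (u powr (- q))) has_real_derivative q * u powr (- q - 1)) (at u)" if "1 / b \<le> u" for u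
    proof -
      have "0 < u" using b that by (meson less_le_trans zero_less_divide_1_iff)
      then show ?thesis by (auto intro!: derivative_eq_intros)
    qed
    show "((\<lambda>u :: real. - (u powr (- q))) \<longlongrightarrow> 0) at_top"
      using tendsto_minus[OF tendsto_neg_powr[OF _ filterlim_ident]] q by simp
  qed (use q in auto)
  also have "0 - (- ((1 / b) powr (- q))) = b powr q" using b by (simp add: powr_minus powr_divide)
  also have "(\<integral>\<^sup>+u. ennreal (q * u powr (- q - 1)) * indicator {1 / b..} u \<partial>lborel)
      = (\<integral>\<^sup>+u. ennreal (q * u powr (- q - 1)) * indicator {1 / b<..} u \<partial>lborel)"
  proof (rule nn_integral_cong_AE)
    have "AE u in lborel. u \<noteq> 1 / b" by (rule AE_lborel_singleton)
    then show "AE u in lborel. ennreal (q * u powr (- q - 1)) * indicator {1 / b..} u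
        = ennreal (q * u powr (- q - 1)) * indicator {1 / b<..} u"
      by eventually_elim (auto simp: indicator_def)
  qed
  finally show ?thesis by simp
qed

lemma sigma_finite_lebesgue: "sigma_finite_measure (lebesgue :: 'a::euclidean_space measure)"
proof (rule sigma_finite_measure.intro, rule exI[of _ "range (\<lambda>n::nat. cball (0::'a) (real n))"], intro conjI)
  show "\<Union>(range (\<lambda>n::nat. cball (0::'a) (real n))) = space lebesgue"
    using real_arch_simple by (auto simp: dist_norm) 
  show "\<forall>a\<in>range (\<lambda>n::nat. cball (0::'a) (real n)). emeasure lebesgue a \<noteq> \<infinity>"
    using fmeasurableD2[OF lmeasurable_cball] by auto
qed auto

text \<open>The condition of the class \<open>B_(p,q)\<close> restricts \<open>\<Psi>\<close> only at large arguments, so small values must not enter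
  the integrals.\<close>

definition excess :: "(real \<Rightarrow> real) \<Rightarrow> real \<Rightarrow> real \<Rightarrow> real" where
  "excess \<Psi> s0 t = (if s0 < t then \<Psi> t else 0)"

text \<open>A number below the norm is not admissible, so the average of \<open>\<Psi>(u F)\<close> exceeds \<open>1\<close>. Values of \<open>u F\<close> below
  the threshold contribute at most \<open>1/2\<close> to it.\<close>

lemma vol_le_excess:
  fixes F :: "real^'d \<Rightarrow> real"
  assumes \<Psi>: "mono \<Psi>" "\<Psi> 0 = 0" and s0: "0 < s0" "\<Psi> s0 \<le> 1 / 2"
    and F[measurable]: "F \<in> borel_measurable lebesgue" "\<And>x. 0 \<le> F x" and P: "P \<in> cubes"
    and u: "0 < u" "1 / u < enn2real (orlicz_norm \<Psi> P F)"
  shows "ennreal (vol P) \<le> 2 * (\<integral>\<^sup>+x\<in>P. ennreal (excess \<Psi> s0 (u * F x)) \<partial>lebesgue)"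
proof -
  have \<Psi>m[measurable]: "\<Psi> \<in> borel_measurable borel" by (rule borel_measurable_mono[OF \<Psi>(1)])
  have "\<not> admissible \<Psi> P F (1 / u)"
  proof
    assume "admissible \<Psi> P F (1 / u)"
    from orlicz_norm_le[OF this] have "enn2real (orlicz_norm \<Psi> P F) \<le> 1 / u"
      using u by (intro enn2real_leI) auto
    then show False using u by simp
  qed
  then have "1 < average P (\<lambda>x. ennreal (\<Psi> (u * F x)))"
    using u F(2) by (simp add: admissible_def not_le mult.commute)
  also have "\<dots> \<le> average P (\<lambda>x. ennreal (excess \<Psi> s0 (u * F x)) + ennreal (1 / 2))"
  proof (rule average_mono)
    fix x
    have "\<Psi> (u * F x) \<le> 1 / 2" if "u * F x \<le> s0" using monoD[OF \<Psi>(1) that] s0(2) by simp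
    moreover have "0 \<le> \<Psi> (u * F x)" using monoD[OF \<Psi>(1), of 0 "u * F x"] \<Psi>(2) u(1) F(2)[of x] by simp
    ultimately show "ennreal (\<Psi> (u * F x)) \<le> ennreal (excess \<Psi> s0 (u * F x)) + ennreal (1 / 2)"
    proof (cases "s0 < u * F x")
      case False
      then have "ennreal (\<Psi> (u * F x)) \<le> ennreal (1 / 2)" using \<open>u * F x \<le> s0 \<Longrightarrow> _\<close> by (intro ennreal_leI) simp
      with False show ?thesis unfolding excess_def by (simp only: if_False ennreal_0 add_0)
    qed (simp add: excess_def add_increasing2)
  qed
  also have "\<dots> = average P (\<lambda>x. ennreal (excess \<Psi> s0 (u * F x))) + ennreal (1 / 2)"
    unfolding excess_def by (subst average_add[OF _ _ P]) (auto simp: average_const[OF P])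
  finally have gt: "1 < average P (\<lambda>x. ennreal (excess \<Psi> s0 (u * F x))) + ennreal (1 / 2)" .
  have half: "ennreal (1 / 2) \<le> average P (\<lambda>x. ennreal (excess \<Psi> s0 (u * F x)))"
  proof (rule ccontr)
    assume "\<not> ?thesis"
    then have "average P (\<lambda>x. ennreal (excess \<Psi> s0 (u * F x))) + ennreal (1 / 2) \<le> ennreal (1 / 2) + ennreal (1 / 2)"
      by (intro add_right_mono) auto
    also have "\<dots> = 1" by (subst ennreal_plus[symmetric]) auto
    finally show False using gt by simp
  qed
  have "ennreal (vol P) = ennreal (2 * (vol P * (1 / 2)))" by simp
  also have "\<dots> = ennreal 2 * (ennreal (vol P) * ennreal (1 / 2))"
    by (subst ennreal_mult', simp, subst ennreal_mult', simp add: vol_def, rule refl)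
  also have "\<dots> \<le> ennreal 2 * (ennreal (vol P) * average P (\<lambda>x. ennreal (excess \<Psi> s0 (u * F x))))"
    by (intro mult_left_mono half) auto
  finally show ?thesis by (simp add: nn_integral_eq_vol_average[OF P])
qed

text \<open>One factor of \<open>vol P powr r\<close> is summed by sparseness: the sum is at most twice the volume of the
  union, which consists of almost disjoint maximal cubes, each of which carries a proportional part of
  the integral. The other \<open>r - 1\<close> factors are bounded by the whole integral.\<close>

lemma sparse_sum_le_powr_integral:
  fixes h :: "real^'d \<Rightarrow> ennreal"
  assumes S: "finite S" "S \<subseteq> cubes" "almost_laminar S" "sparse S" and S': "S' \<subseteq> S"
    and h[measurable]: "h \<in> borel_measurable lebesgue"
    and big: "\<And>P. P \<in> S' \<Longrightarrow> ennreal (vol P) \<le> 2 * (\<integral>\<^sup>+x\<in>P. h x \<partial>lebesgue)" and r: "1 \<le> r"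
  shows "(\<Sum>P\<in>S'. ennreal (vol P powr r)) \<le> 2 * ennpowr (2 * (\<integral>\<^sup>+x. h x \<partial>lebesgue)) r"
proof (cases "(\<integral>\<^sup>+x. h x \<partial>lebesgue) = \<infinity>")
  case True
  then show ?thesis by (simp add: ennreal_mult_top)
next
  case False
  define I where "I = enn2real (2 * (\<integral>\<^sup>+x. h x \<partial>lebesgue))"
  have I: "ennreal I = 2 * (\<integral>\<^sup>+x. h x \<partial>lebesgue)" "0 \<le> I"
    using False by (auto simp: I_def ennreal_mult_less_top less_top)
  have fin: "finite S'" using S(1) S' finite_subset by blast
  define M where "M = maximal_members S'"
  have M: "finite M" "M \<subseteq> S'" "M \<subseteq> cubes" using fin S' S(2) by (auto simp: M_def maximal_members_def)
  have vI: "vol P \<le> I" if "P \<in> S'" for P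
  proof -
    have "ennreal (vol P) \<le> 2 * (\<integral>\<^sup>+x\<in>P. h x \<partial>lebesgue)" by (rule big[OF that])
    also have "\<dots> \<le> ennreal I" unfolding I by (intro mult_left_mono nn_integral_mono) (auto simp: indicator_def)
    finally show ?thesis using I(2) by simp
  qed
  have v0: "0 \<le> vol P" for P :: "(real^'d) set" by (simp add: vol_def)
  have "(\<Sum>P\<in>S'. vol P) \<le> 2 * measure lebesgue (\<Union>S')"
    by (rule sparse_packing[OF S S'])
  also have "measure lebesgue (\<Union>S') = measure lebesgue (\<Union>M)"
    unfolding M_def by (simp add: maximal_members_cover[OF fin])
  also have "\<dots> \<le> (\<Sum>Q\<in>M. vol Q)"
    unfolding vol_def using M cube_lmeasurable by (intro measure_Union_le) auto
  also have "\<dots> \<le> I"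
  proof -
    have "ennreal (\<Sum>Q\<in>M. vol Q) = (\<Sum>Q\<in>M. ennreal (vol Q))" by (simp add: v0 sum_ennreal)
    also have "\<dots> \<le> (\<Sum>Q\<in>M. 2 * (\<integral>\<^sup>+x\<in>Q. h x \<partial>lebesgue))" using M by (intro sum_mono big) auto
    also have "\<dots> = 2 * (\<Sum>Q\<in>M. \<integral>\<^sup>+x\<in>Q. h x \<partial>lebesgue)" by (simp add: sum_distrib_left)
    also have "\<dots> \<le> 2 * (\<integral>\<^sup>+x\<in>UNIV. h x \<partial>lebesgue)"
    proof (intro mult_left_mono sum_nn_integral_le_Union[OF M(1)])
      show "pairwise (\<lambda>P Q. negligible (P \<inter> Q)) M"
        unfolding M_def by (rule maximal_members_overlap[OF almost_laminar_subset[OF S(3) S']])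
      show "M \<subseteq> sets lebesgue" using M(3) cube_sets by auto
    qed auto
    finally have "ennreal (\<Sum>Q\<in>M. vol Q) \<le> ennreal I" unfolding I(1) by simp
    then show ?thesis using I(2) by simp
  qed
  finally have sum: "(\<Sum>P\<in>S'. vol P) \<le> 2 * I" by simp
  have "(\<Sum>P\<in>S'. vol P powr r) \<le> (\<Sum>P\<in>S'. I powr (r - 1) * vol P)"
  proof (rule sum_mono)
    fix P assume P: "P \<in> S'"
    then have "0 < vol P" using S' S(2) vol_cube_pos by blast
    then have "vol P powr r = vol P powr (r - 1) * vol P" by (simp add: powr_diff)
    also have "\<dots> \<le> I powr (r - 1) * vol P"
      using r vI[OF P] v0 by (intro mult_right_mono powr_mono2) auto
    finally show "vol P powr r \<le> I powr (r - 1) * vol P" .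
  qed
  also have "\<dots> \<le> I powr (r - 1) * (2 * I)" unfolding sum_distrib_left[symmetric] by (intro mult_left_mono sum) auto
  also have "\<dots> = 2 * I powr r" using I(2) by (cases "I = 0") (auto simp: powr_diff)
  finally have "ennreal (\<Sum>P\<in>S'. vol P powr r) \<le> ennreal (2 * I powr r)" by (rule ennreal_leI)
  then show ?thesis
    unfolding I(1)[symmetric] using I(2) by (simp add: sum_ennreal ennpowr_ennreal ennreal_mult)
qed

text \<open>On \<open>[1, \<infinity>)\<close> this is the class \<open>B_(p,q)\<close>, and between the threshold and \<open>1\<close> the integrand is bounded.\<close>

lemma excess_profile_finite:
  assumes \<Psi>: "mono \<Psi>" "\<Psi> 0 = 0" "\<Psi> \<in> B_class p q" and s0: "0 < s0" "s0 \<le> 1" and pq: "1 < p" "p \<le> q"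
  shows "(\<integral>\<^sup>+s. ennreal (q * s powr (- q - 1) * excess \<Psi> s0 s powr (q / p)) \<partial>lborel) < \<infinity>"
proof -
  have [measurable]: "\<Psi> \<in> borel_measurable borel" by (rule borel_measurable_mono[OF \<Psi>(1)])
  define K where "K = q * s0 powr (- q - 1) * \<Psi> 1 powr (q / p)"
  have \<Psi>0: "0 \<le> \<Psi> t" if "0 \<le> t" for t using monoD[OF \<Psi>(1) that] \<Psi>(2) by simp
  have "(\<integral>\<^sup>+s. ennreal (q * s powr (- q - 1) * excess \<Psi> s0 s powr (q / p)) \<partial>lborel)
      \<le> (\<integral>\<^sup>+s. ennreal q * (ennreal (\<Psi> s powr (q / p) / s powr q / s) * indicator {1..} s) + ennreal K * indicator {s0..1} s \<partial>lborel)"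
  proof (rule nn_integral_mono)
    fix s :: real
    consider "s \<le> s0" | "s0 < s" "s < 1" | "1 \<le> s" by linarith
    then show "ennreal (q * s powr (- q - 1) * excess \<Psi> s0 s powr (q / p))
        \<le> ennreal q * (ennreal (\<Psi> s powr (q / p) / s powr q / s) * indicator {1..} s) + ennreal K * indicator {s0..1} s"
    proof cases
      case 1 then show ?thesis by (simp add: excess_def)
    next
      case 2
      have "s powr (- q - 1) \<le> s0 powr (- q - 1)"
        using 2 s0 pq by (intro powr_mono2') auto
      moreover have "\<Psi> s powr (q / p) \<le> \<Psi> 1 powr (q / p)"
        using 2 s0 pq \<Psi>0[of s] monoD[OF \<Psi>(1), of s 1] by (intro powr_mono2) auto
      ultimately have "q * s powr (- q - 1) * \<Psi> s powr (q / p) \<le> K"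
        unfolding K_def using pq by (intro mult_mono) auto
      then show ?thesis using 2 by (simp add: excess_def ennreal_leI)
    next
      case 3
      have "s powr (- q - 1) = 1 / s powr q / s" using 3 by (simp add: powr_diff powr_minus field_simps)
      then have "ennreal (q * s powr (- q - 1) * excess \<Psi> s0 s powr (q / p))
          \<le> ennreal q * ennreal (\<Psi> s powr (q / p) / s powr q / s)"
        using 3 pq by (subst ennreal_mult[symmetric]) (auto simp: excess_def intro!: ennreal_leI)
      then show ?thesis using 3 by (simp add: add_increasing2)
    qed
  qed
  also have "\<dots> = ennreal q * (\<integral>\<^sup>+s. ennreal (\<Psi> s powr (q / p) / s powr q / s) * indicator {1..} s \<partial>lborel)
      + ennreal K * emeasure lborel {s0..1}"
    by (subst nn_integral_add) (auto simp: nn_integral_cmult nn_integral_cmult_indicator)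
  also have "\<dots> < \<infinity>"
    using \<Psi>(3) s0 by (simp add: B_class_def ennreal_mult_less_top ennreal_mult_eq_top_iff less_top[symmetric])
  finally show ?thesis .
qed

text \<open>Substitution \<open>s = u a\<close>; the powers of \<open>a\<close> combine to \<open>a powr p\<close>.\<close>

lemma excess_scaling:
  assumes \<Psi>: "mono \<Psi>" and s0: "0 < s0" and pq: "1 < p" "p \<le> q" and a: "0 \<le> a"
  shows "(\<integral>\<^sup>+u\<in>{0<..}. ennreal (q * u powr (- q - 1) * (a powr (p - q) * excess \<Psi> s0 (u * a) powr (q / p))) \<partial>lborel)
    \<le> ennreal (a powr p) * (\<integral>\<^sup>+s. ennreal (q * s powr (- q - 1) * excess \<Psi> s0 s powr (q / p)) \<partial>lborel)"
proof (cases "a = 0")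
  case False
  then have a: "0 < a" using a by simp
  have [measurable]: "\<Psi> \<in> borel_measurable borel" by (rule borel_measurable_mono[OF \<Psi>])
  have "ennreal (a powr p) * (\<integral>\<^sup>+s. ennreal (q * s powr (- q - 1) * excess \<Psi> s0 s powr (q / p)) \<partial>lborel)
      = ennreal (a powr p) * (ennreal a * (\<integral>\<^sup>+u. ennreal (q * (a * u) powr (- q - 1) * excess \<Psi> s0 (a * u) powr (q / p)) \<partial>lborel))"
    using a by (subst nn_integral_real_affine[where c = a and t = 0]) (auto simp: excess_def)
  also have "\<dots> = (\<integral>\<^sup>+u. ennreal (a powr p) * (ennreal a * ennreal (q * (a * u) powr (- q - 1) * excess \<Psi> s0 (a * u) powr (q / p))) \<partial>lborel)"
    unfolding excess_def by (subst nn_integral_cmult, simp, subst nn_integral_cmult) auto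
  also have "\<dots> \<ge> (\<integral>\<^sup>+u\<in>{0<..}. ennreal (q * u powr (- q - 1) * (a powr (p - q) * excess \<Psi> s0 (u * a) powr (q / p))) \<partial>lborel)"
  proof (rule nn_integral_mono)
    fix u :: real
    show "ennreal (q * u powr (- q - 1) * (a powr (p - q) * excess \<Psi> s0 (u * a) powr (q / p))) * indicator {0<..} u
        \<le> ennreal (a powr p) * (ennreal a * ennreal (q * (a * u) powr (- q - 1) * excess \<Psi> s0 (a * u) powr (q / p)))"
    proof (cases "0 < u")
      case True
      have "a powr p * (a * (a * u) powr (- q - 1)) = u powr (- q - 1) * a powr (p - q)"
      proof -
        have "(a * u) powr (- q - 1) = a powr (- q - 1) * u powr (- q - 1)" by (rule powr_mult)
        moreover have "a powr p * (a * a powr (- q - 1)) = a powr (p + (1 + (- q - 1)))"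
          using a by (simp only: powr_add powr_one)
        ultimately show ?thesis by (simp add: mult_ac)
      qed
      then have "a powr p * (a * (q * (a * u) powr (- q - 1) * excess \<Psi> s0 (a * u) powr (q / p)))
          = q * u powr (- q - 1) * (a powr (p - q) * excess \<Psi> s0 (u * a) powr (q / p))"
        by (simp add: mult_ac)
      then show ?thesis using True a pq by (simp flip: ennreal_mult)
    qed simp
  qed
  finally show ?thesis .
qed (use s0 in \<open>simp add: excess_def\<close>)

text \<open>For sparse families this replaces the \<open>L^p\<close> to \<open>L^q\<close> bound for the fractional Orlicz maximal operator of \<open>\<Psi>\<close>. Jensen's
  inequality is applied with weight \<open>F powr p\<close>, for which it loses nothing: by scaling, the integral over the levels
  \<open>u\<close> at a point \<open>x\<close> is a constant times \<open>F x powr p\<close>.\<close>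

lemma sparse_orlicz_sum:
  fixes \<Psi> :: "real \<Rightarrow> real"
  assumes \<Psi>: "mono \<Psi>" "\<Psi> 0 = 0" "\<Psi> \<in> B_class p q"
    and scale: "\<And>c. 0 \<le> c \<Longrightarrow> c \<le> 1 \<Longrightarrow> \<Psi> c \<le> c * \<Psi> 1"
    and pq: "1 < p" "p \<le> q"
  obtains C :: real where "0 \<le> C"
    "\<And>(S :: (real^'d) set set) F. \<lbrakk>finite S; S \<subseteq> cubes; almost_laminar S; sparse S;
       F \<in> borel_measurable lebesgue; \<And>x. 0 \<le> F x; (\<integral>\<^sup>+x. ennreal (F x powr p) \<partial>lebesgue) < \<infinity>\<rbrakk> \<Longrightarrow>
     (\<Sum>P\<in>S. ennreal (vol P powr (q / p) * enn2real (orlicz_norm \<Psi> P F) powr q))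
       \<le> ennreal C * ennpowr (\<integral>\<^sup>+x. ennreal (F x powr p) \<partial>lebesgue) (q / p)"
proof -
  define r where "r = q / p"
  have r: "1 \<le> r" using pq by (simp add: r_def)
  have \<Psi>0: "0 \<le> \<Psi> t" if "0 \<le> t" for t using monoD[OF \<Psi>(1) that] \<Psi>(2) by simp
  have [measurable]: "\<Psi> \<in> borel_measurable borel" by (rule borel_measurable_mono[OF \<Psi>(1)])
  \<comment> \<open>Chosen so that \<open>\<Psi> s0 \<le> s0 \<Psi> 1 \<le> 1/2\<close>; the summand \<open>1\<close> covers the case \<open>\<Psi> 1 = 0\<close> and keeps \<open>s0\<close> below \<open>1\<close>.\<close>
  define s0 where "s0 = 1 / (2 * (\<Psi> 1 + 1))"
  have s0: "0 < s0" "s0 \<le> 1" using \<Psi>0[of 1] by (auto simp: s0_def)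
  have "\<Psi> s0 \<le> s0 * \<Psi> 1" using s0 by (intro scale) auto
  also have "\<dots> \<le> 1 / 2" using \<Psi>0[of 1] by (simp add: s0_def field_simps)
  finally have s0h: "\<Psi> s0 \<le> 1 / 2" .
  define c0 where "c0 = (\<integral>\<^sup>+s. ennreal (q * s powr (- q - 1) * excess \<Psi> s0 s powr r) \<partial>lborel)"
  have c0: "c0 < \<infinity>" unfolding c0_def r_def by (rule excess_profile_finite[OF \<Psi> s0 pq])
  define D where "D = 2 * 2 powr r"
  show ?thesis
  proof (rule that[of "D * enn2real c0"])
    show "0 \<le> D * enn2real c0" by (simp add: D_def)
    fix S :: "(real^'d) set set" and F :: "real^'d \<Rightarrow> real"
    assume S: "finite S" "S \<subseteq> cubes" "almost_laminar S" "sparse S"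
      and F[measurable]: "F \<in> borel_measurable lebesgue" and Fnn: "\<And>x. 0 \<le> F x"
      and fin: "(\<integral>\<^sup>+x. ennreal (F x powr p) \<partial>lebesgue) < \<infinity>"
    define N where "N = (\<integral>\<^sup>+x. ennreal (F x powr p) \<partial>lebesgue)"
    define b where "b P = enn2real (orlicz_norm \<Psi> P F)" for P
    define k where "k u x = ennreal (q * u powr (- q - 1) * (F x powr (p - q) * excess \<Psi> s0 (u * F x) powr r))
      * indicator {0<..} u" for u x
    \<comment> \<open>A cube with \<open>b P = 0\<close> belongs to no level; the explicit condition is needed since \<open>1 / 0 = 0\<close>.\<close>
    define S' where "S' u = {P\<in>S. 0 < b P \<and> 1 / b P < u}" for u
    have bnn: "0 \<le> b P" for P by (simp add: b_def)
    have level: "(\<Sum>P\<in>S' u. ennreal (vol P powr r)) \<le> ennreal D * (ennpowr N (r - 1) *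
        (\<integral>\<^sup>+x. ennreal (F x powr (p - q) * excess \<Psi> s0 (u * F x) powr r) \<partial>lebesgue))" if u: "0 < u" for u
    proof -
      define h where "h x = excess \<Psi> s0 (u * F x)" for x
      have [measurable]: "h \<in> borel_measurable lebesgue" unfolding h_def excess_def by measurable
      have hnn: "0 \<le> h x" for x using \<Psi>0 u Fnn[of x] by (simp add: h_def excess_def)
      have h0: "h x = 0" if "F x = 0" for x using that s0 by (simp add: h_def excess_def)
      have "(\<Sum>P\<in>S' u. ennreal (vol P powr r)) \<le> 2 * ennpowr (2 * (\<integral>\<^sup>+x. ennreal (h x) \<partial>lebesgue)) r"
      proof (rule sparse_sum_le_powr_integral[OF S _ _ _ r])
        fix P assume P: "P \<in> S' u"
        then have "0 < b P" "1 / b P < u" by (auto simp: S'_def)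
        then have "1 / u < b P" using u by (simp add: field_simps)
        then show "ennreal (vol P) \<le> 2 * (\<integral>\<^sup>+x\<in>P. ennreal (h x) \<partial>lebesgue)"
          unfolding h_def b_def using P S(2) by (intro vol_le_excess[OF \<Psi>(1,2) s0(1) s0h F Fnn _ u]) (auto simp: S'_def)
      qed (auto simp: S'_def)
      also have "\<dots> = ennreal D * ennpowr (\<integral>\<^sup>+x. ennreal (h x) \<partial>lebesgue) r"
      proof -
        have "ennpowr 2 r = ennreal (2 powr r)" using ennpowr_ennreal[of 2 r] by simp
        then show ?thesis by (simp add: ennpowr_mult D_def ennreal_mult mult.assoc)
      qed
      \<comment> \<open>The weight \<open>F powr p\<close> can be divided out because \<open>h\<close> vanishes where \<open>F\<close> does.\<close>
      also have "(\<integral>\<^sup>+x. ennreal (h x) \<partial>lebesgue) = (\<integral>\<^sup>+x. ennreal (F x powr p * (h x / F x powr p)) \<partial>lebesgue)"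
        by (intro nn_integral_cong) (auto simp: h0)
      also have "ennpowr \<dots> r \<le> ennpowr N (r - 1) * (\<integral>\<^sup>+x. ennreal (F x powr p * (h x / F x powr p) powr r) \<partial>lebesgue)"
        by (rule weighted_jensen_powr) (use r fin hnn N_def in auto)
      also have "(\<integral>\<^sup>+x. ennreal (F x powr p * (h x / F x powr p) powr r) \<partial>lebesgue)
          = (\<integral>\<^sup>+x. ennreal (F x powr (p - q) * h x powr r) \<partial>lebesgue)"
      proof (rule nn_integral_cong)
        fix x
        have "p * r = q" using pq by (simp add: r_def)
        then show "ennreal (F x powr p * (h x / F x powr p) powr r) = ennreal (F x powr (p - q) * h x powr r)"
          by (cases "F x = 0") (use Fnn[of x] hnn[of x] in \<open>auto simp: powr_divide powr_powr powr_diff\<close>)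
      qed
      finally show ?thesis unfolding h_def by (simp add: mult_left_mono)
    qed
    have "(\<Sum>P\<in>S. ennreal (vol P powr r * b P powr q))
        = (\<Sum>P\<in>S. \<integral>\<^sup>+u. ennreal (q * u powr (- q - 1)) * (if 0 < b P \<and> 1 / b P < u then ennreal (vol P powr r) else 0) \<partial>lborel)"
    proof (rule sum.cong[OF refl])
      fix P
      show "ennreal (vol P powr r * b P powr q)
        = (\<integral>\<^sup>+u. ennreal (q * u powr (- q - 1)) * (if 0 < b P \<and> 1 / b P < u then ennreal (vol P powr r) else 0) \<partial>lborel)"
      proof (cases "0 < b P")
        case True
        have "ennreal (vol P powr r * b P powr q) = ennreal (vol P powr r) * ennreal (b P powr q)" by (simp add: ennreal_mult)
        also have "\<dots> = (\<integral>\<^sup>+u. ennreal (vol P powr r) * (ennreal (q * u powr (- q - 1)) * indicator {1 / b P<..} u) \<partial>lborel)"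
          using pq True by (subst layer_cake_powr) (auto simp: nn_integral_cmult)
        also have "\<dots> = (\<integral>\<^sup>+u. ennreal (q * u powr (- q - 1)) * (if 0 < b P \<and> 1 / b P < u then ennreal (vol P powr r) else 0) \<partial>lborel)"
          using True by (intro nn_integral_cong) (auto simp: indicator_def mult.commute)
        finally show ?thesis .
      next
        case False
        then have "b P = 0" using bnn[of P] by simp
        then show ?thesis using pq by simp
      qed
    qed
    also have "\<dots> = (\<integral>\<^sup>+u. (\<Sum>P\<in>S. ennreal (q * u powr (- q - 1)) * (if 0 < b P \<and> 1 / b P < u then ennreal (vol P powr r) else 0)) \<partial>lborel)"
      by (subst nn_integral_sum) auto
    also have "\<dots> \<le> (\<integral>\<^sup>+u. ennreal D * (ennpowr N (r - 1) * (\<integral>\<^sup>+x. k u x \<partial>lebesgue)) \<partial>lborel)"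
    proof (rule nn_integral_mono)
      fix u :: real
      have eq: "(\<Sum>P\<in>S. ennreal (q * u powr (- q - 1)) * (if 0 < b P \<and> 1 / b P < u then ennreal (vol P powr r) else 0))
          = ennreal (q * u powr (- q - 1)) * (\<Sum>P\<in>S' u. ennreal (vol P powr r))"
        unfolding S'_def using S(1) by (simp only: sum_distrib_left[symmetric] sum.inter_filter)
      show "(\<Sum>P\<in>S. ennreal (q * u powr (- q - 1)) * (if 0 < b P \<and> 1 / b P < u then ennreal (vol P powr r) else 0))
          \<le> ennreal D * (ennpowr N (r - 1) * (\<integral>\<^sup>+x. k u x \<partial>lebesgue))"
      proof (cases "0 < u")
        case True
        have "(\<integral>\<^sup>+x. k u x \<partial>lebesgue) = (\<integral>\<^sup>+x. ennreal (q * u powr (- q - 1)) * ennreal (F x powr (p - q) * excess \<Psi> s0 (u * F x) powr r) \<partial>lebesgue)"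
          unfolding k_def using True pq by (intro nn_integral_cong) (simp add: ennreal_mult)
        also have "\<dots> = ennreal (q * u powr (- q - 1)) * (\<integral>\<^sup>+x. ennreal (F x powr (p - q) * excess \<Psi> s0 (u * F x) powr r) \<partial>lebesgue)"
          unfolding excess_def by (subst nn_integral_cmult) auto
        finally show ?thesis
          unfolding eq using mult_left_mono[OF level[OF True], of "ennreal (q * u powr (- q - 1))"] by (simp add: mult_ac)
      next
        case False
        then have "S' u = {}" using order.strict_trans[of 0 "1 / b _" u] by (auto simp: S'_def)
        then show ?thesis unfolding eq by simp
      qed
    qed
    also have "\<dots> = ennreal D * (ennpowr N (r - 1) * (\<integral>\<^sup>+u. (\<integral>\<^sup>+x. k u x \<partial>lebesgue) \<partial>lborel))"
    proof -
      interpret L: sigma_finite_measure "lebesgue :: (real^'d) measure" by (rule sigma_finite_lebesgue)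
      have [measurable]: "case_prod k \<in> borel_measurable (lborel \<Otimes>\<^sub>M lebesgue)"
        unfolding k_def excess_def by measurable
      have "(\<lambda>u. \<integral>\<^sup>+x. k u x \<partial>lebesgue) \<in> borel_measurable lborel" by measurable
      then show ?thesis by (simp add: nn_integral_cmult)
    qed
    also have "(\<integral>\<^sup>+u. (\<integral>\<^sup>+x. k u x \<partial>lebesgue) \<partial>lborel) = (\<integral>\<^sup>+x. (\<integral>\<^sup>+u. k u x \<partial>lborel) \<partial>lebesgue)"
    proof -
      interpret L: sigma_finite_measure "lebesgue :: (real^'d) measure" by (rule sigma_finite_lebesgue)
      interpret pair_sigma_finite "lborel :: real measure" "lebesgue :: (real^'d) measure" ..
      have "case_prod k \<in> borel_measurable (lborel \<Otimes>\<^sub>M lebesgue)"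
        unfolding k_def excess_def by measurable
      then show ?thesis by (rule Fubini'[symmetric])
    qed
    also have "\<dots> \<le> (\<integral>\<^sup>+x. ennreal (F x powr p) * c0 \<partial>lebesgue)"
      unfolding k_def c0_def r_def
      by (intro nn_integral_mono excess_scaling[OF \<Psi>(1) s0(1) pq Fnn])
    also have "\<dots> = N * c0" unfolding N_def by (subst nn_integral_multc) auto
    also have "ennreal D * (ennpowr N (r - 1) * (N * c0)) = ennreal (D * enn2real c0) * ennpowr N r"
    proof -
      have "ennpowr N (r - 1) * N = ennpowr N r" by (rule ennpowr_mult_self) (use fin N_def in simp)
      moreover have "ennreal (D * enn2real c0) = ennreal D * c0" using c0 by (simp add: ennreal_mult' D_def less_top)
      ultimately show ?thesis by (metis mult.assoc mult.commute)
    qed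
    finally show "(\<Sum>P\<in>S. ennreal (vol P powr (q / p) * enn2real (orlicz_norm \<Psi> P F) powr q))
       \<le> ennreal (D * enn2real c0) * ennpowr (\<integral>\<^sup>+x. ennreal (F x powr p) \<partial>lebesgue) (q / p)"
      by (simp add: b_def r_def N_def mult_left_mono)
  qed
qed

section \<open>The matrix weighted maximal operator\<close>

lemma ennpowr_SUP:
  assumes r: "0 < r"
  shows "ennpowr (SUP i\<in>I. h i) r = (SUP i\<in>I. ennpowr (h i) r)"
proof (rule antisym)
  define Y where "Y = (SUP i\<in>I. ennpowr (h i) r)"
  have inv: "ennpowr (ennpowr z r) (1 / r) = z" "ennpowr (ennpowr z (1 / r)) r = z" for z
    using r by (simp_all add: ennpowr_ennpowr)
  have "(SUP i\<in>I. h i) \<le> ennpowr Y (1 / r)"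
  proof (rule SUP_least)
    fix i assume "i \<in> I"
    then have "ennpowr (h i) r \<le> Y" unfolding Y_def by (rule SUP_upper)
    then have "ennpowr (ennpowr (h i) r) (1 / r) \<le> ennpowr Y (1 / r)" using r by (intro ennpowr_mono) auto
    then show "h i \<le> ennpowr Y (1 / r)" by (simp add: inv)
  qed
  then have "ennpowr (SUP i\<in>I. h i) r \<le> ennpowr (ennpowr Y (1 / r)) r" using r by (intro ennpowr_mono) auto
  then show "ennpowr (SUP i\<in>I. h i) r \<le> Y" by (simp add: inv)
  show "(SUP i\<in>I. ennpowr (h i) r) \<le> ennpowr (SUP i\<in>I. h i) r"
    using r by (intro SUP_least ennpowr_mono SUP_upper) auto
qed

lemma borel_measurable_lebesgue_AE_cong:
  fixes f g :: "'a::euclidean_space \<Rightarrow> ennreal"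
  assumes f: "f \<in> borel_measurable lebesgue" and ae: "AE x in lebesgue. f x = g x"
  shows "g \<in> borel_measurable lebesgue"
proof (rule measurableI)
  fix S :: "ennreal set" assume S: "S \<in> sets borel"
  have "AE x in lebesgue. x \<in> f -` S \<inter> space lebesgue \<longleftrightarrow> x \<in> g -` S \<inter> space lebesgue"
    using ae by eventually_elim auto
  then show "g -` S \<inter> space lebesgue \<in> sets lebesgue"
    by (rule completion.in_sets_AE) (use measurable_sets[OF f S] in auto)
qed simp

text \<open>The quantity inside the supremum of the maximal operator for one cube, with \<open>\<delta>\<close> for \<open>\<alpha>/d\<close> and with
  arbitrary measurable matrix functions in place of the powers of the weights.\<close>

definition kernel_average ::
  "real \<Rightarrow> (real^'d \<Rightarrow> complex^'n^'n) \<Rightarrow> (real^'d \<Rightarrow> complex^'n^'n) \<Rightarrow> (real^'d) set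
    \<Rightarrow> (real^'d \<Rightarrow> complex^'n) \<Rightarrow> real^'d \<Rightarrow> ennreal" where
  "kernel_average \<delta> A B Q f x = ennreal (1 / vol Q powr (1 - \<delta>)) *
     (\<integral>\<^sup>+y\<in>Q. ennreal (norm ((A x ** B y) *v f y)) \<partial>lebesgue)"

lemma borel_measurable_lebesgue_nn_integral:
  fixes h :: "real^'d \<Rightarrow> real^'d \<Rightarrow> ennreal"
  assumes "case_prod h \<in> borel_measurable (lebesgue \<Otimes>\<^sub>M lebesgue)"
  shows "(\<lambda>x. \<integral>\<^sup>+y. h x y \<partial>lebesgue) \<in> borel_measurable lebesgue"
proof -
  interpret L: sigma_finite_measure "lebesgue :: (real^'d) measure" by (rule sigma_finite_lebesgue)
  show ?thesis using assms by (rule L.borel_measurable_nn_integral)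
qed

lemma kernel_average_measurable [measurable]:
  fixes A B :: "real^'d \<Rightarrow> complex^'n^'n"
  assumes [measurable]: "A \<in> borel_measurable lebesgue" "B \<in> borel_measurable lebesgue" "f \<in> borel_measurable lebesgue"
    and Q: "Q \<in> cubes"
  shows "kernel_average \<delta> A B Q f \<in> borel_measurable lebesgue"
proof -
  note [measurable] = cube_sets[OF Q]
  have "(\<lambda>x. \<integral>\<^sup>+y\<in>Q. ennreal (norm ((A x ** B y) *v f y)) \<partial>lebesgue) \<in> borel_measurable lebesgue"
    by (rule borel_measurable_lebesgue_nn_integral) measurable
  then show ?thesis unfolding kernel_average_def by measurable
qed

lemma kernel_average_eq_average:
  assumes Q: "Q \<in> cubes"
  shows "kernel_average \<delta> A B Q f x = ennreal (vol Q powr \<delta>) * average Q (\<lambda>y. ennreal (norm (A x *v (B y *v f y))))"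
proof -
  have "1 / vol Q powr (1 - \<delta>) = vol Q powr \<delta> * (1 / vol Q)"
    using vol_cube_pos[OF Q] by (simp add: powr_diff)
  then have "ennreal (1 / vol Q powr (1 - \<delta>)) = ennreal (vol Q powr \<delta>) * ennreal (1 / vol Q)"
    using ennreal_mult'[of "vol Q powr \<delta>" "1 / vol Q"] by simp
  then show ?thesis unfolding kernel_average_def average_def
    by (simp only: mult.assoc matrix_vector_mul_assoc)
qed

definition rational_cubes :: "(real^'d) set set" where
  "rational_cubes = (\<lambda>(f :: 'd \<Rightarrow> rat, l). cube (\<chi> i. of_rat (f i)) (of_rat l)) ` {(f, l). 0 < l}"

lemma countable_rational_cubes: "countable (rational_cubes :: (real^'d) set set)"
  unfolding rational_cubes_def by (intro countable_image) (rule countable_subset[OF subset_UNIV], simp)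

lemma rational_cubes_subset: "(rational_cubes :: (real^'d) set set) \<subseteq> cubes"
proof
  fix R :: "(real^'d) set" assume "R \<in> rational_cubes"
  then obtain f :: "'d \<Rightarrow> rat" and l where "0 < l" "R = cube (\<chi> i. of_rat (f i)) (of_rat l)"
    by (auto simp: rational_cubes_def)
  then show "R \<in> cubes" unfolding cubes_eq by (intro exI[of _ "\<chi> i. of_rat (f i)"] exI[of _ "of_rat l"]) simp
qed

lemma rational_cubes_nonempty: "rational_cubes \<noteq> {}"
  unfolding rational_cubes_def by (auto intro!: exI[of _ 1])

text \<open>Enlarging \<open>Q\<close> slightly to a cube with rational data changes its volume by a factor close to \<open>1\<close>.\<close>

lemma rational_cube_approx:
  fixes Q :: "(real^'d) set"
  assumes Q: "Q \<in> cubes" and s: "0 < s" and \<epsilon>: "0 < \<epsilon>" "\<epsilon> < 1"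
  obtains R where "R \<in> rational_cubes" "Q \<subseteq> R" "\<epsilon> * (1 / vol Q powr s) \<le> 1 / vol R powr s"
proof -
  obtain a l where l: "0 < l" "Q = cube a l" using Q by (auto simp: cubes_eq)
  define v where "v = vol Q powr s"
  have v: "0 < v" "v = (l ^ CARD('d)) powr s" using vol_cube_pos[OF Q] l by (auto simp: v_def vol_cube)
  have "((\<lambda>z. (z ^ CARD('d)) powr s) \<longlongrightarrow> (l ^ CARD('d)) powr s) (at_right l)"
    using l by (intro tendsto_intros) auto
  moreover have "(l ^ CARD('d)) powr s < v / \<epsilon>" using v \<epsilon> by (simp add: field_simps)
  ultimately have "\<forall>\<^sub>F z in at_right l. (z ^ CARD('d)) powr s < v / \<epsilon>" by (rule order_tendstoD)
  then obtain b where b: "l < b" "\<And>z. l < z \<Longrightarrow> z < b \<Longrightarrow> (z ^ CARD('d)) powr s < v / \<epsilon>"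
    by (auto simp: eventually_at_right_field)
  obtain l' where l': "l < of_rat l'" "of_rat l' < b" using of_rat_dense[OF b(1)] by blast
  have "\<exists>f. a $ i - (of_rat l' - l) < of_rat f \<and> of_rat f < a $ i" for i
    by (rule of_rat_dense) (use l' in simp)
  then obtain f :: "'d \<Rightarrow> rat" where f: "\<And>i. a $ i - (of_rat l' - l) < of_rat (f i)" "\<And>i. of_rat (f i) < a $ i"
    by metis
  have l'0: "0 < (of_rat l' :: real)" using l l' by linarith
  let ?R = "cube (\<chi> i. of_rat (f i)) (of_rat l') :: (real^'d) set"
  show ?thesis
  proof (rule that)
    show "?R \<in> rational_cubes" using l'0 by (auto simp: rational_cubes_def zero_less_of_rat_iff)
    show "Q \<subseteq> ?R" unfolding l using f by (intro cube_subset) (simp, smt (verit))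
    have "vol ?R powr s < v / \<epsilon>" using b(2)[OF l'] l'0 by (simp add: vol_cube)
    moreover have "0 < vol ?R powr s" using l'0 by (simp add: vol_cube)
    ultimately show "\<epsilon> * (1 / vol Q powr s) \<le> 1 / vol ?R powr s"
      using \<epsilon> v unfolding v_def[symmetric] by (simp add: field_simps)
  qed
qed

text \<open>Passing to a slightly larger rational cube increases the integral and decreases the normalizing factor
  by a factor arbitrarily close to \<open>1\<close>; the point \<open>x\<close> stays inside.\<close>

lemma maximal_eq_rational:
  fixes A B :: "real^'d \<Rightarrow> complex^'n^'n"
  assumes \<delta>: "\<delta> < 1"
  shows "(SUP Q\<in>{Q\<in>cubes. x \<in> Q}. kernel_average \<delta> A B Q f x)
       = (SUP R\<in>rational_cubes. kernel_average \<delta> A B R f x * indicator R x)" (is "?l = ?r")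
proof (rule antisym)
  show "?l \<le> ?r"
  proof (rule SUP_least)
    fix Q assume "Q \<in> {Q\<in>cubes. x \<in> Q}"
    then have Q: "Q \<in> cubes" "x \<in> Q" by auto
    show "kernel_average \<delta> A B Q f x \<le> ?r"
    proof (rule ennreal_approx_unit)
      fix e :: ennreal assume e: "0 < e" "e < 1"
      then obtain \<epsilon> where \<epsilon>: "e = ennreal \<epsilon>" "0 < \<epsilon>" "\<epsilon> < 1" by (cases e) (auto simp: ennreal_less_one_iff)
      obtain R where R: "R \<in> rational_cubes" "Q \<subseteq> R" "\<epsilon> * (1 / vol Q powr (1 - \<delta>)) \<le> 1 / vol R powr (1 - \<delta>)"
        using rational_cube_approx[OF Q(1) _ \<epsilon>(2,3), of "1 - \<delta>"] \<delta> by auto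
      have "e * kernel_average \<delta> A B Q f x
          = ennreal (\<epsilon> * (1 / vol Q powr (1 - \<delta>))) * (\<integral>\<^sup>+y\<in>Q. ennreal (norm ((A x ** B y) *v f y)) \<partial>lebesgue)"
        using \<epsilon> unfolding kernel_average_def by (subst ennreal_mult) (auto simp: mult.assoc)
      also have "\<dots> \<le> kernel_average \<delta> A B R f x * indicator R x"
        using R Q(2) unfolding kernel_average_def
        by (auto simp: subset_iff intro!: mult_mono ennreal_leI nn_integral_mono simp: indicator_def)
      also have "\<dots> \<le> ?r" by (rule SUP_upper[OF R(1)])
      finally show "e * kernel_average \<delta> A B Q f x \<le> ?r" .
    qed
  qed
  show "?r \<le> ?l"
  proof (rule SUP_least)
    fix R :: "(real^'d) set" assume "R \<in> rational_cubes"
    then have "R \<in> cubes" using rational_cubes_subset by blast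
    then show "kernel_average \<delta> A B R f x * indicator R x \<le> ?l"
      by (cases "x \<in> R") (auto intro: SUP_upper)
  qed
qed

text \<open>Admissibility is inherited by larger numbers, so the infimum can be taken over rational \<open>l\<close>. For each
  of these the average is a measurable function of \<open>x\<close> by Tonelli.\<close>

lemma orlicz_norm_measurable:
  fixes A B :: "real^'d \<Rightarrow> complex^'n^'n"
  assumes Y: "young_function \<Phi>"
    and [measurable]: "A \<in> borel_measurable lebesgue" "B \<in> borel_measurable lebesgue" and Q: "Q \<in> cubes"
  shows "(\<lambda>x. orlicz_norm \<Phi> Q (\<lambda>y. op_norm (A x ** B y))) \<in> borel_measurable lebesgue"
proof -
  note [measurable] = cube_sets[OF Q]
  have mo: "\<And>s t. 0 \<le> s \<Longrightarrow> s \<le> t \<Longrightarrow> \<Phi> s \<le> \<Phi> t" using Y by (auto simp: young_function_def mono_on_def)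
  have "mono (\<lambda>t. \<Phi> (max 0 t))" using mo by (intro monoI) auto
  then have [measurable]: "(\<lambda>t. \<Phi> (max 0 t)) \<in> borel_measurable borel" by (rule borel_measurable_mono)
  define av where "av l x = average Q (\<lambda>y. ennreal (\<Phi> (\<bar>op_norm (A x ** B y)\<bar> / l)))" for l x
  have av[measurable]: "av l \<in> borel_measurable lebesgue" if l: "0 < l" for l
  proof -
    have "(\<lambda>x. \<integral>\<^sup>+y\<in>Q. ennreal (\<Phi> (max 0 (\<bar>op_norm (A x ** B y)\<bar> / l))) \<partial>lebesgue) \<in> borel_measurable lebesgue"
      by (rule borel_measurable_lebesgue_nn_integral) measurable
    then show ?thesis unfolding av_def average_def using l by (simp add: max_def)
  qed
  have "orlicz_norm \<Phi> Q (\<lambda>y. op_norm (A x ** B y))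
      = (INF l\<in>{l :: rat. 0 < l}. if av (of_rat l) x \<le> 1 then ennreal (of_rat l) else top)" (is "?l = ?r") for x
  proof (rule antisym)
    show "?l \<le> ?r"
    proof (rule INF_greatest)
      fix l :: rat assume "l \<in> {l. 0 < l}"
      then show "?l \<le> (if av (of_rat l) x \<le> 1 then ennreal (of_rat l) else top)"
        by (auto simp: admissible_def av_def intro!: orlicz_norm_le)
    qed
    show "?r \<le> ?l" unfolding orlicz_norm_admissible
    proof (rule Inf_greatest, clarify)
      fix l :: real assume "admissible \<Phi> Q (\<lambda>y. op_norm (A x ** B y)) l"
      then have l: "0 < l" "av l x \<le> 1" by (auto simp: admissible_def av_def)
      show "?r \<le> ennreal l"
      proof (rule ennreal_le_epsilon)
        fix e :: real assume e: "0 < e"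
        then obtain l' where l': "l < of_rat l'" "of_rat l' < l + e" using of_rat_dense[of l "l + e"] by auto
        have l'0: "0 < (of_rat l' :: real)" using l l' by linarith
        have "av (of_rat l') x \<le> av l x" unfolding av_def
          using l l' l'0 by (intro average_mono ennreal_leI mo) (auto intro!: divide_left_mono divide_nonneg_pos mult_pos_pos)
        then have "av (of_rat l') x \<le> 1" using l(2) by simp
        then have "?r \<le> ennreal (of_rat l')"
          by (intro INF_lower2[of l']) (use l'0 in \<open>auto simp: zero_less_of_rat_iff\<close>)
        also have "\<dots> \<le> ennreal l + ennreal e" using l' l e by (simp flip: ennreal_plus)
        finally show "?r \<le> ennreal l + ennreal e" .
      qed
    qed
  qed
  moreover have "(\<lambda>x. INF l\<in>{l :: rat. 0 < l}. if av (of_rat l) x \<le> 1 then ennreal (of_rat l) else top) \<in> borel_measurable lebesgue"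
  proof (rule borel_measurable_INF)
    fix l :: rat assume "l \<in> {l. 0 < l}"
    then have [measurable]: "av (of_rat l) \<in> borel_measurable lebesgue" by (intro av) (simp add: zero_less_of_rat_iff)
    show "(\<lambda>x. if av (of_rat l) x \<le> 1 then ennreal (of_rat l) else top) \<in> borel_measurable lebesgue" by measurable
  qed (rule countable_subset[OF subset_UNIV], simp)
  ultimately show ?thesis by simp
qed

lemma kernel_average_holder:
  fixes A B :: "real^'d \<Rightarrow> complex^'n^'n" and f :: "real^'d \<Rightarrow> complex^'n"
  assumes Y: "young_function \<Phi>" and Q: "Q \<in> cubes"
    and [measurable]: "A \<in> borel_measurable lebesgue" "B \<in> borel_measurable lebesgue" "f \<in> borel_measurable lebesgue"
    and bd: "\<And>y. norm (f y) \<le> k"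
    and fin: "orlicz_norm \<Phi> Q (\<lambda>y. op_norm (A x ** B y)) < \<infinity>"
  shows "kernel_average \<delta> A B Q f x \<le> ennreal (2 * vol Q powr \<delta> * enn2real (orlicz_norm (young_associate \<Phi>) Q (\<lambda>y. norm (f y))))
     * orlicz_norm \<Phi> Q (\<lambda>y. op_norm (A x ** B y))"
proof -
  define a where "a = enn2real (orlicz_norm \<Phi> Q (\<lambda>y. op_norm (A x ** B y)))"
  define b where "b = enn2real (orlicz_norm (young_associate \<Phi>) Q (\<lambda>y. norm (f y)))"
  have a: "orlicz_norm \<Phi> Q (\<lambda>y. op_norm (A x ** B y)) = ennreal a" "0 \<le> a"
    using fin by (auto simp: a_def less_top)
  have "orlicz_norm (young_associate \<Phi>) Q (\<lambda>y. norm (f y)) < \<infinity>"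
    by (rule orlicz_norm_bounded[OF Y Q, of _ k]) (use bd in simp)
  then have b: "orlicz_norm (young_associate \<Phi>) Q (\<lambda>y. norm (f y)) = ennreal b" "0 \<le> b"
    by (auto simp: b_def less_top)
  have "average Q (\<lambda>y. ennreal (norm (A x *v (B y *v f y)))) \<le> average Q (\<lambda>y. ennreal (op_norm (A x ** B y) * norm (f y)))"
    by (intro average_mono ennreal_leI) (simp add: matrix_vector_mul_assoc norm_le_op_norm)
  also have "\<dots> \<le> ennreal (2 * a * b)"
    by (rule orlicz_holder[OF Y Q _ _ _ _ a b]) (auto simp: op_norm_nonneg)
  finally have "ennreal (vol Q powr \<delta>) * average Q (\<lambda>y. ennreal (norm (A x *v (B y *v f y))))
      \<le> ennreal (vol Q powr \<delta>) * ennreal (2 * a * b)" by (intro mult_left_mono) auto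
  also have "\<dots> = ennreal (2 * vol Q powr \<delta> * b) * ennreal a"
    using a b by (simp add: mult_ac flip: ennreal_mult)
  finally show ?thesis unfolding kernel_average_eq_average[OF Q] a(1) b_def[symmetric] .
qed

text \<open>The weight constant in terms of the matrix functions that replace the powers of the weights.\<close>

definition pair_const :: "real \<Rightarrow> real \<Rightarrow> real \<Rightarrow> (real \<Rightarrow> real) \<Rightarrow> (real^'d \<Rightarrow> complex^'n^'n) \<Rightarrow> (real^'d \<Rightarrow> complex^'n^'n) \<Rightarrow> ennreal" where
  "pair_const \<delta> p q \<Phi> A B =
     (SUP Q\<in>cubes. ennreal (vol Q powr (\<delta> + 1 / q - 1 / p)) *
        ennpowr (average Q (\<lambda>x. ennpowr (orlicz_norm \<Phi> Q (\<lambda>y. op_norm (A x ** B y))) q)) (1 / q))"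

text \<open>The weight condition on a single cube, solved for the \<open>q\<close>-th moment.\<close>

lemma pair_const_testing:
  fixes A B :: "real^'d \<Rightarrow> complex^'n^'n"
  assumes q: "0 < q" and Q: "Q \<in> cubes" and W: "pair_const \<delta> p q \<Phi> A B \<le> ennreal W" "0 \<le> W"
  shows "(\<integral>\<^sup>+x\<in>Q. ennpowr (orlicz_norm \<Phi> Q (\<lambda>y. op_norm (A x ** B y))) q \<partial>lebesgue)
     \<le> ennreal (W powr q * vol Q powr (q / p - \<delta> * q))"
proof -
  define G where "G = (\<lambda>x. ennpowr (orlicz_norm \<Phi> Q (\<lambda>y. op_norm (A x ** B y))) q)"
  define s where "s = \<delta> + 1 / q - 1 / p"
  have v: "0 < vol Q" by (rule vol_cube_pos[OF Q])
  have "ennreal (vol Q powr s) * ennpowr (average Q G) (1 / q) \<le> pair_const \<delta> p q \<Phi> A B"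
    unfolding pair_const_def G_def s_def by (rule SUP_upper[OF Q])
  also note W(1)
  finally have "ennpowr (ennreal (vol Q powr s) * ennpowr (average Q G) (1 / q)) q \<le> ennpowr (ennreal W) q"
    using q by (intro ennpowr_mono) auto
  then have "ennreal (vol Q powr (s * q)) * average Q G \<le> ennreal (W powr q)"
    using q W(2) by (simp add: ennpowr_mult ennpowr_ennpowr ennpowr_ennreal powr_powr)
  then have "ennreal (vol Q powr (q / p - \<delta> * q)) * (ennreal (vol Q powr (s * q)) * average Q G)
      \<le> ennreal (vol Q powr (q / p - \<delta> * q)) * ennreal (W powr q)" by (intro mult_left_mono) auto
  moreover have "ennreal (vol Q powr (q / p - \<delta> * q)) * (ennreal (vol Q powr (s * q)) * average Q G) = ennreal (vol Q) * average Q G"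
  proof -
    have "q / p - \<delta> * q + s * q = 1" using q by (simp add: s_def algebra_simps)
    then have "vol Q powr (q / p - \<delta> * q) * vol Q powr (s * q) = vol Q" using v by (simp flip: powr_add)
    then show ?thesis by (simp add: mult.assoc[symmetric] flip: ennreal_mult)
  qed
  ultimately show ?thesis
    unfolding nn_integral_eq_vol_average[OF Q] G_def[symmetric] by (simp add: mult.commute flip: ennreal_mult)
qed

text \<open>Sparse domination turns the supremum over nested cubes into a sum over a sparse family, where the weight condition is
  used cube by cube. The Orlicz norm in \<open>x\<close> is finite almost everywhere on each cube
  because its \<open>q\<close>-th moment is, so that Hoelder's inequality is available there.\<close>

lemma laminar_maximal_bound:
  fixes A B :: "real^'d \<Rightarrow> complex^'n^'n"
  assumes \<delta>: "0 \<le> \<delta>" and pq: "1 < p" "p \<le> q"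
    and Y: "young_function \<Phi>" "young_associate \<Phi> \<in> B_class p q"
    and A[measurable]: "A \<in> borel_measurable lebesgue" and B[measurable]: "B \<in> borel_measurable lebesgue"
    and W: "pair_const \<delta> p q \<Phi> A B < \<infinity>"
  obtains C :: real where "0 \<le> C"
    "\<And>F f k. \<lbrakk>finite F; F \<subseteq> cubes; almost_laminar F; f \<in> borel_measurable lebesgue;
        \<And>y. norm (f y) \<le> k; \<And>y. norm (B y *v f y) \<le> k; (\<integral>\<^sup>+x. ennreal (norm (f x) powr p) \<partial>lebesgue) < \<infinity>\<rbrakk> \<Longrightarrow>
      (\<integral>\<^sup>+x. ennpowr (SUP Q\<in>F. kernel_average \<delta> A B Q f x * indicator Q x) q \<partial>lebesgue)
       \<le> ennreal C * ennpowr (\<integral>\<^sup>+x. ennreal (norm (f x) powr p) \<partial>lebesgue) (q / p)"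
proof -
  let ?\<Psi> = "young_associate \<Phi>"
  have q: "0 < q" using pq by simp
  define W' where "W' = enn2real (pair_const \<delta> p q \<Phi> A B)"
  have W': "pair_const \<delta> p q \<Phi> A B \<le> ennreal W'" "0 \<le> W'" using W by (auto simp: W'_def less_top)
  have sc: "?\<Psi> c \<le> c * ?\<Psi> 1" if "0 \<le> c" "c \<le> 1" for c using young_associate_scale[OF Y(1) that, of 1] by simp
  obtain C0 :: real where C0: "0 \<le> C0" "\<And>(S :: (real^'d) set set) F. \<lbrakk>finite S; S \<subseteq> cubes; almost_laminar S; sparse S;
       F \<in> borel_measurable lebesgue; \<And>x. 0 \<le> F x; (\<integral>\<^sup>+x. ennreal (F x powr p) \<partial>lebesgue) < \<infinity>\<rbrakk> \<Longrightarrow>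
     (\<Sum>P\<in>S. ennreal (vol P powr (q / p) * enn2real (orlicz_norm ?\<Psi> P F) powr q))
       \<le> ennreal C0 * ennpowr (\<integral>\<^sup>+x. ennreal (F x powr p) \<partial>lebesgue) (q / p)"
    by (rule sparse_orlicz_sum[where 'd = 'd, OF young_associate_mono[OF Y(1)] young_associate_0[OF Y(1)] Y(2) sc pq]) blast+
  define K :: real where "K = real (2 * CARD('n)^3)"
  have K: "0 \<le> K" "of_nat (2 * CARD('n)^3) = ennreal K" unfolding K_def by (simp_all only: ennreal_of_nat_eq_real_of_nat of_nat_0_le_iff)
  define D where "D = (2 * K) powr q * W' powr q"
  show ?thesis
  proof (rule that[of "D * C0"])
    show "0 \<le> D * C0" using C0(1) by (simp add: D_def)
    fix F :: "(real^'d) set set" and f :: "real^'d \<Rightarrow> complex^'n" and k :: real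
    assume F: "finite F" "F \<subseteq> cubes" "almost_laminar F" and f[measurable]: "f \<in> borel_measurable lebesgue"
      and fk: "\<And>y. norm (f y) \<le> k" and gk: "\<And>y. norm (B y *v f y) \<le> k"
      and N: "(\<integral>\<^sup>+x. ennreal (norm (f x) powr p) \<partial>lebesgue) < \<infinity>"
    define g where "g y = B y *v f y" for y
    have g[measurable]: "g \<in> borel_measurable lebesgue" unfolding g_def by measurable
    have "mean_dot g P e < \<infinity>" if "P \<in> F" for P e
    proof -
      have "norm (dotp e (g y)) \<le> (\<Sum>i\<in>UNIV. norm (e $ i) * k)" for y
        unfolding dotp_def
        by (rule order_trans[OF norm_sum], rule sum_mono)
           (auto simp: norm_mult g_def intro!: mult_left_mono order_trans[OF Finite_Cartesian_Product.norm_nth_le gk])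
      then have "mean_dot g P e \<le> average P (\<lambda>_. ennreal (\<Sum>i\<in>UNIV. norm (e $ i) * k))"
        unfolding mean_dot_def by (intro average_mono ennreal_leI)
      also have "\<dots> < \<infinity>" using that F(2) by (subst average_const) auto
      finally show ?thesis .
    qed
    from sparse_domination[OF g this F]
    obtain S where S: "S \<subseteq> F" "sparse S"
      and dom: "\<And>Q. Q \<in> F \<Longrightarrow> \<exists>P\<in>S. Q \<subseteq> P \<and> (\<forall>A :: complex^'n^'n. average Q (\<lambda>y. ennreal (norm (A *v g y)))
        \<le> of_nat (2 * CARD('n)^3) * average P (\<lambda>y. ennreal (norm (A *v g y))))" by metis
    have Sc: "finite S" "S \<subseteq> cubes" "almost_laminar S"
      using S(1) F finite_subset almost_laminar_subset by (blast, blast, blast)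
    define a where "a P x = orlicz_norm \<Phi> P (\<lambda>y. op_norm (A x ** B y))" for P x
    define b where "b P = enn2real (orlicz_norm ?\<Psi> P (\<lambda>y. norm (f y)))" for P
    have am[measurable]: "a P \<in> borel_measurable lebesgue" if "P \<in> S" for P
      unfolding a_def using that Sc(2) by (intro orlicz_norm_measurable[OF Y(1) A B]) auto
    have test: "(\<integral>\<^sup>+x\<in>P. ennpowr (a P x) q \<partial>lebesgue) \<le> ennreal (W' powr q * vol P powr (q / p - \<delta> * q))" if "P \<in> S" for P
      unfolding a_def using that Sc(2) by (intro pair_const_testing[OF q _ W']) auto
    define c where "c P = (2 * K) powr q * (vol P powr (\<delta> * q) * b P powr q)" for P
    \<comment> \<open>Only finitely many cubes occur, so the exceptional set is null.\<close>
    have afin: "AE x in lebesgue. \<forall>P\<in>S. x \<in> P \<longrightarrow> a P x < \<infinity>"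
    proof (rule AE_finite_allI[OF Sc(1)])
      fix P assume P: "P \<in> S"
      then have [measurable]: "P \<in> sets lebesgue" using Sc(2) cube_sets by blast
      have "AE x in lebesgue. ennpowr (a P x) q * indicator P x \<noteq> \<infinity>"
        using am[OF P] test[OF P] by (intro nn_integral_PInf_AE) (auto simp: top_unique)
      then show "AE x in lebesgue. x \<in> P \<longrightarrow> a P x < \<infinity>"
        by eventually_elim (auto simp: less_top[symmetric] indicator_def)
    qed
    have pt: "AE x in lebesgue. ennpowr (SUP Q\<in>F. kernel_average \<delta> A B Q f x * indicator Q x) q
        \<le> (\<Sum>P\<in>S. ennreal (c P) * (ennpowr (a P x) q * indicator P x))"
      using afin
    proof eventually_elim
      case (elim x)
      show ?case
        unfolding ennpowr_SUP[OF q]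
      proof (rule SUP_least)
        fix Q assume Q: "Q \<in> F"
        show "ennpowr (kernel_average \<delta> A B Q f x * indicator Q x) q \<le> (\<Sum>P\<in>S. ennreal (c P) * (ennpowr (a P x) q * indicator P x))"
        proof (cases "x \<in> Q")
          case True
          obtain P where P: "P \<in> S" "Q \<subseteq> P" "\<And>A :: complex^'n^'n. average Q (\<lambda>y. ennreal (norm (A *v g y)))
              \<le> ennreal K * average P (\<lambda>y. ennreal (norm (A *v g y)))" using dom[OF Q] K(2) by metis
          have PQ: "P \<in> cubes" "Q \<in> cubes" using P(1) Sc(2) Q F(2) by auto
          have "vol Q \<le> vol P" unfolding vol_def
            using P(2) cube_lmeasurable[OF PQ(1)] cube_sets[OF PQ(2)] by (intro measure_mono_fmeasurable) auto
          then have "vol Q powr \<delta> \<le> vol P powr \<delta>" using vol_cube_pos[OF PQ(2)] \<delta> by (intro powr_mono2) auto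
          then have "kernel_average \<delta> A B Q f x \<le> ennreal (vol P powr \<delta>) * (ennreal K * average P (\<lambda>y. ennreal (norm (A x *v g y))))"
            unfolding kernel_average_eq_average[OF PQ(2)] g_def[symmetric] by (intro mult_mono P(3) ennreal_leI) auto
          also have "\<dots> = ennreal K * kernel_average \<delta> A B P f x"
            unfolding kernel_average_eq_average[OF PQ(1)] g_def[symmetric] by (simp add: mult_ac)
          also have "\<dots> \<le> ennreal K * (ennreal (2 * vol P powr \<delta> * b P) * a P x)"
            unfolding a_def b_def
            using elim P(1,2) True
            by (intro mult_left_mono kernel_average_holder[OF Y(1) PQ(1) A B f fk]) (auto simp: a_def)
          also have "\<dots> = ennreal (2 * K * (vol P powr \<delta> * b P)) * a P x"
            using K(1) by (subst mult.assoc[symmetric], subst ennreal_mult[symmetric]) (auto simp: b_def mult_ac)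
          finally have "ennpowr (kernel_average \<delta> A B Q f x) q \<le> ennpowr (ennreal (2 * K * (vol P powr \<delta> * b P)) * a P x) q"
            using q by (intro ennpowr_mono) auto
          also have "\<dots> = ennreal (c P) * (ennpowr (a P x) q * indicator P x)"
            using True P(2) K(1) by (auto simp: ennpowr_mult ennpowr_ennreal c_def powr_mult powr_powr b_def)
          also have "\<dots> \<le> (\<Sum>P\<in>S. ennreal (c P) * (ennpowr (a P x) q * indicator P x))"
            by (rule member_le_sum[OF P(1)]) (use Sc(1) in auto)
          finally show ?thesis using True by simp
        qed simp
      qed
    qed
    have "(\<integral>\<^sup>+x. ennpowr (SUP Q\<in>F. kernel_average \<delta> A B Q f x * indicator Q x) q \<partial>lebesgue)
        \<le> (\<integral>\<^sup>+x. (\<Sum>P\<in>S. ennreal (c P) * (ennpowr (a P x) q * indicator P x)) \<partial>lebesgue)"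
      by (rule nn_integral_mono_AE[OF pt])
    also have "\<dots> = (\<Sum>P\<in>S. ennreal (c P) * (\<integral>\<^sup>+x\<in>P. ennpowr (a P x) q \<partial>lebesgue))"
    proof -
      have m: "(\<lambda>x. ennpowr (a P x) q * indicator P x) \<in> borel_measurable lebesgue" if "P \<in> S" for P
      proof -
        have [measurable]: "P \<in> sets lebesgue" using that Sc(2) cube_sets by blast
        show ?thesis using am[OF that] by measurable
      qed
      then have "(\<integral>\<^sup>+x. (\<Sum>P\<in>S. ennreal (c P) * (ennpowr (a P x) q * indicator P x)) \<partial>lebesgue)
          = (\<Sum>P\<in>S. \<integral>\<^sup>+x. ennreal (c P) * (ennpowr (a P x) q * indicator P x) \<partial>lebesgue)"
      proof (intro nn_integral_sum)
        fix P assume "P \<in> S"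
        from m[OF this] show "(\<lambda>x. ennreal (c P) * (ennpowr (a P x) q * indicator P x)) \<in> borel_measurable lebesgue"
          by measurable
      qed
      also have "\<dots> = (\<Sum>P\<in>S. ennreal (c P) * (\<integral>\<^sup>+x\<in>P. ennpowr (a P x) q \<partial>lebesgue))"
        by (intro sum.cong refl nn_integral_cmult m)
      finally show ?thesis .
    qed
    also have "\<dots> \<le> (\<Sum>P\<in>S. ennreal (c P) * ennreal (W' powr q * vol P powr (q / p - \<delta> * q)))"
      by (intro sum_mono mult_left_mono test) auto
    also have "\<dots> = (\<Sum>P\<in>S. ennreal D * ennreal (vol P powr (q / p) * b P powr q))"
    proof (rule sum.cong[OF refl])
      fix P assume "P \<in> S"
      then have v: "0 < vol P" using Sc(2) vol_cube_pos by blast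
      have vv: "vol P powr (q / p) = vol P powr (\<delta> * q) * vol P powr (q / p - \<delta> * q)" by (simp flip: powr_add)
      have "c P * (W' powr q * vol P powr (q / p - \<delta> * q)) = D * (vol P powr (q / p) * b P powr q)"
        unfolding c_def D_def vv by (simp add: mult_ac)
      then show "ennreal (c P) * ennreal (W' powr q * vol P powr (q / p - \<delta> * q)) = ennreal D * ennreal (vol P powr (q / p) * b P powr q)"
        by (simp add: c_def D_def flip: ennreal_mult)
    qed
    also have "\<dots> = ennreal D * (\<Sum>P\<in>S. ennreal (vol P powr (q / p) * b P powr q))"
      by (rule sum_distrib_left[symmetric])
    also have "\<dots> \<le> ennreal D * (ennreal C0 * ennpowr (\<integral>\<^sup>+x. ennreal (norm (f x) powr p) \<partial>lebesgue) (q / p))"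
      unfolding b_def by (intro mult_left_mono C0(2)[OF Sc S(2)] N) auto
    also have "\<dots> = ennreal (D * C0) * ennpowr (\<integral>\<^sup>+x. ennreal (norm (f x) powr p) \<partial>lebesgue) (q / p)"
      using C0(1) by (simp add: D_def ennreal_mult mult.assoc)
    finally show "(\<integral>\<^sup>+x. ennpowr (SUP Q\<in>F. kernel_average \<delta> A B Q f x * indicator Q x) q \<partial>lebesgue)
       \<le> ennreal (D * C0) * ennpowr (\<integral>\<^sup>+x. ennreal (norm (f x) powr p) \<partial>lebesgue) (q / p)" .
  qed
qed

lemma finite_maximal_bound:
  fixes A B :: "real^'d \<Rightarrow> complex^'n^'n"
  assumes \<delta>: "0 \<le> \<delta>" "\<delta> < 1" and pq: "1 < p" "p \<le> q"
    and Y: "young_function \<Phi>" "young_associate \<Phi> \<in> B_class p q"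
    and A[measurable]: "A \<in> borel_measurable lebesgue" and B[measurable]: "B \<in> borel_measurable lebesgue"
    and W: "pair_const \<delta> p q \<Phi> A B < \<infinity>"
  obtains C :: real where "0 \<le> C"
    "\<And>F f k. \<lbrakk>finite F; F \<subseteq> cubes; f \<in> borel_measurable lebesgue;
        \<And>y. norm (f y) \<le> k; \<And>y. norm (B y *v f y) \<le> k; (\<integral>\<^sup>+x. ennreal (norm (f x) powr p) \<partial>lebesgue) < \<infinity>\<rbrakk> \<Longrightarrow>
      (\<integral>\<^sup>+x. ennpowr (SUP Q\<in>F. kernel_average \<delta> A B Q f x * indicator Q x) q \<partial>lebesgue)
       \<le> ennreal C * ennpowr (\<integral>\<^sup>+x. ennreal (norm (f x) powr p) \<partial>lebesgue) (q / p)"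
proof -
  have q: "0 < q" using pq by simp
  obtain C1 :: real where C1: "0 \<le> C1" "\<And>F f k. \<lbrakk>finite F; F \<subseteq> cubes; almost_laminar F; f \<in> borel_measurable lebesgue;
        \<And>y. norm (f y) \<le> k; \<And>y. norm (B y *v f y) \<le> k; (\<integral>\<^sup>+x. ennreal (norm (f x) powr p) \<partial>lebesgue) < \<infinity>\<rbrakk> \<Longrightarrow>
      (\<integral>\<^sup>+x. ennpowr (SUP Q\<in>F. kernel_average \<delta> A B Q f x * indicator Q x) q \<partial>lebesgue)
       \<le> ennreal C1 * ennpowr (\<integral>\<^sup>+x. ennreal (norm (f x) powr p) \<partial>lebesgue) (q / p)"
    by (rule laminar_maximal_bound[OF \<delta>(1) pq Y A B W]) blast+
  define K where "K = (6 ^ CARD('d)) powr (1 - \<delta>)"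
  define n where "n = card (UNIV :: 'd set set)"
  show ?thesis
  proof (rule that[of "real n * K powr q * C1"])
    show "0 \<le> real n * K powr q * C1" using C1(1) by simp
    fix \<Q> :: "(real^'d) set set" and f :: "real^'d \<Rightarrow> complex^'n" and k :: real
    assume \<Q>: "finite \<Q>" "\<Q> \<subseteq> cubes" and f[measurable]: "f \<in> borel_measurable lebesgue"
      and fk: "\<And>y. norm (f y) \<le> k" and gk: "\<And>y. norm (B y *v f y) \<le> k"
      and N: "(\<integral>\<^sup>+x. ennreal (norm (f x) powr p) \<partial>lebesgue) < \<infinity>"
    obtain F :: "'d set \<Rightarrow> (real^'d) set set" where F: "\<And>T. finite (F T)" "\<And>T. F T \<subseteq> cubes" "\<And>T. almost_laminar (F T)"
      and cov: "\<And>Q. Q \<in> \<Q> \<Longrightarrow> \<exists>T. \<exists>P\<in>F T. Q \<subseteq> P \<and> vol P \<le> 6 ^ CARD('d) * vol Q"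
      by (rule finite_cubes_laminar_cover[OF \<Q>]) blast
    define m where "m T x = ennpowr (SUP Q\<in>F T. kernel_average \<delta> A B Q f x * indicator Q x) q" for T x
    have mm: "m T \<in> borel_measurable lebesgue" for T
      unfolding m_def
      by (intro ennpowr_measurable borel_measurable_SUP borel_measurable_times_ennreal borel_measurable_indicator kernel_average_measurable A B f)
         (auto intro: countable_finite F(1) cube_sets subsetD[OF F(2)])
    have "(\<integral>\<^sup>+x. ennpowr (SUP Q\<in>\<Q>. kernel_average \<delta> A B Q f x * indicator Q x) q \<partial>lebesgue)
        \<le> (\<integral>\<^sup>+x. ennreal (K powr q) * (\<Sum>T\<in>UNIV. m T x) \<partial>lebesgue)"
    proof (rule nn_integral_mono, unfold ennpowr_SUP[OF q], rule SUP_least)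
      fix x Q assume Q: "Q \<in> \<Q>"
      show "ennpowr (kernel_average \<delta> A B Q f x * indicator Q x) q \<le> ennreal (K powr q) * (\<Sum>T\<in>UNIV. m T x)"
      proof (cases "x \<in> Q")
        case True
        obtain T P where P: "P \<in> F T" "Q \<subseteq> P" "vol P \<le> 6 ^ CARD('d) * vol Q" using cov[OF Q] by blast
        have PQ: "P \<in> cubes" "Q \<in> cubes" using P(1) F(2) Q \<Q>(2) by auto
        have v: "0 < vol P" "0 < vol Q" using PQ vol_cube_pos by auto
        have "vol P powr (1 - \<delta>) \<le> (6 ^ CARD('d) * vol Q) powr (1 - \<delta>)"
          using P(3) v \<delta> by (intro powr_mono2) auto
        also have "\<dots> = K * vol Q powr (1 - \<delta>)" unfolding K_def by (rule powr_mult)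
        finally have "1 / vol Q powr (1 - \<delta>) \<le> K * (1 / vol P powr (1 - \<delta>))" using v by (simp add: field_simps)
        then have "kernel_average \<delta> A B Q f x \<le> ennreal (K * (1 / vol P powr (1 - \<delta>))) *
            (\<integral>\<^sup>+y\<in>P. ennreal (norm ((A x ** B y) *v f y)) \<partial>lebesgue)"
          unfolding kernel_average_def using P(2)
          by (intro mult_mono ennreal_leI nn_integral_mono) (auto simp: indicator_def)
        also have "\<dots> = ennreal K * kernel_average \<delta> A B P f x"
          unfolding kernel_average_def by (subst ennreal_mult) (auto simp: K_def mult.assoc)
        finally have "ennpowr (kernel_average \<delta> A B Q f x * indicator Q x) q
            \<le> ennpowr (ennreal K * (kernel_average \<delta> A B P f x * indicator P x)) q"
          using True P(2) q by (intro ennpowr_mono) auto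
        also have "\<dots> = ennreal (K powr q) * ennpowr (kernel_average \<delta> A B P f x * indicator P x) q"
          by (simp only: ennpowr_mult) (simp add: ennpowr_ennreal K_def)
        also have "\<dots> \<le> ennreal (K powr q) * m T x"
          unfolding m_def ennpowr_SUP[OF q] by (intro mult_left_mono SUP_upper P(1)) auto
        also have "\<dots> \<le> ennreal (K powr q) * (\<Sum>T\<in>UNIV. m T x)"
          by (intro mult_left_mono member_le_sum) auto
        finally show ?thesis .
      qed simp
    qed
    also have "\<dots> = ennreal (K powr q) * (\<Sum>T\<in>UNIV. \<integral>\<^sup>+x. m T x \<partial>lebesgue)"
      using mm by (simp add: nn_integral_cmult nn_integral_sum borel_measurable_sum)
    also have "\<dots> \<le> ennreal (K powr q) * (\<Sum>T\<in>(UNIV :: 'd set set).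
        ennreal C1 * ennpowr (\<integral>\<^sup>+x. ennreal (norm (f x) powr p) \<partial>lebesgue) (q / p))"
      unfolding m_def by (intro mult_left_mono sum_mono C1(2)[OF F f fk gk N]) auto
    also have "\<dots> = ennreal (real n * K powr q * C1) * ennpowr (\<integral>\<^sup>+x. ennreal (norm (f x) powr p) \<partial>lebesgue) (q / p)"
      unfolding sum_constant n_def[symmetric] ennreal_of_nat_eq_real_of_nat
      using C1(1) by (simp add: ennreal_mult mult_ac)
    finally show "(\<integral>\<^sup>+x. ennpowr (SUP Q\<in>\<Q>. kernel_average \<delta> A B Q f x * indicator Q x) q \<partial>lebesgue)
       \<le> ennreal (real n * K powr q * C1) * ennpowr (\<integral>\<^sup>+x. ennreal (norm (f x) powr p) \<partial>lebesgue) (q / p)" .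
  qed
qed

text \<open>One monotone limit does both truncations: at stage \<open>k\<close> only the rational cubes with index up to \<open>k\<close> are used, and
  \<open>f\<close> is cut off to the set where \<open>f\<close> and \<open>B f\<close> are bounded by \<open>k\<close>.\<close>

lemma rational_maximal_bound:
  fixes A B :: "real^'d \<Rightarrow> complex^'n^'n" and f :: "real^'d \<Rightarrow> complex^'n"
  assumes q: "0 < q"
    and A[measurable]: "A \<in> borel_measurable lebesgue" and B[measurable]: "B \<in> borel_measurable lebesgue"
    and f[measurable]: "f \<in> borel_measurable lebesgue"
    and bound: "\<And>F f' k. \<lbrakk>finite F; F \<subseteq> cubes; f' \<in> borel_measurable lebesgue; \<And>y. norm (f' y) \<le> norm (f y);
        \<And>y. norm (f' y) \<le> k; \<And>y. norm (B y *v f' y) \<le> k\<rbrakk> \<Longrightarrow>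
      (\<integral>\<^sup>+x. ennpowr (SUP Q\<in>F. kernel_average \<delta> A B Q f' x * indicator Q x) q \<partial>lebesgue) \<le> Z"
  shows "(\<integral>\<^sup>+x. ennpowr (SUP Q\<in>rational_cubes. kernel_average \<delta> A B Q f x * indicator Q x) q \<partial>lebesgue) \<le> Z"
proof -
  define R :: "nat \<Rightarrow> (real^'d) set" where "R = from_nat_into rational_cubes"
  have R: "range R = rational_cubes"
    unfolding R_def by (rule range_from_nat_into[OF rational_cubes_nonempty countable_rational_cubes])
  have Rc: "R i \<in> cubes" for i using R rational_cubes_subset by blast
  note [measurable] = cube_sets[OF Rc]
  define S where "S k = {y. norm (f y) \<le> real k \<and> norm (B y *v f y) \<le> real k}" for k :: nat
  have Sm[measurable]: "S k \<in> sets lebesgue" for k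
  proof -
    have "S k = {y \<in> space lebesgue. norm (f y) \<le> real k \<and> norm (B y *v f y) \<le> real k}" by (simp add: S_def)
    also have "\<dots> \<in> sets lebesgue" by measurable
    finally show ?thesis .
  qed
  define fk where "fk k y = (if y \<in> S k then f y else 0)" for k y
  have fkm[measurable]: "fk k \<in> borel_measurable lebesgue" for k unfolding fk_def by measurable
  have mono: "kernel_average \<delta> A B (R i) (fk k) x \<le> kernel_average \<delta> A B (R i) (fk k') x" if "k \<le> k'" for i k k' x
  proof -
    have "S k \<subseteq> S k'" using that by (auto simp: S_def intro: order_trans)
    then show ?thesis unfolding kernel_average_def
      by (intro mult_left_mono nn_integral_mono mult_right_mono ennreal_leI) (auto simp: fk_def)
  qed
  have conv: "kernel_average \<delta> A B (R i) f x = (SUP k. kernel_average \<delta> A B (R i) (fk k) x)" for i x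
  proof -
    have inc: "incseq (\<lambda>k y. ennreal (norm ((A x ** B y) *v fk k y)) * indicator (R i) y)"
    proof (intro incseq_SucI le_funI mult_right_mono ennreal_leI)
      fix k y
      have "S k \<subseteq> S (Suc k)" by (auto simp: S_def)
      then show "norm ((A x ** B y) *v fk k y) \<le> norm ((A x ** B y) *v fk (Suc k) y)" by (auto simp: fk_def)
    qed auto
    have pw: "ennreal (norm ((A x ** B y) *v f y)) * indicator (R i) y
        = (SUP k. ennreal (norm ((A x ** B y) *v fk k y)) * indicator (R i) y)" for y
    proof (rule antisym)
      obtain k where "norm (f y) + norm (B y *v f y) \<le> real k" using real_arch_simple by blast
      then have "norm (f y) \<le> real k" "norm (B y *v f y) \<le> real k"
        using norm_ge_zero[of "f y"] norm_ge_zero[of "B y *v f y"] by linarith+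
      then have "y \<in> S k" by (simp add: S_def)
      then have "ennreal (norm ((A x ** B y) *v f y)) * indicator (R i) y = ennreal (norm ((A x ** B y) *v fk k y)) * indicator (R i) y"
        by (simp add: fk_def)
      also have "\<dots> \<le> (SUP k. ennreal (norm ((A x ** B y) *v fk k y)) * indicator (R i) y)" by (rule SUP_upper) simp
      finally show "ennreal (norm ((A x ** B y) *v f y)) * indicator (R i) y
        \<le> (SUP k. ennreal (norm ((A x ** B y) *v fk k y)) * indicator (R i) y)" .
      show "(SUP k. ennreal (norm ((A x ** B y) *v fk k y)) * indicator (R i) y) \<le> ennreal (norm ((A x ** B y) *v f y)) * indicator (R i) y"
        by (intro SUP_least mult_right_mono ennreal_leI) (auto simp: fk_def)
    qed
    have [measurable]: "(\<lambda>y. A x ** B y) \<in> borel_measurable lebesgue" by measurable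
    show ?thesis
      unfolding kernel_average_def pw SUP_mult_left_ennreal[symmetric]
      by (subst nn_integral_monotone_convergence_SUP[OF inc]) auto
  qed
  define h where "h k x = (SUP Q\<in>R ` {..k}. kernel_average \<delta> A B Q (fk k) x * indicator Q x)" for k x
  have hm[measurable]: "h k \<in> borel_measurable lebesgue" for k
    unfolding h_def
    by (intro borel_measurable_SUP borel_measurable_times_ennreal borel_measurable_indicator kernel_average_measurable A B fkm)
       (auto simp: Rc cube_sets)
  have hinc: "h k x \<le> h k' x" if "k \<le> k'" for k k' x
    unfolding h_def
  proof (rule SUP_least)
    fix Q assume Q: "Q \<in> R ` {..k}"
    then have "kernel_average \<delta> A B Q (fk k) x * indicator Q x \<le> kernel_average \<delta> A B Q (fk k') x * indicator Q x"
      using mono[OF that] by (intro mult_right_mono) auto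
    also have "\<dots> \<le> (SUP Q\<in>R ` {..k'}. kernel_average \<delta> A B Q (fk k') x * indicator Q x)"
      using Q that by (intro SUP_upper) auto
    finally show "kernel_average \<delta> A B Q (fk k) x * indicator Q x
        \<le> (SUP Q\<in>R ` {..k'}. kernel_average \<delta> A B Q (fk k') x * indicator Q x)" .
  qed
  have le: "(SUP Q\<in>rational_cubes. kernel_average \<delta> A B Q f x * indicator Q x) \<le> (SUP k. h k x)" for x
    unfolding R[symmetric]
  proof (rule SUP_least, clarify)
    fix i
    have "kernel_average \<delta> A B (R i) f x * indicator (R i) x = (SUP k. kernel_average \<delta> A B (R i) (fk k) x * indicator (R i) x)"
      unfolding conv by (rule SUP_mult_right_ennreal)
    also have "\<dots> \<le> (SUP k. h k x)"
    proof (rule SUP_least)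
      fix k
      have "kernel_average \<delta> A B (R i) (fk k) x * indicator (R i) x \<le> kernel_average \<delta> A B (R i) (fk (max i k)) x * indicator (R i) x"
        by (intro mult_right_mono mono) auto
      also have "\<dots> \<le> h (max i k) x" unfolding h_def by (rule SUP_upper) auto
      also have "\<dots> \<le> (SUP k. h k x)" by (rule SUP_upper) simp
      finally show "kernel_average \<delta> A B (R i) (fk k) x * indicator (R i) x \<le> (SUP k. h k x)" .
    qed
    finally show "kernel_average \<delta> A B (R i) f x * indicator (R i) x \<le> (SUP k. h k x)" .
  qed
  have "(\<integral>\<^sup>+x. ennpowr (SUP Q\<in>rational_cubes. kernel_average \<delta> A B Q f x * indicator Q x) q \<partial>lebesgue)
      \<le> (\<integral>\<^sup>+x. (SUP k. ennpowr (h k x) q) \<partial>lebesgue)"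
    unfolding ennpowr_SUP[OF q, symmetric, of _ UNIV] using q by (intro nn_integral_mono ennpowr_mono le) auto
  also have "\<dots> = (SUP k. \<integral>\<^sup>+x. ennpowr (h k x) q \<partial>lebesgue)"
  proof (rule nn_integral_monotone_convergence_SUP)
    show "incseq (\<lambda>k x. ennpowr (h k x) q)"
      using q by (intro monoI le_funI ennpowr_mono hinc) auto
  qed measurable
  also have "\<dots> \<le> Z"
  proof (rule SUP_least)
    fix k
    show "(\<integral>\<^sup>+x. ennpowr (h k x) q \<partial>lebesgue) \<le> Z"
      unfolding h_def
    proof (rule bound)
      show "finite (R ` {..k})" "R ` {..k} \<subseteq> cubes" using Rc by auto
      show "norm (fk k y) \<le> norm (f y)" for y by (simp add: fk_def)
      show "norm (fk k y) \<le> real k" for y by (simp add: fk_def S_def)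
      show "norm (B y *v fk k y) \<le> real k" for y by (simp add: fk_def S_def)
    qed measurable
  qed
  finally show ?thesis .
qed

lemma orlicz_norm_cong_AE:
  assumes "AE y in lebesgue. f y = g y"
  shows "orlicz_norm \<Phi> Q f = orlicz_norm \<Phi> Q g"
proof -
  have "average Q (\<lambda>x. ennreal (\<Phi> (\<bar>f x\<bar> / l))) = average Q (\<lambda>x. ennreal (\<Phi> (\<bar>g x\<bar> / l)))" for l
    unfolding average_def using assms by (intro arg_cong2[where f = times] refl nn_integral_cong_AE) (auto elim!: eventually_mono)
  then show ?thesis by (simp add: orlicz_norm_def)
qed

theorem theorem1p6:
  fixes \<alpha> p q :: real and \<Phi> :: "real \<Rightarrow> real"
    and U V :: "real^'d \<Rightarrow> complex^'n^'n"
  assumes "0 \<le> \<alpha>" and "\<alpha> < real CARD('d)"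
    and "1 < p" and "p \<le> q"
    and "1 / p - 1 / q \<le> \<alpha> / real CARD('d)"
    and "young_function \<Phi>" and "young_associate \<Phi> \<in> B_class p q"
    and "matrix_weight U" and "matrix_weight V"
    and "weight_pair_const \<alpha> p q \<Phi> U V < \<infinity>"
  shows "\<exists>C::real. \<forall>f \<in> Lp_space p.
           frac_maximal \<alpha> p q U V f \<in> borel_measurable lebesgue \<and>
           Lp_norm q (frac_maximal \<alpha> p q U V f) \<le> ennreal C * Lp_norm p (\<lambda>x. ennreal (norm (f x)))"
proof -
  define \<delta> where "\<delta> = \<alpha> / real CARD('d)"
  have \<delta>: "0 \<le> \<delta>" "\<delta> < 1" using assms(1,2) by (auto simp: \<delta>_def)
  have p: "0 < p" and q: "0 < q" using assms(3,4) by auto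
  obtain A where A: "A \<in> borel_measurable lebesgue" "AE x in lebesgue. mat_powr (U x) (1 / q) = A x"
    by (rule matrix_weight_powr_measurable[OF assms(8)])
  obtain B where B: "B \<in> borel_measurable lebesgue" "AE y in lebesgue. mat_powr (V y) (- 1 / p) = B y"
    by (rule matrix_weight_powr_measurable[OF assms(9)])
  have "pair_const \<delta> p q \<Phi> A B = weight_pair_const \<alpha> p q \<Phi> U V"
  proof -
    have ae: "AE x in lebesgue. orlicz_norm \<Phi> Q (\<lambda>y. op_norm (A x ** B y))
        = orlicz_norm \<Phi> Q (\<lambda>y. op_norm (mat_powr (U x) (1 / q) ** mat_powr (V y) (- 1 / p)))" for Q
      using A(2)
    proof eventually_elim
      case (elim x)
      show ?case using B(2) by (intro orlicz_norm_cong_AE) (auto simp: elim elim!: eventually_mono)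
    qed
    have "average Q (\<lambda>x. ennpowr (orlicz_norm \<Phi> Q (\<lambda>y. op_norm (A x ** B y))) q)
        = average Q (\<lambda>x. ennpowr (orlicz_norm \<Phi> Q (\<lambda>y. op_norm (mat_powr (U x) (1 / q) ** mat_powr (V y) (- 1 / p)))) q)" for Q
      unfolding average_def using ae[of Q]
      by (intro arg_cong2[where f = times] refl nn_integral_cong_AE) (auto elim!: eventually_mono)
    then show ?thesis unfolding pair_const_def weight_pair_const_def \<delta>_def by simp
  qed
  then have W: "pair_const \<delta> p q \<Phi> A B < \<infinity>" using assms(10) by simp
  obtain C :: real where C: "0 \<le> C"
    "\<And>F f k. \<lbrakk>finite F; F \<subseteq> cubes; f \<in> borel_measurable lebesgue;
        \<And>y. norm (f y) \<le> k; \<And>y. norm (B y *v f y) \<le> k; (\<integral>\<^sup>+x. ennreal (norm (f x) powr p) \<partial>lebesgue) < \<infinity>\<rbrakk> \<Longrightarrow>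
      (\<integral>\<^sup>+x. ennpowr (SUP Q\<in>F. kernel_average \<delta> A B Q f x * indicator Q x) q \<partial>lebesgue)
       \<le> ennreal C * ennpowr (\<integral>\<^sup>+x. ennreal (norm (f x) powr p) \<partial>lebesgue) (q / p)"
    by (rule finite_maximal_bound[OF \<delta> assms(3,4,6,7) A(1) B(1) W]) blast+
  show ?thesis
  proof (intro exI[of _ "C powr (1 / q)"] ballI)
    fix f :: "real^'d \<Rightarrow> complex^'n" assume f: "f \<in> Lp_space p"
    define M where "M x = (SUP R\<in>rational_cubes. kernel_average \<delta> A B R f x * indicator R x)" for x
    have fm: "f \<in> borel_measurable lebesgue" using f by (simp add: Lp_space_def)
    define N where "N = (\<integral>\<^sup>+x. ennreal (norm (f x) powr p) \<partial>lebesgue)"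
    have LpN: "Lp_norm p (\<lambda>x. ennreal (norm (f x))) = ennpowr N (1 / p)"
      by (simp add: Lp_norm_def N_def ennpowr_ennreal)
    then have N: "N < \<infinity>" using f by (simp add: Lp_space_def ennpowr_less_top)
    have Mm: "M \<in> borel_measurable lebesgue"
      unfolding M_def using rational_cubes_subset cube_sets
      by (intro borel_measurable_SUP countable_rational_cubes borel_measurable_times_ennreal borel_measurable_indicator kernel_average_measurable A(1) B(1) fm) auto
    have MAE: "AE x in lebesgue. M x = frac_maximal \<alpha> p q U V f x"
      using A(2)
    proof eventually_elim
      case (elim x)
      have "kernel_average \<delta> A B Q f x = ennreal (1 / vol Q powr (1 - \<alpha> / real CARD('d))) *
        (\<integral>\<^sup>+y\<in>Q. ennreal (norm ((mat_powr (U x) (1 / q) ** mat_powr (V y) (- 1 / p)) *v f y)) \<partial>lebesgue)" for Q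
        unfolding kernel_average_def \<delta>_def using B(2)
        by (intro arg_cong2[where f = times] refl nn_integral_cong_AE) (auto simp: elim elim!: eventually_mono)
      then show ?case
        unfolding M_def maximal_eq_rational[OF \<delta>(2), symmetric] frac_maximal_def by simp
    qed
    have meas: "frac_maximal \<alpha> p q U V f \<in> borel_measurable lebesgue"
      by (rule borel_measurable_lebesgue_AE_cong[OF Mm MAE])
    have "(\<integral>\<^sup>+x. ennpowr (frac_maximal \<alpha> p q U V f x) q \<partial>lebesgue) = (\<integral>\<^sup>+x. ennpowr (M x) q \<partial>lebesgue)"
      using MAE by (intro nn_integral_cong_AE) (auto elim!: eventually_mono)
    also have "\<dots> \<le> ennreal C * ennpowr N (q / p)"
      unfolding M_def
    proof (rule rational_maximal_bound[OF q A(1) B(1) fm])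
      fix F :: "(real^'d) set set" and f' :: "real^'d \<Rightarrow> complex^'n" and k
      assume F: "finite F" "F \<subseteq> cubes" "f' \<in> borel_measurable lebesgue" and le: "\<And>y. norm (f' y) \<le> norm (f y)"
        and k: "\<And>y. norm (f' y) \<le> k" "\<And>y. norm (B y *v f' y) \<le> k"
      have le: "(\<integral>\<^sup>+x. ennreal (norm (f' x) powr p) \<partial>lebesgue) \<le> N"
        unfolding N_def using p le by (intro nn_integral_mono ennreal_leI powr_mono2) auto
      then have "(\<integral>\<^sup>+x. ennreal (norm (f' x) powr p) \<partial>lebesgue) < \<infinity>" using N by simp
      from C(2)[OF F k this]
      have "(\<integral>\<^sup>+x. ennpowr (SUP Q\<in>F. kernel_average \<delta> A B Q f' x * indicator Q x) q \<partial>lebesgue)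
         \<le> ennreal C * ennpowr (\<integral>\<^sup>+x. ennreal (norm (f' x) powr p) \<partial>lebesgue) (q / p)" .
      also have "\<dots> \<le> ennreal C * ennpowr N (q / p)"
        using p q by (intro mult_left_mono ennpowr_mono le) auto
      finally show "(\<integral>\<^sup>+x. ennpowr (SUP Q\<in>F. kernel_average \<delta> A B Q f' x * indicator Q x) q \<partial>lebesgue)
         \<le> ennreal C * ennpowr N (q / p)" .
    qed
    finally have "Lp_norm q (frac_maximal \<alpha> p q U V f) \<le> ennpowr (ennreal C * ennpowr N (q / p)) (1 / q)"
      unfolding Lp_norm_def using q by (intro ennpowr_mono) auto
    also have "\<dots> = ennreal (C powr (1 / q)) * Lp_norm p (\<lambda>x. ennreal (norm (f x)))"
      using C(1) q by (simp add: LpN ennpowr_mult ennpowr_ennpowr ennpowr_ennreal)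
    finally show "frac_maximal \<alpha> p q U V f \<in> borel_measurable lebesgue \<and>
       Lp_norm q (frac_maximal \<alpha> p q U V f) \<le> ennreal (C powr (1 / q)) * Lp_norm p (\<lambda>x. ennreal (norm (f x)))"
      using meas by blast
  qed
qed

end
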